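(* Let $D$ be a domain in $\mathbb R^n$, $n\ge2$, let $Q:D\to[0,\infty]$ be Lebesgue measurable, let $K\subset D$ be compact and $\delta>0$. Assume $Q$ satisfies the sphere-integrability condition in $D$. Then: (1) if $D$ is bounded, the family $\mathfrak F^{\delta}_{K,Q}(D)$ is equi-uniform on $K$ (and hence uniformly light on $K$); (2) if $Q\in L^1(D)$ and $f(x)\ne\infty$ for every $x\in D$ and every $f\in\mathfrak F^{\delta}_{K,Q}(D)$, then there exist constants $C,C_1>0$ such that $|f(x)-f(y)|\ge C_1\exp\Big\{-\frac{2\|Q\|_{L^1(D)}}{C|x-y|^n}\Big\}$ for all $x,y\in K$ and every $f\in\mathfrak F^{\delta}_{K,Q}(D)$.
   Context: $\overline{\mathbb R^n}=\mathbb R^n\cup\{\infty\}$ carries the chordal metric $h(x,y)=\frac{|x-y|}{\sqrt{1+|x|^2}\sqrt{1+|y|^2}}$, $h(x,\infty)=\frac{1}{\sqrt{1+|x|^2}}$; $h(E)=\sup_{x,y\in E}h(x,y)$, $h(E,F)=\inf_{x\in E,y\in F}h(x,y)$; boundaries are taken in $\overline{\mathbb R^n}$. Notation: $S(x_0,r)=\{|x-x_0|=r\}$, $A(x_0,r_1,r_2)=\{r_1<|x-x_0|<r_2\}$. $\Gamma(E,F,G)$ is the family of paths $\gamma:[a,b]\to\overline{\mathbb R^n}$ with $\gamma(a)\in E$, $\gamma(b)\in F$, $\gamma(t)\in G$ for $a<t<b$; $M$ is the conformal ($n$-)modulus of path families. Ring $Q$-inequality: with $Q$ extended by $0$ outside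 $D$, $f:D\to\overline{\mathbb R^n}$ satisfies it at $x_0\in D$ for radii in $(0,R)$ if $M(f(\Gamma(S(x_0,r_1),S(x_0,r_2),D)))\le\int_{A(x_0,r_1,r_2)\cap D}Q(x)\eta^n(|x-x_0|)\,dm(x)$ for all $0<r_1<r_2<R$ and all measurable $\eta:(r_1,r_2)\to[0,\infty]$ with $\int_{r_1}^{r_2}\eta\,dr\ge1$. Sphere-integrability condition: for each $x_0\in D$ and every $0<r_1<r_2<\sup_{x\in D}|x-x_0|$ there is a set $E_1\subset[r_1,r_2]$ of positive linear Lebesgue measure such that $Q$ is integrable with respect to $\mathcal H^{n-1}$ over $S(x_0,r)$ for every $r\in E_1$. $\mathfrak F^{\delta}_{K,Q}(D)$: the family of all homeomorphisms $f:D\to\overline{\mathbb R^n}$ satisfying the ring $Q$-inequality at every $x_0\in D$ for radii in $(0,\sup_{x\in D}|x-x_0|)$ and such that $h(f(K),\partial f(D))\ge\delta$. A family $\mathfrak F$ of maps $D\to\overline{\mathbb R^n}$ is equi-uniform on $K$ if for every $\varepsilon>0$ there is $\delta_1>0$ with $h(f(x),f(y))\ge\delta_1$ for all $f\in\mathfrak F$ and all $x,y\in K$ with $h(x,y)\ge\varepsilon$; it is uniformly light on $K$ if for every $\varepsilon>0$ there is $\delta_1>0$ with $h(f(C))\ge\delta_1$ for all $f\in\mathfrak F$ and all continua $C\subset K$ with $h(C)\ge\varepsilon$. *)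

theory Defs
  imports "HOL-Analysis.Analysis"
begin

section \<open>Extended space: \<open>'a option\<close>, with \<open>None\<close> playing the role of \<infinity>\<close>

definition chordal :: "'a::euclidean_space option \<Rightarrow> 'a option \<Rightarrow> real" where
  "chordal p q = (case (p, q) of
      (Some x, Some y) \<Rightarrow> norm (x - y) / (sqrt (1 + (norm x)\<^sup>2) * sqrt (1 + (norm y)\<^sup>2))
    | (Some x, None) \<Rightarrow> 1 / sqrt (1 + (norm x)\<^sup>2)
    | (None, Some y) \<Rightarrow> 1 / sqrt (1 + (norm y)\<^sup>2)
    | (None, None) \<Rightarrow> 0)"

definition ext_top :: "'a::euclidean_space option topology" where
  "ext_top = topology (\<lambda>U. \<forall>x\<in>U. \<exists>e>0. \<forall>y. chordal x y < e \<longrightarrow> y \<in> U)"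

definition chordal_diam :: "'a::euclidean_space option set \<Rightarrow> real" where
  "chordal_diam E = Sup {chordal x y | x y. x \<in> E \<and> y \<in> E}"

text \<open>A path is a pair (I, g): I a real interval, g continuous on I into the extended space.\<close>

definition variation :: "(real \<Rightarrow> 'a::euclidean_space) \<Rightarrow> real \<Rightarrow> real \<Rightarrow> ennreal" where
  "variation g c d = (SUP ts \<in> {ts. sorted ts \<and> ts \<noteq> [] \<and> hd ts = c \<and> last ts = d}.
       \<Sum>i<length ts - 1. ennreal (dist (g (ts ! Suc i)) (g (ts ! i))))"

definition seg_line_integral ::
    "('a::euclidean_space \<Rightarrow> ennreal) \<Rightarrow> (real \<Rightarrow> 'a) \<Rightarrow> real \<Rightarrow> real \<Rightarrow> ennreal" where
  "seg_line_integral \<rho> g c d =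
     (\<integral>\<^sup>+ t \<in> {c..d}. \<rho> (g t)
        \<partial>interval_measure (\<lambda>t. enn2real (variation g c (max c (min t d)))))"

definition finite_segment :: "real set \<Rightarrow> (real \<Rightarrow> 'a option) \<Rightarrow> real \<Rightarrow> real \<Rightarrow> bool" where
  "finite_segment I g c d \<longleftrightarrow> c \<le> d \<and> {c..d} \<subseteq> I \<and> (\<forall>t\<in>{c..d}. g t \<noteq> None)"

definition locally_rectifiable :: "real set \<times> (real \<Rightarrow> 'a::euclidean_space option) \<Rightarrow> bool" where
  "locally_rectifiable p \<longleftrightarrow>
     (\<forall>c d. finite_segment (fst p) (snd p) c d \<longrightarrow> variation (the \<circ> snd p) c d < \<infinity>)"

definition line_integral ::
    "('a::euclidean_space \<Rightarrow> ennreal) \<Rightarrow> real set \<times> (real \<Rightarrow> 'a option) \<Rightarrow> ennreal" where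
  "line_integral \<rho> p = (SUP F \<in> {F. finite F \<and> (\<forall>(c,d)\<in>F. finite_segment (fst p) (snd p) c d)
         \<and> (\<forall>(c,d)\<in>F. \<forall>(c',d')\<in>F. (c,d) \<noteq> (c',d') \<longrightarrow> {c..d} \<inter> {c'..d'} = {})}.
       \<Sum>(c,d)\<in>F. seg_line_integral \<rho> (the \<circ> snd p) c d)"

definition admissible ::
    "('a::euclidean_space \<Rightarrow> ennreal) \<Rightarrow> (real set \<times> (real \<Rightarrow> 'a option)) set \<Rightarrow> bool" where
  "admissible \<rho> \<Gamma> \<longleftrightarrow> \<rho> \<in> borel_measurable borel \<and>
     (\<forall>p\<in>\<Gamma>. locally_rectifiable p \<longrightarrow> line_integral \<rho> p \<ge> 1)"

definition modulus :: "(real set \<times> (real \<Rightarrow> 'a::euclidean_space option)) set \<Rightarrow> ennreal" where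
  "modulus \<Gamma> = (INF \<rho> \<in> {\<rho>. admissible \<rho> \<Gamma>}. \<integral>\<^sup>+ x. \<rho> x ^ DIM('a) \<partial>lborel)"

definition path_family ::
    "'a::euclidean_space option set \<Rightarrow> 'a option set \<Rightarrow> 'a option set
       \<Rightarrow> (real set \<times> (real \<Rightarrow> 'a option)) set" where
  "path_family E F G = {({a..b}, \<gamma>) | a b \<gamma>. a < b \<and>
       continuous_map (top_of_set {a..b}) ext_top \<gamma> \<and>
       \<gamma> a \<in> E \<and> \<gamma> b \<in> F \<and> (\<forall>t\<in>{a<..<b}. \<gamma> t \<in> G)}"

definition image_family ::
    "('a::euclidean_space \<Rightarrow> 'a option) \<Rightarrow> 'a set \<Rightarrow> (real set \<times> (real \<Rightarrow> 'a option)) set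
       \<Rightarrow> (real set \<times> (real \<Rightarrow> 'a option)) set" where
  "image_family f D \<Gamma> = {({t\<in>I. \<gamma> t \<in> Some ` D}, \<lambda>t. f (the (\<gamma> t))) | I \<gamma>. (I, \<gamma>) \<in> \<Gamma>}"

definition annulus :: "'a::euclidean_space \<Rightarrow> real \<Rightarrow> real \<Rightarrow> 'a set" where
  "annulus x0 r1 r2 = {x. r1 < dist x x0 \<and> dist x x0 < r2}"

definition ring_Q_ineq ::
    "('a::euclidean_space \<Rightarrow> 'a option) \<Rightarrow> 'a set \<Rightarrow> ('a \<Rightarrow> ennreal) \<Rightarrow> 'a \<Rightarrow> bool" where
  "ring_Q_ineq f D Q x0 \<longleftrightarrow>
     (\<forall>r1 r2. 0 < r1 \<and> r1 < r2 \<and> (\<exists>x\<in>D. r2 < dist x x0) \<longrightarrow>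
        (\<forall>\<eta> :: real \<Rightarrow> ennreal.
           \<eta> \<in> borel_measurable (restrict_space lebesgue {r1<..<r2}) \<and>
           (\<integral>\<^sup>+ r \<in> {r1<..<r2}. \<eta> r \<partial>lborel) \<ge> 1 \<longrightarrow>
           modulus (image_family f D
               (path_family (Some ` sphere x0 r1) (Some ` sphere x0 r2) (Some ` D)))
             \<le> (\<integral>\<^sup>+ x \<in> annulus x0 r1 r2 \<inter> D. Q x * \<eta> (dist x x0) ^ DIM('a) \<partial>lebesgue)))"

definition ring_family ::
    "real \<Rightarrow> 'a::euclidean_space set \<Rightarrow> ('a \<Rightarrow> ennreal) \<Rightarrow> 'a set \<Rightarrow> ('a \<Rightarrow> 'a option) set" where
  "ring_family \<delta> K Q D = {f.
       homeomorphic_map (top_of_set D) (subtopology ext_top (f ` D)) f \<and>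
       (\<forall>x0\<in>D. ring_Q_ineq f D Q x0) \<and>
       (\<forall>x\<in>K. \<forall>y\<in>ext_top frontier_of (f ` D). \<delta> \<le> chordal (f x) y)}"

definition hausdorff_delta :: "real \<Rightarrow> real \<Rightarrow> 'a::euclidean_space set \<Rightarrow> ennreal" where
  "hausdorff_delta s \<epsilon> E = (INF C \<in> {C :: nat \<Rightarrow> 'a set. E \<subseteq> (\<Union>i. C i) \<and>
         (\<forall>i. bounded (C i) \<and> diameter (C i) \<le> \<epsilon>)}.
       \<Sum>i. ennreal (pi powr (s/2) / Gamma (s/2 + 1) * (diameter (C i) / 2) powr s))"

definition hausdorff_outer :: "real \<Rightarrow> 'a::euclidean_space set \<Rightarrow> ennreal" where
  "hausdorff_outer s E = (SUP \<epsilon> \<in> {0<..}. hausdorff_delta s \<epsilon> E)"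

definition hausdorff_measure :: "real \<Rightarrow> 'a::euclidean_space measure" where
  "hausdorff_measure s = measure_of UNIV
     {A. \<forall>B. hausdorff_outer s B = hausdorff_outer s (B \<inter> A) + hausdorff_outer s (B - A)}
     (hausdorff_outer s)"

definition sphere_integrable_cond :: "'a::euclidean_space set \<Rightarrow> ('a \<Rightarrow> ennreal) \<Rightarrow> bool" where
  "sphere_integrable_cond D Q \<longleftrightarrow>
     (\<forall>x0\<in>D. \<forall>r1 r2. 0 < r1 \<and> r1 < r2 \<and> (\<exists>x\<in>D. r2 < dist x x0) \<longrightarrow>
        (\<exists>E1 \<subseteq> {r1..r2}. E1 \<in> sets lebesgue \<and> emeasure lebesgue E1 > 0 \<and>
          (\<forall>r\<in>E1. (\<lambda>x. indicator D x * Q x)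
                        \<in> borel_measurable (restrict_space (hausdorff_measure (real DIM('a) - 1)) (sphere x0 r))
                    \<and> (\<integral>\<^sup>+ x \<in> sphere x0 r. indicator D x * Q x
                           \<partial>hausdorff_measure (real DIM('a) - 1)) < \<infinity>)))"

definition equi_uniform :: "('a::euclidean_space \<Rightarrow> 'a option) set \<Rightarrow> 'a set \<Rightarrow> bool" where
  "equi_uniform \<F> K \<longleftrightarrow> (\<forall>\<epsilon>>0. \<exists>\<delta>1>0. \<forall>f\<in>\<F>. \<forall>x\<in>K. \<forall>y\<in>K.
      chordal (Some x) (Some y) \<ge> \<epsilon> \<longrightarrow> chordal (f x) (f y) \<ge> \<delta>1)"

definition uniformly_light :: "('a::euclidean_space \<Rightarrow> 'a option) set \<Rightarrow> 'a set \<Rightarrow> bool" where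
  "uniformly_light \<F> K \<longleftrightarrow> (\<forall>\<epsilon>>0. \<exists>\<delta>1>0. \<forall>f\<in>\<F>. \<forall>C.
      C \<subseteq> K \<and> C \<noteq> {} \<and> compact C \<and> connected C \<and> chordal_diam (Some ` C) \<ge> \<epsilon>
        \<longrightarrow> chordal_diam (f ` C) \<ge> \<delta>1)"

end

theory Submission
  imports Defs
begin

text \<open>
  Let \<open>E\<close> and \<open>F\<close> be connected subsets of \<open>D\<close>, with \<open>E\<close> in a ball \<open>B(w, r1)\<close> and \<open>F\<close> outside \<open>B(w, r2)\<close>,
  whose images both cross every sphere \<open>S(c, R)\<close>, \<open>R0 < R < R1\<close>, of \<open>f(D)\<close>. Joining the two images inside each
  of these spheres yields the lower bound \<open>c0 ln (R1 / R0)\<close> for the modulus of the image of the ring family, whereas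
  the ring inequality at \<open>w\<close> bounds this modulus from above. The cap of chordal radius \<open>s < \<delta>\<close> about \<open>f(x)\<close>, \<open>x \<in> K\<close>,
  lies in \<open>f(D)\<close>, so every ray from a point \<open>q\<close> with \<open>f(q)\<close> near \<open>f(x)\<close> contains a segment of \<open>D\<close>, starting at \<open>q\<close>,
  whose image leaves the cap.

  For the second part take \<open>E\<close> on the ray from \<open>x\<close> away from \<open>y\<close>, \<open>F\<close> on the ray from \<open>y\<close> away from \<open>x\<close>, and for \<open>w\<close> the
  midpoint of \<open>E\<close>; the weight \<open>1 / |x - y|\<close> gives the upper bound \<open>\<parallel>Q\<parallel> / |x - y|\<^sup>n\<close>.

  For the first part suppose \<open>f_m(x_m)\<close> and \<open>f_m(y_m)\<close> come together while \<open>x_m \<rightarrow> x0\<close>, \<open>y_m \<rightarrow> y0 \<noteq> x0\<close>. Sphere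
  integrability makes the upper bound finite for fixed \<open>w, r1, r2\<close>, and the set of points near which \<open>f_m\<close> collapses
  to \<open>f_m(x_m)\<close> is then open and closed in \<open>D\<close>. Hence \<open>f_m\<close> collapses on all of \<open>D\<close>, which fails on a segment running
  from a fixed point of \<open>D\<close> close to the boundary to the point where its image leaves the cap.
\<close>

section \<open>Polar coordinates with the cone measure\<close>

text \<open>All estimates must be uniform in \<open>f\<close>, while admissible densities are tested
  in the image, of which only the cap about \<open>f(x)\<close> is known. Test paths are therefore
  built there by hand, on spheres inside \<open>f(D)\<close>: two radially projected chords that
  meet at a vertex \<open>u\<close>, averaged over \<open>u\<close> in a small ball. Each such path
  is Lipschitz, so its line integral is bounded by a Lebesgue integral.

  Two obstacles shape the first part. The upper bound is finite for each ring but not uniformly in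
  its centre, so rings cannot be centred at the moving points \<open>x_m\<close>; limits and
  connectedness of \<open>D\<close> replace this. Boundedness of \<open>D\<close> provides the ray
  that leaves it.

  \<open>Q\<close> is integrable over spheres for a Hausdorff measure that is given only through
  covers. A comparison with the cone measure in one direction makes polar coordinates available for
  it.\<close>

lemma nn_integral_lborel_scaleR:
  fixes f :: "'a::euclidean_space \<Rightarrow> ennreal"
  assumes [measurable]: "f \<in> borel_measurable borel" and c: "c \<noteq> 0"
  shows "(\<integral>\<^sup>+x. f x \<partial>lborel) = ennreal (\<bar>c\<bar> ^ DIM('a)) * (\<integral>\<^sup>+x. f (t + c *\<^sub>R x) \<partial>lborel)"
  by (subst lborel_affine[OF c, of t])
     (simp add: nn_integral_density nn_integral_distr nn_integral_cmult)

text \<open>In \<open>nn_integral_polar\<close> a scaling variable \<open>s\<close> is integrated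
  over \<open>s > norm x\<close>; this value cancels the weight \<open>norm x ^ n\<close> and leaves
  the factor 1/n.\<close>

lemma nn_integral_inverse_power_tail:
  fixes a :: real and n :: nat
  assumes "a > 0" "n > 0"
  shows "(\<integral>\<^sup>+s. ennreal (if a < s then 1 / s ^ Suc n else 0) \<partial>lborel) = ennreal (1 / (n * a ^ n))"
proof -
  have "(\<integral>\<^sup>+s. ennreal (if a < s then 1 / s ^ Suc n else 0) \<partial>lborel)
      = (\<integral>\<^sup>+s. ennreal (1 / s ^ Suc n) * indicator {a..} s \<partial>lborel)"
  proof (rule nn_integral_cong_AE)
    have "AE s in lborel. s \<noteq> a" by (rule AE_lborel_singleton)
    then show "AE s in lborel. ennreal (if a < s then 1 / s ^ Suc n else 0) = ennreal (1 / s ^ Suc n) * indicator {a..} s"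
      by eventually_elim (auto simp: indicator_def)
  qed
  also have "\<dots> = 0 - (- 1 / (n * a ^ n))"
  proof (rule nn_integral_FTC_atLeast)
    fix s assume "a \<le> s"
    then have "s > 0" using assms by simp
    have "((\<lambda>s. - (1 / real n) * (inverse s) ^ n) has_real_derivative
       - (1 / real n) * (real n * (inverse s ^ (n - 1) * - (inverse s * 1 * inverse s)))) (at s)"
      using \<open>s > 0\<close> by (auto intro!: derivative_eq_intros simp: mult_ac)
    moreover have "- (1 / real n) * (real n * (inverse s ^ (n - 1) * - (inverse s * 1 * inverse s))) = 1 / s ^ Suc n"
      using assms \<open>s > 0\<close> by (cases n) (auto simp: field_simps)
    moreover have "(\<lambda>s::real. - (1 / real n) * (inverse s) ^ n) = (\<lambda>s. - 1 / (real n * s ^ n))"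
      by (auto simp: field_simps)
    ultimately show "((\<lambda>s. - 1 / (real n * s ^ n)) has_real_derivative 1 / s ^ Suc n) (at s)" by metis
    show "0 \<le> 1 / s ^ Suc n" using \<open>s > 0\<close> by simp
  next
    have "((\<lambda>s::real. - (1 / real n) * (inverse s) ^ n) \<longlongrightarrow> - (1 / real n) * 0 ^ n) at_top"
      by (intro tendsto_intros tendsto_inverse_0_at_top filterlim_ident)
    moreover have "(\<lambda>s::real. - (1 / real n) * (inverse s) ^ n) = (\<lambda>s. - 1 / (real n * s ^ n))"
      by (auto simp: field_simps)
    ultimately show "((\<lambda>s. - 1 / (real n * s ^ n)) \<longlongrightarrow> 0) at_top"
      using assms by (simp add: power_0_left)
  qed measurable
  finally show ?thesis by simp
qed

text \<open>The surface measure of the unit sphere, divided by the dimension.\<close>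

definition cone_measure :: "'a::euclidean_space measure" where
  "cone_measure = distr (density lborel (indicator (ball 0 1))) borel sgn"

lemma borel_measurable_sgn_vector [measurable]:
  "(sgn :: 'a::euclidean_space \<Rightarrow> 'a) \<in> borel_measurable borel"
  unfolding sgn_div_norm[abs_def] by measurable

lemma ball_in_sets_borel [measurable]: "ball (a::'a::euclidean_space) r \<in> sets borel"
  by simp

lemma sets_cone_measure [simp, measurable_cong]: "sets cone_measure = sets borel"
  by (simp add: cone_measure_def)

lemma space_cone_measure [simp]: "space cone_measure = UNIV"
  by (simp add: cone_measure_def)

lemma nn_integral_cone_measure:
  fixes f :: "'a::euclidean_space \<Rightarrow> ennreal"
  assumes [measurable]: "f \<in> borel_measurable borel"
  shows "(\<integral>\<^sup>+x. f x \<partial>cone_measure) = (\<integral>\<^sup>+u. indicator (ball 0 1) u * f (sgn u) \<partial>lborel)"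
proof -
  have [measurable]: "indicator (ball (0::'a) 1) \<in> (borel_measurable borel :: ('a \<Rightarrow> ennreal) set)"
    by (intro borel_measurable_indicator) auto
  show ?thesis
    unfolding cone_measure_def by (subst nn_integral_distr, simp, simp, subst nn_integral_density) auto
qed

lemma sigma_finite_cone_measure: "sigma_finite_measure (cone_measure :: ('a::euclidean_space) measure)"
proof -
  have "emeasure (cone_measure :: ('a) measure) UNIV = (\<integral>\<^sup>+(x::'a). indicator UNIV x \<partial>cone_measure)"
    by (subst nn_integral_indicator) auto
  also have "\<dots> = (\<integral>\<^sup>+(u::'a). indicator (ball 0 1) u \<partial>lborel)"
    by (subst nn_integral_cone_measure) auto
  also have "\<dots> = emeasure lborel (ball (0::'a) 1)" by simp
  also have "\<dots> < \<infinity>" by (simp add: emeasure_ball)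
  finally have "finite_measure (cone_measure :: ('a) measure)" by (intro finite_measureI) auto
  then show ?thesis by (simp add: finite_measure_def)
qed

text \<open>The substitution \<open>r = norm u * s\<close> trades the direction \<open>sgn u\<close>
  for \<open>u\<close> itself, so that after Fubini the volume variable can be rescaled by
  \<open>s\<close>.\<close>

lemma nn_integral_radial:
  fixes f :: "'a::euclidean_space \<Rightarrow> ennreal" and u :: 'a
  assumes [measurable]: "f \<in> borel_measurable borel" and "u \<noteq> 0"
  shows "(\<integral>\<^sup>+r. ennreal (indicator {0<..} r * r ^ (DIM('a) - 1)) * f (r *\<^sub>R sgn u) \<partial>lborel)
       = (\<integral>\<^sup>+s. ennreal (indicator {0<..} s * s ^ (DIM('a) - 1) * norm u ^ DIM('a)) * f (s *\<^sub>R u) \<partial>lborel)"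
proof -
  obtain k where k: "DIM('a) = Suc k" using DIM_positive[where 'a='a] by (cases "DIM('a)") auto
  have "(\<integral>\<^sup>+r. ennreal (indicator {0<..} r * r ^ k) * f (r *\<^sub>R sgn u) \<partial>lborel)
     = ennreal \<bar>norm u\<bar> * (\<integral>\<^sup>+s. ennreal (indicator {0<..} (0 + norm u * s) * (0 + norm u * s) ^ k) * f ((0 + norm u * s) *\<^sub>R sgn u) \<partial>lborel)"
    using assms by (intro nn_integral_real_affine) auto
  also have "\<dots> = (\<integral>\<^sup>+s. ennreal (norm u) * (ennreal (indicator {0<..} (0 + norm u * s) * (0 + norm u * s) ^ k) * f ((0 + norm u * s) *\<^sub>R sgn u)) \<partial>lborel)"
    by (subst nn_integral_cmult) auto
  also have "\<dots> = (\<integral>\<^sup>+s. ennreal (indicator {0<..} s * s ^ k * norm u ^ Suc k) * f (s *\<^sub>R u) \<partial>lborel)"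
  proof (rule nn_integral_cong)
    fix s :: real
    have *: "(0 + norm u * s) *\<^sub>R sgn u = s *\<^sub>R u" using assms by (simp add: sgn_div_norm)
    have "norm u * (norm u * s) ^ k = s ^ k * norm u ^ Suc k" by (simp add: power_mult_distrib)
    moreover have "0 < norm u * s \<longleftrightarrow> 0 < s" using assms by (simp add: zero_less_mult_iff)
    ultimately show "ennreal (norm u) * (ennreal (indicator {0<..} (0 + norm u * s) * (0 + norm u * s) ^ k) * f ((0 + norm u * s) *\<^sub>R sgn u))
        = ennreal (indicator {0<..} s * s ^ k * norm u ^ Suc k) * f (s *\<^sub>R u)"
      unfolding * by (simp add: indicator_def mult.assoc[symmetric] ennreal_mult'[symmetric] del: power_Suc)
  qed
  finally show ?thesis using k by simp
qed

text \<open>Unfolding \<open>cone_measure\<close> turns the right side into a double integral over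
  radii and points \<open>u\<close> of the unit ball. Substituting \<open>r = norm u * s\<close>,
  then \<open>x = s u\<close>, and integrating \<open>s\<close> out last gives the volume
  integral.\<close>

lemma nn_integral_polar:
  fixes f :: "'a::euclidean_space \<Rightarrow> ennreal"
  assumes f [measurable]: "f \<in> borel_measurable borel"
  shows "(\<integral>\<^sup>+x. f x \<partial>lborel) =
    of_nat DIM('a) * (\<integral>\<^sup>+r. ennreal (indicator {0<..} r * r ^ (DIM('a) - 1)) * (\<integral>\<^sup>+\<theta>. f (r *\<^sub>R \<theta>) \<partial>cone_measure) \<partial>lborel)"
proof -
  let ?n = "DIM('a)"
  let ?p = "\<lambda>r::real. ennreal (indicator {0<..} r * r ^ (?n - 1))"
  let ?q = "\<lambda>s (u::'a). ennreal (indicator {0<..} s * s ^ (?n - 1) * norm u ^ ?n)"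
  let ?k = "\<lambda>x s. ennreal (if norm x < s then 1 / s ^ Suc ?n else 0) * (ennreal (norm x ^ ?n) * f x)"
  obtain k where k: "?n = Suc k" using DIM_positive[where 'a='a] by (cases "DIM('a)") auto
  have "(\<integral>\<^sup>+r. ?p r * (\<integral>\<^sup>+\<theta>. f (r *\<^sub>R \<theta>) \<partial>cone_measure) \<partial>lborel)
     = (\<integral>\<^sup>+r. \<integral>\<^sup>+u. ?p r * (indicator (ball 0 1) u * f (r *\<^sub>R sgn u)) \<partial>lborel \<partial>lborel)"
    by (subst nn_integral_cone_measure, simp, subst nn_integral_cmult) auto
  also have "\<dots> = (\<integral>\<^sup>+u. \<integral>\<^sup>+r. ?p r * (indicator (ball 0 1) u * f (r *\<^sub>R sgn u)) \<partial>lborel \<partial>lborel)"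
    by (rule lborel_pair.Fubini') measurable
  also have "\<dots> = (\<integral>\<^sup>+u. \<integral>\<^sup>+s. ?q s u * (indicator (ball 0 1) u * f (s *\<^sub>R u)) \<partial>lborel \<partial>lborel)"
  proof (rule nn_integral_cong_AE)
    have "AE u::'a in lborel. u \<noteq> 0" by (rule AE_lborel_singleton)
    then show "AE u::'a in lborel. (\<integral>\<^sup>+r. ?p r * (indicator (ball 0 1) u * f (r *\<^sub>R sgn u)) \<partial>lborel)
       = (\<integral>\<^sup>+s. ?q s u * (indicator (ball 0 1) u * f (s *\<^sub>R u)) \<partial>lborel)"
    proof eventually_elim
      case (elim u)
      show ?case
      proof (cases "u \<in> ball 0 1")
        case True
        then show ?thesis using nn_integral_radial[OF f elim] by simp
      qed auto
    qed
  qed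
  also have "\<dots> = (\<integral>\<^sup>+s. \<integral>\<^sup>+u. ?q s u * (indicator (ball 0 1) u * f (s *\<^sub>R u)) \<partial>lborel \<partial>lborel)"
    by (rule lborel_pair.Fubini'[symmetric]) measurable
  \<comment> \<open>With \<open>x = s u\<close>, the condition \<open>norm u < 1\<close> becomes
    \<open>norm x < s\<close>, and the weight \<open>s ^ (n-1) * norm u ^ n\<close> times the
    Jacobian \<open>s ^ (-n)\<close> becomes \<open>norm x ^ n / s ^ (n+1)\<close>.\<close>
  also have "\<dots> = (\<integral>\<^sup>+s. \<integral>\<^sup>+x. ?k x s \<partial>lborel \<partial>lborel)"
  proof (rule nn_integral_cong)
    fix s :: real
    show "(\<integral>\<^sup>+u. ?q s u * (indicator (ball 0 1) u * f (s *\<^sub>R u)) \<partial>lborel)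
      = (\<integral>\<^sup>+x. ?k x s \<partial>lborel)"
    proof (cases "s > 0")
      case True
      have "(\<integral>\<^sup>+x. ?k x s \<partial>lborel)
        = ennreal (\<bar>s\<bar> ^ ?n) * (\<integral>\<^sup>+x. ennreal (if norm (0 + s *\<^sub>R x) < s then 1 / s ^ Suc ?n else 0) * (ennreal (norm (0 + s *\<^sub>R x) ^ ?n) * f (0 + s *\<^sub>R x)) \<partial>lborel)"
        using True by (intro nn_integral_lborel_scaleR) auto
      also have "\<dots> = (\<integral>\<^sup>+x. ennreal (s ^ ?n) * (ennreal (if norm (0 + s *\<^sub>R x) < s then 1 / s ^ Suc ?n else 0) * (ennreal (norm (0 + s *\<^sub>R x) ^ ?n) * f (0 + s *\<^sub>R x))) \<partial>lborel)"
        using True by (subst nn_integral_cmult) auto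
      also have "\<dots> = (\<integral>\<^sup>+u. ?q s u * (indicator (ball 0 1) u * f (s *\<^sub>R u)) \<partial>lborel)"
      proof (rule nn_integral_cong)
        fix x :: 'a
        have "s * norm x < s \<longleftrightarrow> norm x < 1" using True by auto
        moreover have "s ^ ?n * (1 / s ^ Suc ?n * (s * norm x) ^ ?n) = s ^ k * norm x ^ ?n"
          using True k by (simp add: field_simps power_mult_distrib)
        ultimately show "ennreal (s ^ ?n) * (ennreal (if norm (0 + s *\<^sub>R x) < s then 1 / s ^ Suc ?n else 0) * (ennreal (norm (0 + s *\<^sub>R x) ^ ?n) * f (0 + s *\<^sub>R x)))
          = ?q s x * (indicator (ball 0 1) x * f (s *\<^sub>R x))"
          using True k
          by (cases "norm x < 1")
             (simp_all add: indicator_def mult.assoc[symmetric] ennreal_mult'[symmetric] power_mult_distrib del: power_Suc)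
      qed
      finally show ?thesis by simp
    next
      case False
      have "\<not> norm x < s" for x :: 'a using False norm_ge_zero[of x] by linarith
      then show ?thesis using False by (simp add: indicator_def)
    qed
  qed
  also have "\<dots> = (\<integral>\<^sup>+x. \<integral>\<^sup>+s. ?k x s \<partial>lborel \<partial>lborel)"
    by (rule lborel_pair.Fubini'[symmetric]) measurable
  also have "\<dots> = (\<integral>\<^sup>+x. ennreal (1 / ?n) * f x \<partial>lborel)"
  proof (rule nn_integral_cong_AE)
    have "AE u::'a in lborel. u \<noteq> 0" by (rule AE_lborel_singleton)
    then show "AE x::'a in lborel. (\<integral>\<^sup>+s. ?k x s \<partial>lborel)
       = ennreal (1 / ?n) * f x"
    proof eventually_elim
      case (elim x)
      have "(\<integral>\<^sup>+s. ?k x s \<partial>lborel)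
        = (\<integral>\<^sup>+s. ennreal (if norm x < s then 1 / s ^ Suc ?n else 0) \<partial>lborel) * (ennreal (norm x ^ ?n) * f x)"
        by (rule nn_integral_multc) auto
      also have "\<dots> = ennreal (1 / (?n * norm x ^ ?n)) * (ennreal (norm x ^ ?n) * f x)"
        using elim by (subst nn_integral_inverse_power_tail) auto
      also have "\<dots> = ennreal (1 / ?n) * f x"
        using elim by (simp add: mult.assoc[symmetric] ennreal_mult'[symmetric])
      finally show ?case .
    qed
  qed
  also have "\<dots> = ennreal (1 / ?n) * (\<integral>\<^sup>+x. f x \<partial>lborel)" by (rule nn_integral_cmult) auto
  finally have *: "(\<integral>\<^sup>+r. ?p r * (\<integral>\<^sup>+\<theta>. f (r *\<^sub>R \<theta>) \<partial>cone_measure) \<partial>lborel)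
      = ennreal (1 / ?n) * (\<integral>\<^sup>+x. f x \<partial>lborel)" .
  have "ennreal ?n * ennreal (1 / ?n) = 1"
    by (subst ennreal_mult'[symmetric]) auto
  then show ?thesis
    unfolding * by (simp add: mult.assoc[symmetric] ennreal_of_nat_eq_real_of_nat)
qed

section \<open>A length-area estimate on spheres\<close>

lemma AE_cone_measure_norm: "AE \<theta>::'a::euclidean_space in cone_measure. norm \<theta> = 1"
proof -
  have "AE u::'a in lborel. u \<noteq> 0" by (rule AE_lborel_singleton)
  then have "AE u::'a in density lborel (indicator (ball 0 1)). norm (sgn u) = 1"
    by (subst AE_density, simp, eventually_elim) (auto simp: norm_sgn)
  then show ?thesis
    unfolding cone_measure_def by (subst AE_distr_iff) auto
qed

text \<open>\<open>G (sgn v)\<close> does not depend on the radius, so polar coordinates leave a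
  radial integral with \<open>r ^ (n-1)\<close> at most \<open>\<beta> ^ (n-1)\<close>. The lower
  radius may be negative, as \<open>1 - 3 * t\<close> can be in
  \<open>fibre_estimate\<close>.\<close>

lemma nn_integral_shell_le:
  fixes G :: "'a::euclidean_space \<Rightarrow> ennreal"
  assumes [measurable]: "G \<in> borel_measurable borel" and "\<alpha> \<le> \<beta>" "0 \<le> \<beta>"
  shows "(\<integral>\<^sup>+v. indicator {\<alpha>..\<beta>} (norm v) * G (sgn v) \<partial>lborel)
      \<le> of_nat DIM('a) * (ennreal (\<beta> ^ (DIM('a) - 1) * (\<beta> - \<alpha>)) * (\<integral>\<^sup>+\<theta>. G \<theta> \<partial>cone_measure))"
proof -
  let ?S = "\<lambda>r. \<integral>\<^sup>+\<theta>. indicator {\<alpha>..\<beta>} (norm (r *\<^sub>R \<theta>)) * G (sgn (r *\<^sub>R \<theta>)) \<partial>(cone_measure :: 'a measure)"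
  let ?p = "\<lambda>r::real. ennreal (indicator {0<..} r * r ^ (DIM('a) - 1))"
  let ?\<Psi> = "\<integral>\<^sup>+\<theta>. G \<theta> \<partial>cone_measure"
  have "(\<integral>\<^sup>+v. indicator {\<alpha>..\<beta>} (norm v) * G (sgn v) \<partial>lborel)
     = of_nat DIM('a) * (\<integral>\<^sup>+r. ?p r * ?S r \<partial>lborel)"
    by (rule nn_integral_polar) measurable
  also have "(\<integral>\<^sup>+r. ?p r * ?S r \<partial>lborel)
     \<le> (\<integral>\<^sup>+r. ennreal (\<beta> ^ (DIM('a) - 1)) * ?\<Psi> * indicator {\<alpha>..\<beta>} r \<partial>lborel)"
  proof (rule nn_integral_mono)
    fix r :: real
    show "?p r * ?S r
       \<le> ennreal (\<beta> ^ (DIM('a) - 1)) * ?\<Psi> * indicator {\<alpha>..\<beta>} r"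
    proof (cases "r > 0")
      case True
      have "?S r
         = (\<integral>\<^sup>+\<theta>. indicator {\<alpha>..\<beta>} r * G \<theta> \<partial>cone_measure)"
      proof (rule nn_integral_cong_AE)
        show "AE \<theta> in cone_measure. indicator {\<alpha>..\<beta>} (norm (r *\<^sub>R \<theta>)) * G (sgn (r *\<^sub>R \<theta>)) = indicator {\<alpha>..\<beta>} r * G \<theta>"
          using AE_cone_measure_norm[where 'a='a]
          by eventually_elim (use True in \<open>auto simp: sgn_div_norm\<close>)
      qed
      also have "\<dots> = indicator {\<alpha>..\<beta>} r * ?\<Psi>" by (rule nn_integral_cmult) simp
      finally have *: "?S r
         = indicator {\<alpha>..\<beta>} r * ?\<Psi>" .
      show ?thesis
      proof (cases "r \<in> {\<alpha>..\<beta>}")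
        case True
        then have "r ^ (DIM('a) - 1) \<le> \<beta> ^ (DIM('a) - 1)" using \<open>r > 0\<close> by (intro power_mono) auto
        then show ?thesis unfolding * using True \<open>r > 0\<close> by (auto intro!: mult_right_mono ennreal_leI)
      next
        case False
        then show ?thesis unfolding * by simp
      qed
    qed simp
  qed
  also have "\<dots> = ennreal (\<beta> ^ (DIM('a) - 1)) * ?\<Psi> * ennreal (\<beta> - \<alpha>)"
    using assms by (subst nn_integral_cmult_indicator) auto
  also have "\<dots> = ennreal (\<beta> ^ (DIM('a) - 1) * (\<beta> - \<alpha>)) * ?\<Psi>"
    using assms by (simp add: ennreal_mult' mult_ac)
  finally show ?thesis by (simp add: mult_left_mono)
qed

text \<open>Either \<open>x \<le> l\<close>, or \<open>x / l\<close> exceeds 1 and then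
  \<open>x \<le> x ^ n / l ^ (n-1)\<close>. This takes the place of Hoelder's inequality and also
  covers infinite values.\<close>

lemma ennreal_le_add_power:
  fixes x :: ennreal
  assumes "l > 0" "n > 0"
  shows "x \<le> ennreal l + ennreal (1 / l ^ (n - 1)) * x ^ n"
proof (cases x)
  case (real y)
  have "y \<le> l + 1 / l ^ (n - 1) * y ^ n"
  proof (cases "y \<le> l")
    case True
    have "0 \<le> 1 / l ^ (n - 1) * y ^ n" using assms real by auto
    then show ?thesis using True by linarith
  next
    case False
    then have "l ^ (n - 1) \<le> y ^ (n - 1)" using assms by (intro power_mono) auto
    then have "1 \<le> 1 / l ^ (n - 1) * y ^ (n - 1)" using assms by (simp add: field_simps)
    then have "y * 1 \<le> y * (1 / l ^ (n - 1) * y ^ (n - 1))" using real by (intro mult_left_mono) auto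
    also have "\<dots> = 1 / l ^ (n - 1) * y ^ n" using assms by (cases n) auto
    finally show ?thesis using assms by simp
  qed
  then have "ennreal y \<le> ennreal (l + 1 / l ^ (n - 1) * y ^ n)" by (rule ennreal_leI)
  also have "\<dots> = ennreal l + ennreal (1 / l ^ (n - 1)) * ennreal y ^ n"
    using assms real by (subst ennreal_plus, simp, simp, subst ennreal_mult') (auto simp: ennreal_power)
  finally show ?thesis using real by simp
next
  case top
  have "ennreal (1 / l ^ (n - 1)) * top = (top :: ennreal)"
    using assms by (simp add: ennreal_mult_eq_top_iff)
  then show ?thesis using assms top by (simp add: power_eq_top_ennreal)
qed

lemma nn_integral_powr_0_1:
  fixes n :: nat assumes "n > 0"
  shows "(\<integral>\<^sup>+t. ennreal (t powr (1 / n - 1)) * indicator {0..1} t \<partial>lborel) = of_nat n"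
proof -
  have "((\<lambda>t::real. t powr (1 / n - 1)) has_integral (1 powr (1 / n - 1 + 1) / (1 / n - 1 + 1))) {0..1}"
    using assms by (intro has_integral_powr_from_0) auto
  then have "((\<lambda>t::real. t powr (1 / n - 1)) has_integral real n) {0..1}" by simp
  from nn_integral_has_integral_lebesgue[OF _ this]
  show ?thesis by (simp add: ennreal_of_nat_eq_real_of_nat mult.commute ennreal_mult' ennreal_indicator)
qed

text \<open>\<open>G\<close> is integrated over the chord from \<open>a\<close> to \<open>u\<close>
  projected to the unit sphere, with respect to the chord parameter rather than arc length. The
  Lipschitz constant of the projected chord enters later, as the factor \<open>L\<close> of
  \<open>sphere_length_area\<close>.\<close>

abbreviation arc_integral :: "('a::euclidean_space \<Rightarrow> ennreal) \<Rightarrow> 'a \<Rightarrow> 'a \<Rightarrow> ennreal" where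
  "arc_integral G a u \<equiv> (\<integral>\<^sup>+t\<in>{0..1}. G (sgn ((1 - t) *\<^sub>R a + t *\<^sub>R u)) \<partial>lborel)"

text \<open>
  The points \<open>(1 - t) a + t u\<close>, \<open>u \<in> ball w (1/5)\<close>, fill a set of volume of order \<open>t\<^sup>n\<close> in a shell of thickness of
  order \<open>t\<close>, so \<open>x \<le> \<lambda> + x\<^sup>n / \<lambda>\<^sup>n\<^sup>-\<^sup>1\<close> with \<open>\<lambda> = \<kappa> t powr (1/n - 1)\<close> makes both terms integrable in \<open>t\<close>.
\<close>

lemma fibre_estimate:
  fixes G :: "'a::euclidean_space \<Rightarrow> ennreal" and a w :: 'a
  assumes G [measurable]: "G \<in> borel_measurable borel"
    and a: "norm a = 1" and w: "norm w = 1" and "\<kappa> > 0"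
  shows "(\<integral>\<^sup>+u\<in>ball w (1/5). arc_integral G a u \<partial>lborel)
    \<le> of_nat DIM('a) * (ennreal \<kappa> * emeasure lborel (ball w (1/5))
        + ennreal (6 * real DIM('a) * 4 ^ (DIM('a) - 1) / \<kappa> ^ (DIM('a) - 1)) * (\<integral>\<^sup>+\<theta>. G \<theta> ^ DIM('a) \<partial>cone_measure))"
proof -
  let ?n = "DIM('a)" and ?W = "ball w (1/5)"
  let ?\<Psi> = "\<integral>\<^sup>+\<theta>. G \<theta> ^ DIM('a) \<partial>cone_measure"
  \<comment> \<open>The shell met at time \<open>t\<close> has thickness \<open>6 * t\<close> and
    outer radius at most 4; the factor \<open>n\<close> comes from polar coordinates.\<close>
  let ?K = "6 * real ?n * 4 ^ (?n - 1)"
  let ?v = "\<lambda>t u. (1 - t) *\<^sub>R a + t *\<^sub>R u"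
  let ?B = "ennreal \<kappa> * emeasure lborel ?W + ennreal (?K / \<kappa> ^ (?n - 1)) * ?\<Psi>"
  have n: "?n > 0" by simp
  have 1: "(\<integral>\<^sup>+u. G (sgn (?v t u)) ^ ?n * indicator ?W u \<partial>lborel) \<le> ennreal (?K * t / t ^ ?n) * ?\<Psi>"
    if t: "0 < t" "t < 1" for t
  proof -
    have "(\<integral>\<^sup>+u. G (sgn (?v t u)) ^ ?n * indicator ?W u \<partial>lborel)
       \<le> (\<integral>\<^sup>+u. indicator {1 - 3 * t..1 + 3 * t} (norm (?v t u)) * G (sgn (?v t u)) ^ ?n \<partial>lborel)"
    proof (rule nn_integral_mono)
      fix u
      have "norm (?v t u) \<in> {1 - 3 * t..1 + 3 * t}" if "u \<in> ?W"
      proof -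
        have "norm (u - a) \<le> norm (u - w) + norm w + norm a"
          by (smt (verit) norm_triangle_ineq norm_triangle_ineq4 diff_add_cancel)
        also have "\<dots> \<le> 3" using that a w by (simp add: dist_norm norm_minus_commute)
        finally have "norm (t *\<^sub>R (u - a)) \<le> 3 * t" using t by simp
        moreover have "?v t u = a + t *\<^sub>R (u - a)" by (simp add: algebra_simps)
        ultimately show ?thesis using a norm_triangle_ineq[of a "t *\<^sub>R (u - a)"] norm_triangle_ineq4[of "?v t u" "t *\<^sub>R (u - a)"]
          by auto
      qed
      then show "G (sgn (?v t u)) ^ ?n * indicator ?W u \<le> indicator {1 - 3 * t..1 + 3 * t} (norm (?v t u)) * G (sgn (?v t u)) ^ ?n"
        by (auto simp: indicator_def)
    qed
    also have "\<dots> = ennreal (1 / t ^ ?n) * (\<integral>\<^sup>+v. indicator {1 - 3 * t..1 + 3 * t} (norm v) * G (sgn v) ^ ?n \<partial>lborel)"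
    proof -
      have "(\<integral>\<^sup>+v. indicator {1 - 3 * t..1 + 3 * t} (norm v) * G (sgn v) ^ ?n \<partial>lborel)
        = ennreal (\<bar>t\<bar> ^ ?n) * (\<integral>\<^sup>+u. indicator {1 - 3 * t..1 + 3 * t} (norm (?v t u)) * G (sgn (?v t u)) ^ ?n \<partial>lborel)"
        using t by (intro nn_integral_lborel_scaleR) auto
      then show ?thesis using t by (simp add: mult.assoc[symmetric] ennreal_mult'[symmetric])
    qed
    also have "\<dots> \<le> ennreal (1 / t ^ ?n) * (of_nat ?n * (ennreal ((1 + 3 * t) ^ (?n - 1) * (1 + 3 * t - (1 - 3 * t))) * ?\<Psi>))"
      using t by (intro mult_left_mono nn_integral_shell_le) auto
    also have "\<dots> = ennreal (1 / t ^ ?n * (?n * ((1 + 3 * t) ^ (?n - 1) * (6 * t)))) * ?\<Psi>"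
      using t by (simp add: mult.assoc[symmetric] ennreal_mult'[symmetric] ennreal_of_nat_eq_real_of_nat)
    also have "\<dots> \<le> ennreal (?K * t / t ^ ?n) * ?\<Psi>"
    proof (intro mult_right_mono ennreal_leI)
      have "(1 + 3 * t) ^ (?n - 1) \<le> 4 ^ (?n - 1)" using t by (intro power_mono) auto
      then have "1 / t ^ ?n * (?n * ((1 + 3 * t) ^ (?n - 1) * (6 * t))) \<le> 1 / t ^ ?n * (?n * (4 ^ (?n - 1) * (6 * t)))"
        using t by (intro mult_left_mono mult_right_mono) auto
      then show "1 / t ^ ?n * (?n * ((1 + 3 * t) ^ (?n - 1) * (6 * t))) \<le> ?K * t / t ^ ?n" by (simp add: mult_ac)
    qed simp
    finally show ?thesis .
  qed
  have 2: "(\<integral>\<^sup>+u. G (sgn (?v t u)) * indicator ?W u \<partial>lborel) \<le> ennreal (t powr (1 / ?n - 1)) * ?B"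
    if t: "0 < t" "t < 1" for t
  proof -
    \<comment> \<open>For this exponent \<open>l\<close> and \<open>t / (t ^ n * l ^ (n-1))\<close>
      carry the same power of \<open>t\<close>. The factor \<open>\<kappa>\<close> stays free until
      \<open>sphere_length_area\<close> uses it to absorb a term.\<close>
    define l where "l = \<kappa> * t powr (1 / ?n - 1)"
    have l: "l > 0" using t \<open>\<kappa> > 0\<close> by (simp add: l_def)
    have "(\<integral>\<^sup>+u. G (sgn (?v t u)) * indicator ?W u \<partial>lborel)
       \<le> (\<integral>\<^sup>+u. ennreal l * indicator ?W u + ennreal (1 / l ^ (?n - 1)) * (G (sgn (?v t u)) ^ ?n * indicator ?W u) \<partial>lborel)"
      using ennreal_le_add_power[OF l n] by (intro nn_integral_mono) (auto simp: indicator_def)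
    also have "\<dots> = ennreal l * emeasure lborel ?W + ennreal (1 / l ^ (?n - 1)) * (\<integral>\<^sup>+u. G (sgn (?v t u)) ^ ?n * indicator ?W u \<partial>lborel)"
      by (simp add: nn_integral_add nn_integral_cmult nn_integral_cmult_indicator)
    also have "\<dots> \<le> ennreal l * emeasure lborel ?W + ennreal (1 / l ^ (?n - 1)) * (ennreal (?K * t / t ^ ?n) * ?\<Psi>)"
      by (intro add_left_mono mult_left_mono 1 t) auto
    also have "\<dots> = ennreal (t powr (1 / ?n - 1)) * ?B"
    proof -
      have "l ^ (?n - 1) = \<kappa> ^ (?n - 1) * (t powr (1 / ?n - 1)) powr real (?n - 1)"
        using t by (simp only: l_def power_mult_distrib) (subst powr_realpow, auto)
      also have "(t powr (1 / ?n - 1)) powr real (?n - 1) = t powr (2 - 1 / ?n - ?n)"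
        using n by (simp add: powr_powr of_nat_diff field_simps)
      finally have l': "l ^ (?n - 1) = \<kappa> ^ (?n - 1) * t powr (2 - 1 / ?n - ?n)" .
      have tn: "t ^ ?n = t powr ?n" using t by (simp add: powr_realpow)
      have "1 / l ^ (?n - 1) * (?K * t / t ^ ?n) = ?K / \<kappa> ^ (?n - 1) * (t powr 1 / (t powr (2 - 1 / ?n - ?n) * t powr ?n))"
        unfolding l' tn using t by (simp add: field_simps)
      also have "t powr 1 / (t powr (2 - 1 / ?n - ?n) * t powr ?n) = t powr (1 - (2 - 1 / ?n - ?n + ?n))"
        by (simp only: powr_add powr_diff)
      also have "1 - (2 - 1 / ?n - ?n + ?n) = 1 / real ?n - 1" by simp
      finally have *: "1 / l ^ (?n - 1) * (?K * t / t ^ ?n) = t powr (1 / ?n - 1) * (?K / \<kappa> ^ (?n - 1))" by (simp add: mult.commute)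
      have "ennreal (1 / l ^ (?n - 1)) * (ennreal (?K * t / t ^ ?n) * ?\<Psi>) = ennreal (1 / l ^ (?n - 1) * (?K * t / t ^ ?n)) * ?\<Psi>"
        using l t by (subst ennreal_mult) (auto simp: mult_ac)
      also have "\<dots> = ennreal (t powr (1 / ?n - 1)) * (ennreal (?K / \<kappa> ^ (?n - 1)) * ?\<Psi>)"
        unfolding * using \<open>\<kappa> > 0\<close> by (subst ennreal_mult) (auto simp: mult_ac)
      finally show ?thesis
        using \<open>\<kappa> > 0\<close> by (simp add: l_def ennreal_mult distrib_left mult_ac)
    qed
    finally show ?thesis .
  qed
  have "(\<integral>\<^sup>+u\<in>?W. (\<integral>\<^sup>+t\<in>{0..1}. G (sgn (?v t u)) \<partial>lborel) \<partial>lborel)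
     = (\<integral>\<^sup>+u. (\<integral>\<^sup>+t. G (sgn (?v t u)) * indicator {0..1} t * indicator ?W u \<partial>lborel) \<partial>lborel)"
    by (subst nn_integral_multc) auto
  also have "\<dots> = (\<integral>\<^sup>+t. (\<integral>\<^sup>+u. G (sgn (?v t u)) * indicator {0..1} t * indicator ?W u \<partial>lborel) \<partial>lborel)"
    by (rule lborel_pair.Fubini') measurable
  also have "\<dots> \<le> (\<integral>\<^sup>+t. ?B * (ennreal (t powr (1 / ?n - 1)) * indicator {0..1} t) \<partial>lborel)"
  proof (rule nn_integral_mono_AE)
    have "AE t::real in lborel. t \<noteq> 0" "AE t::real in lborel. t \<noteq> 1" by (rule AE_lborel_singleton)+
    then show "AE t in lborel. (\<integral>\<^sup>+u. G (sgn (?v t u)) * indicator {0..1} t * indicator ?W u \<partial>lborel)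
        \<le> ?B * (ennreal (t powr (1 / ?n - 1)) * indicator {0..1} t)"
    proof eventually_elim
      case (elim t)
      then show ?case using 2[of t] by (cases "t \<in> {0..1}") (auto simp: mult_ac)
    qed
  qed
  also have "\<dots> = ?B * of_nat ?n"
    by (subst nn_integral_cmult) (auto simp: nn_integral_powr_0_1[OF n])
  finally show ?thesis by (simp add: mult.commute)
qed

text \<open>Averaging the hypothesis over all vertices \<open>u\<close> of the ball, by
  \<open>fibre_estimate\<close>, bounds the volume \<open>m\<close> of the ball by half of
  \<open>m\<close> plus a multiple of the integral of \<open>G ^ n\<close>. A fixed vertex would not
  do for \<open>n \<ge> 3\<close>, where a single arc is a null set of the sphere.\<close>

lemma sphere_length_area:
  "\<exists>c>0. \<forall>G\<in>borel_measurable (borel :: 'a::euclidean_space measure). \<forall>a b w L.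
      norm a = 1 \<and> norm b = 1 \<and> norm w = 1 \<and> L > 0 \<and>
      (\<forall>u\<in>ball w (1/5). 1 \<le> ennreal L * (arc_integral G a u
          + arc_integral G b u))
      \<longrightarrow> ennreal (c / L ^ DIM('a)) \<le> (\<integral>\<^sup>+\<theta>. G \<theta> ^ DIM('a) \<partial>cone_measure)"
proof -
  let ?n = "DIM('a)"
  define m where "m = unit_ball_vol (real ?n) * (1/5) ^ ?n"
  define K where "K = 6 * real ?n * 4 ^ (?n - 1)"
  define c where "c = m / (4 * ?n * K * (4 * ?n) ^ (?n - 1))"
  have m: "m > 0" by (simp add: m_def)
  have K: "K > 0" by (simp add: K_def)
  have c: "c > 0" using m K by (simp add: c_def)
  show ?thesis
  proof (intro exI[of _ c] conjI ballI allI impI, rule c)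
    fix G :: "'a \<Rightarrow> ennreal" and a b w :: 'a and L :: real
    assume [measurable]: "G \<in> borel_measurable borel"
    assume asm: "norm a = 1 \<and> norm b = 1 \<and> norm w = 1 \<and> L > 0 \<and>
      (\<forall>u\<in>ball w (1/5). 1 \<le> ennreal L * (arc_integral G a u
          + arc_integral G b u))"
    then have a: "norm a = 1" and b: "norm b = 1" and w: "norm w = 1" and L: "L > 0" by auto
    have *: "\<And>u. u \<in> ball w (1/5) \<Longrightarrow> 1 \<le> ennreal L * (arc_integral G a u
          + arc_integral G b u)" using asm by blast
    let ?W = "ball w (1/5)"
    let ?\<Psi> = "\<integral>\<^sup>+\<theta>. G \<theta> ^ DIM('a) \<partial>cone_measure"
    let ?I = "\<lambda>a u. \<integral>\<^sup>+t\<in>{0..1}. G (sgn ((1 - t) *\<^sub>R a + t *\<^sub>R u)) \<partial>lborel"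
    \<comment> \<open>Chosen so that the volume term \<open>2 * L * n * \<kappa> * m\<close> equals
      \<open>m / 2\<close> and can be absorbed on the left.\<close>
    define \<kappa> where "\<kappa> = 1 / (4 * ?n * L)"
    have \<kappa>: "\<kappa> > 0" using L by (simp add: \<kappa>_def)
    have em: "emeasure lborel ?W = ennreal m" by (simp add: emeasure_ball m_def)
    let ?B = "of_nat ?n * (ennreal \<kappa> * ennreal m + ennreal (K / \<kappa> ^ (?n - 1)) * ?\<Psi>)"
    have "ennreal m = (\<integral>\<^sup>+u. indicator ?W u \<partial>lborel)" using em by simp
    also have "\<dots> \<le> (\<integral>\<^sup>+u. ennreal L * (?I a u * indicator ?W u + ?I b u * indicator ?W u) \<partial>lborel)"
      using * by (intro nn_integral_mono) (auto simp: indicator_def)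
    also have "\<dots> = ennreal L * ((\<integral>\<^sup>+u\<in>?W. ?I a u \<partial>lborel) + (\<integral>\<^sup>+u\<in>?W. ?I b u \<partial>lborel))"
      by (subst nn_integral_cmult, measurable, subst nn_integral_add) auto
    also have "\<dots> \<le> ennreal L * (?B + ?B)"
      using fibre_estimate[of G a w \<kappa>] fibre_estimate[of G b w \<kappa>] a b w \<kappa>
      unfolding K_def[symmetric] em by (intro mult_left_mono add_mono) auto
    also have "\<dots> = ennreal (2 * L * ?n * \<kappa> * m) + ennreal (2 * L * ?n * K / \<kappa> ^ (?n - 1)) * ?\<Psi>"
    proof -
      let ?Y = "ennreal \<kappa> * ennreal m + ennreal (K / \<kappa> ^ (?n - 1)) * ?\<Psi>"
      have e: "ennreal (2 * L * ?n) = ennreal L * (2 * of_nat ?n)"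
        using L by (simp add: ennreal_mult' ennreal_of_nat_eq_real_of_nat mult_ac)
      have "ennreal L * (?B + ?B) = ennreal (2 * L * ?n) * ?Y"
        unfolding e by (simp only: mult_2[of "of_nat ?n"] distrib_right mult.assoc)
      also have "\<dots> = ennreal (2 * L * ?n) * ennreal (\<kappa> * m) + ennreal (2 * L * ?n) * ennreal (K / \<kappa> ^ (?n - 1)) * ?\<Psi>"
        using \<kappa> m by (simp add: distrib_left ennreal_mult mult.assoc)
      also have "ennreal (2 * L * ?n) * ennreal (\<kappa> * m) = ennreal (2 * L * ?n * \<kappa> * m)"
        using L \<kappa> m by (subst ennreal_mult[symmetric]) (auto simp: mult.assoc)
      also have "ennreal (2 * L * ?n) * ennreal (K / \<kappa> ^ (?n - 1)) = ennreal (2 * L * ?n * K / \<kappa> ^ (?n - 1))"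
        using L \<kappa> K by (subst ennreal_mult[symmetric]) auto
      finally show ?thesis .
    qed
    also have "2 * L * ?n * \<kappa> * m = m / 2" using L by (simp add: \<kappa>_def)
    finally have **: "ennreal m \<le> ennreal (m / 2) + ennreal (2 * L * ?n * K / \<kappa> ^ (?n - 1)) * ?\<Psi>" .
    show "ennreal (c / L ^ ?n) \<le> ?\<Psi>"
    proof (cases ?\<Psi>)
      case (real p)
      define A where "A = 2 * L * ?n * K / \<kappa> ^ (?n - 1)"
      have A: "A \<ge> 0" using L K \<kappa> by (simp add: A_def)
      have "ennreal (m / 2 + A * p) = ennreal (m / 2) + ennreal A * ennreal p"
        using A m real by (simp add: ennreal_plus ennreal_mult)
      then have "ennreal m \<le> ennreal (m / 2 + A * p)"
        using ** real by (simp add: A_def)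
      then have "m \<le> m / 2 + A * p"
        using A m real by (subst (asm) ennreal_le_iff) auto
      then have "m / 2 \<le> 2 * L * ?n * K * (4 * ?n * L) ^ (?n - 1) * p"
        by (simp add: A_def \<kappa>_def power_one_over field_simps)
      also have "\<dots> = 2 * ?n * K * (4 * ?n) ^ (?n - 1) * (L * L ^ (?n - 1)) * p"
        by (simp add: power_mult_distrib)
      also have "L * L ^ (?n - 1) = L ^ ?n" by (metis power_eq_if DIM_positive less_irrefl)
      finally have "c / L ^ ?n \<le> p" using L K by (simp add: c_def field_simps)
      then show ?thesis using real by (simp add: ennreal_leI)
    qed simp
  qed
qed

section \<open>Line integrals along Lipschitz paths\<close>

text \<open>The inner sum of \<open>variation\<close>, separated so that inequalities can be proved
  by induction on the partition.\<close>

definition polygon_length :: "(real \<Rightarrow> 'a::euclidean_space) \<Rightarrow> real list \<Rightarrow> ennreal" where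
  "polygon_length g ts = (\<Sum>i<length ts - 1. ennreal (dist (g (ts ! Suc i)) (g (ts ! i))))"

lemma polygon_length_simps [simp]:
  "polygon_length g [] = 0" "polygon_length g [x] = 0"
  "polygon_length g (x # y # r) = ennreal (dist (g y) (g x)) + polygon_length g (y # r)"
  by (simp_all add: polygon_length_def sum.lessThan_Suc_shift del: sum.lessThan_Suc)

lemma variation_alt:
  "variation g c d = (SUP ts \<in> {ts. sorted ts \<and> ts \<noteq> [] \<and> hd ts = c \<and> last ts = d}. polygon_length g ts)"
  by (simp add: variation_def polygon_length_def)

lemma polygon_length_le_lipschitz:
  assumes "L-lipschitz_on {a..b} g" "sorted ts" "ts \<noteq> []" "a \<le> hd ts" "last ts = b"
  shows "polygon_length g ts \<le> ennreal (L * (b - hd ts))"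
  using assms(2-)
proof (induction ts)
  case (Cons x r)
  show ?case
  proof (cases r)
    case (Cons y r')
    have L: "L \<ge> 0" using assms(1) by (rule lipschitz_on_nonneg)
    have "last r \<in> set r" using Cons by simp
    then have y: "x \<le> y" "y \<le> b" "sorted r"
      using Cons.prems Cons by auto
    have IH: "polygon_length g r \<le> ennreal (L * (b - y))"
      using Cons.IH Cons.prems y Cons by auto
    have "dist (g y) (g x) \<le> L * (y - x)"
      using lipschitz_onD[OF assms(1), of y x] y Cons.prems by (auto simp: dist_real_def)
    then have "polygon_length g (x # r) \<le> ennreal (L * (y - x)) + ennreal (L * (b - y))"
      using IH unfolding Cons by (auto intro!: add_mono ennreal_leI)
    also have "\<dots> = ennreal (L * (b - x))"
      using L y by (subst ennreal_plus[symmetric]) (auto simp: algebra_simps mult_left_mono)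
    finally show ?thesis by simp
  qed simp
qed simp

lemma variation_le_lipschitz:
  assumes "L-lipschitz_on {a..b} g"
  shows "variation g a b \<le> ennreal (L * (b - a))"
  unfolding variation_alt using polygon_length_le_lipschitz[OF assms] by (intro SUP_least) auto

text \<open>The partition is cut at \<open>d\<close>: its points up to \<open>d\<close> are kept and
  \<open>d\<close> is added, while by the Lipschitz bound everything beyond \<open>d\<close>
  contributes at most \<open>L * (e - d)\<close>. This is what makes the variation Lipschitz in its
  right endpoint.\<close>

lemma polygon_truncate:
  assumes "L-lipschitz_on {a..e} g" "sorted ts" "ts \<noteq> []" "a \<le> hd ts" "hd ts \<le> d" "d \<le> e" "last ts = e"
  shows "\<exists>ts'. sorted ts' \<and> ts' \<noteq> [] \<and> hd ts' = hd ts \<and> last ts' = d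
           \<and> polygon_length g ts \<le> polygon_length g ts' + ennreal (L * (e - d))"
  using assms(2-)
proof (induction ts)
  case (Cons x r)
  show ?case
  proof (cases r)
    case Nil
    then show ?thesis using Cons.prems by (intro exI[of _ "[x]"]) auto
  next
    case r: (Cons y r')
    have L: "L \<ge> 0" using assms(1) by (rule lipschitz_on_nonneg)
    have "last r \<in> set r" using r by simp
    then have y: "x \<le> y" "y \<le> e" "sorted r"
      using Cons.prems r by auto
    show ?thesis
    proof (cases "y \<le> d")
      case True
      then obtain ts' where ts': "sorted ts'" "ts' \<noteq> []" "hd ts' = y" "last ts' = d"
        "polygon_length g r \<le> polygon_length g ts' + ennreal (L * (e - d))"
        using Cons.IH Cons.prems y r by auto
      obtain q where q: "ts' = y # q" using ts' by (cases ts') auto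
      show ?thesis
      proof (intro exI[of _ "x # ts'"] conjI)
        show "sorted (x # ts')" using ts' y q by auto
        show "polygon_length g (x # r) \<le> polygon_length g (x # ts') + ennreal (L * (e - d))"
          using ts' unfolding r q by (simp add: add.assoc add_left_mono)
      qed (use ts' in auto)
    next
      case False
      show ?thesis
      proof (intro exI[of _ "[x, d]"] conjI)
        have "dist (g y) (g x) \<le> dist (g d) (g x) + dist (g y) (g d)"
          by (metis add.commute dist_triangle)
        also have "dist (g y) (g d) \<le> L * (y - d)"
          using lipschitz_onD[OF assms(1), of y d] y Cons.prems False by (auto simp: dist_real_def)
        finally have "ennreal (dist (g y) (g x)) \<le> ennreal (dist (g d) (g x)) + ennreal (L * (y - d))"
          using L False by (subst ennreal_plus[symmetric]) (simp_all del: ennreal_plus add: ennreal_leI)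
        moreover have "polygon_length g r \<le> ennreal (L * (e - y))"
          using polygon_length_le_lipschitz[OF assms(1), of r] y r Cons.prems by auto
        ultimately have "polygon_length g (x # r) \<le> (ennreal (dist (g d) (g x)) + ennreal (L * (y - d))) + ennreal (L * (e - y))"
          unfolding r by (auto intro!: add_mono)
        also have "\<dots> = ennreal (dist (g d) (g x)) + ennreal (L * (e - d))"
          using L y False by (simp add: add.assoc flip: ennreal_plus) (simp add: algebra_simps)
        finally show "polygon_length g (x # r) \<le> polygon_length g [x, d] + ennreal (L * (e - d))" by simp
      qed (use Cons.prems in auto)
    qed
  qed
qed simp

lemma variation_extend_le:
  assumes "L-lipschitz_on {a..e} g" "a \<le> d" "d \<le> e"
  shows "variation g a e \<le> variation g a d + ennreal (L * (e - d))"
  unfolding variation_alt[of g a e]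
proof (rule SUP_least)
  fix ts assume "ts \<in> {ts. sorted ts \<and> ts \<noteq> [] \<and> hd ts = a \<and> last ts = e}"
  then obtain ts' where ts': "sorted ts'" "ts' \<noteq> []" "hd ts' = a" "last ts' = d"
     "polygon_length g ts \<le> polygon_length g ts' + ennreal (L * (e - d))"
    using polygon_truncate[OF assms(1), of ts d] assms by auto
  moreover have "polygon_length g ts' \<le> variation g a d"
    unfolding variation_alt using ts' by (intro SUP_upper) auto
  ultimately show "polygon_length g ts \<le> variation g a d + ennreal (L * (e - d))"
    by (meson add_right_mono order_trans)
qed

lemma variation_mono:
  assumes "d \<le> e"
  shows "variation g a d \<le> variation g a e"
  unfolding variation_alt[of g a d]
proof (rule SUP_least)
  fix ts assume ts: "ts \<in> {ts. sorted ts \<and> ts \<noteq> [] \<and> hd ts = a \<and> last ts = d}"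
  have "x \<le> d" if "x \<in> set ts" for x
  proof -
    obtain us where "ts = us @ [d]" using ts by (cases ts rule: rev_cases) auto
    then show ?thesis using ts that by (auto simp: sorted_append)
  qed
  then have "ts @ [e] \<in> {ts. sorted ts \<and> ts \<noteq> [] \<and> hd ts = a \<and> last ts = e}"
    using ts assms by (force simp: sorted_append hd_append)
  then have "polygon_length g (ts @ [e]) \<le> variation g a e"
    unfolding variation_alt by (rule SUP_upper)
  moreover have "polygon_length g ts \<le> polygon_length g (ts @ [e])"
  proof -
    have "polygon_length g ts = (\<Sum>i<length ts - 1. ennreal (dist (g ((ts @ [e]) ! Suc i)) (g ((ts @ [e]) ! i))))"
      unfolding polygon_length_def by (intro sum.cong) (auto simp: nth_append)
    also have "\<dots> \<le> polygon_length g (ts @ [e])"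
      unfolding polygon_length_def by (intro sum_mono2) auto
    finally show ?thesis .
  qed
  ultimately show "polygon_length g ts \<le> variation g a e" by simp
qed

text \<open>Line integrals are defined against the Stieltjes measure of the variation function; for
  a Lipschitz path this trades it for Lebesgue measure. An upper bound is what is wanted, because
  admissibility bounds line integrals from below.\<close>

lemma nn_integral_interval_measure_le:
  fixes V :: "real \<Rightarrow> real" and f :: "real \<Rightarrow> ennreal"
  assumes mono: "\<And>s t. s \<le> t \<Longrightarrow> V s \<le> V t"
    and lip: "\<And>s t. s \<le> t \<Longrightarrow> V t - V s \<le> L * (t - s)"
    and f: "f \<in> borel_measurable borel"
  shows "(\<integral>\<^sup>+t. f t \<partial>interval_measure V) \<le> ennreal L * (\<integral>\<^sup>+t. f t \<partial>lborel)"
proof -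
  have L: "L \<ge> 0" using mono[of 0 1] lip[of 0 1] by simp
  \<comment> \<open>\<open>V\<close> and \<open>W\<close> generate Stieltjes measures whose sum is \<open>L\<close> times Lebesgue measure.\<close>
  define W where "W = (\<lambda>t. L * t - V t)"
  have monoW: "W s \<le> W t" if "s \<le> t" for s t
    using lip[OF that] by (simp add: W_def algebra_simps)
  have lipV: "L-lipschitz_on UNIV V"
    by (rule lipschitz_onI[OF _ L]) (smt (verit) mono lip dist_real_def)
  have contV: "continuous (at_right a) V" for a
    using lipschitz_on_continuous_on[OF lipV] by (auto simp: continuous_on_eq_continuous_within intro: continuous_within_subset)
  have contW: "continuous (at_right a) W" for a
    unfolding W_def by (intro continuous_intros contV)
  define N where "N = measure_of UNIV (sets borel) (\<lambda>A. emeasure (interval_measure V) A + emeasure (interval_measure W) A)"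
  have emN: "emeasure N A = emeasure (interval_measure V) A + emeasure (interval_measure W) A" if "A \<in> sets borel" for A
  proof (rule emeasure_measure_of[OF N_def])
    show "countably_additive (sets N) (\<lambda>A. emeasure (interval_measure V) A + emeasure (interval_measure W) A)"
    proof (rule countably_additiveI)
      fix A :: "nat \<Rightarrow> real set" assume A: "range A \<subseteq> sets N" "disjoint_family A" "\<Union>(range A) \<in> sets N"
      have sN: "sets N = sets borel" unfolding N_def by (simp add: sets.sigma_sets_eq[of borel, simplified])
      have "(\<Sum>i. emeasure (interval_measure V) (A i) + emeasure (interval_measure W) (A i))
        = (\<Sum>i. emeasure (interval_measure V) (A i)) + (\<Sum>i. emeasure (interval_measure W) (A i))"
        by (intro suminf_add[symmetric]) auto
      also have "\<dots> = emeasure (interval_measure V) (\<Union>(range A)) + emeasure (interval_measure W) (\<Union>(range A))"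
        using A sN by (simp add: suminf_emeasure)
      finally show "(\<Sum>i. emeasure (interval_measure V) (A i) + emeasure (interval_measure W) (A i)) = \<dots>" .
    qed
  qed (use that in \<open>auto simp: positive_def N_def\<close>)
  have sN [measurable_cong]: "sets N = sets borel" unfolding N_def by (simp add: sets.sigma_sets_eq[of borel, simplified])
  have Neq: "N = scale_measure (ennreal L) lborel"
  proof (rule measure_eqI_generator_eq[where \<Omega> = UNIV and E = "range (\<lambda>(a,b). {a<..b::real})" and A = "\<lambda>i. {- real i<..real i}"])
    show "Int_stable (range (\<lambda>(a,b). {a<..b::real}))"
      by (auto simp: Int_stable_def intro!: image_eqI[of _ _ "(max _ _, min _ _)"])
    show "sets N = sigma_sets UNIV (range (\<lambda>(a,b). {a<..b::real}))"
      unfolding sN by (subst borel_sigma_sets_Ioc) simp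
    show "sets (scale_measure (ennreal L) lborel) = sigma_sets UNIV (range (\<lambda>(a,b). {a<..b::real}))"
      by (simp, subst borel_sigma_sets_Ioc) simp
    show "(\<Union>i. {- real i<..real i}) = UNIV"
    proof (intro equalityI subsetI UNIV_I)
      fix x :: real
      obtain i where "\<bar>x\<bar> < real i" using reals_Archimedean2 by blast
      then show "x \<in> (\<Union>i. {- real i<..real i})" by (intro UN_I[of i]) auto
    qed
    have *: "emeasure N {a<..b} = ennreal (L * (b - a))" if "a \<le> b" for a b
      using that monoW[OF that] mono[OF that]
      by (simp add: emN emeasure_interval_measure_Ioc[OF that mono contV] emeasure_interval_measure_Ioc[OF that monoW contW]
           flip: ennreal_plus) (simp add: W_def algebra_simps)
    fix X :: "real set" assume "X \<in> range (\<lambda>(a,b). {a<..b})"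
    then obtain a b where X: "X = {a<..b}" by auto
    show "emeasure N X = emeasure (scale_measure (ennreal L) lborel) X"
      using *[of a b] L by (cases "a \<le> b") (auto simp: X ennreal_mult)
  next
    fix i :: nat
    show "emeasure N {- real i<..real i} \<noteq> \<infinity>"
      using emeasure_interval_measure_Ioc[of "-real i" "real i" V, OF _ mono contV] emeasure_interval_measure_Ioc[of "-real i" "real i" W, OF _ monoW contW]
      by (simp add: emN)
  qed auto
  have "(\<integral>\<^sup>+t. f t \<partial>interval_measure V) \<le> (\<integral>\<^sup>+t. f t \<partial>N)"
  proof (rule nn_integral_mono_measure)
    show "sets (interval_measure V) = sets N" by (simp add: sN)
    show "interval_measure V \<le> N"
      by (subst le_measure) (auto simp: sN emN)
  qed
  also have "\<dots> = ennreal L * (\<integral>\<^sup>+t. f t \<partial>lborel)"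
    unfolding Neq using f by (simp add: nn_integral_scale_measure)
  finally show ?thesis .
qed


lemma locally_rectifiable_lipschitz:
  assumes "L-lipschitz_on {a..b} \<beta>" "\<And>t. t \<in> {a..b} \<Longrightarrow> g t = Some (\<beta> t)"
  shows "locally_rectifiable ({a..b}, g)"
  unfolding locally_rectifiable_def
proof (intro allI impI)
  fix c d assume "finite_segment (fst ({a..b}, g)) (snd ({a..b}, g)) c d"
  then have cd: "c \<le> d" "{c..d} \<subseteq> {a..b}" by (auto simp: finite_segment_def)
  have "L-lipschitz_on {c..d} (the \<circ> g)"
    using lipschitz_on_subset[OF assms(1) cd(2)] assms(2) cd(2)
    by (subst lipschitz_on_transform[where f = \<beta>]) auto
  from variation_le_lipschitz[OF this]
  show "variation (the \<circ> snd ({a..b}, g)) c d < \<infinity>"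
    by (simp add: order_le_less_trans)
qed

text \<open>On each segment the Stieltjes measure is dominated by \<open>L\<close> times Lebesgue
  measure. As the segments of a family are disjoint, the bounds add up to one integral over a subset
  of \<open>{a..b}\<close>.\<close>

lemma line_integral_le_lipschitz:
  fixes \<rho> :: "'a::euclidean_space \<Rightarrow> ennreal"
  assumes lip: "L-lipschitz_on {a..b} \<beta>" and g: "\<And>t. t \<in> {a..b} \<Longrightarrow> g t = Some (\<beta> t)"
    and \<rho> [measurable]: "\<rho> \<in> borel_measurable borel"
  shows "line_integral \<rho> ({a..b}, g) \<le> ennreal L * (\<integral>\<^sup>+t\<in>{a..b}. \<rho> (\<beta> t) \<partial>lborel)"
proof -
  \<comment> \<open>\<open>\<beta>\<close> is controlled only on \<open>{a..b}\<close>, so the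
    integrand is cut off there to become Borel on the whole line.\<close>
  define h where "h = (\<lambda>t. \<rho> (\<beta> t) * indicator {a..b} t)"
  have "continuous_on {a..b} \<beta>" using lip by (rule lipschitz_on_continuous_on)
  then have "(\<lambda>t. indicator {a..b} t *\<^sub>R \<beta> t) \<in> borel_measurable borel"
    by (intro borel_measurable_continuous_on_indicator) auto
  then have "(\<lambda>t. \<rho> (indicator {a..b} t *\<^sub>R \<beta> t) * indicator {a..b} t) \<in> borel_measurable borel"
    by measurable
  also have "(\<lambda>t. \<rho> (indicator {a..b} t *\<^sub>R \<beta> t) * indicator {a..b} t) = h"
    by (auto simp: h_def indicator_def)
  finally have h [measurable]: "h \<in> borel_measurable borel" .
  have L: "L \<ge> 0" using lip by (rule lipschitz_on_nonneg)
  have seg: "seg_line_integral \<rho> (the \<circ> g) c d \<le> ennreal L * (\<integral>\<^sup>+t\<in>{c..d}. h t \<partial>lborel)"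
    if "c \<le> d" "{c..d} \<subseteq> {a..b}" for c d
  proof -
    let ?V = "\<lambda>t. enn2real (variation (the \<circ> g) c (max c (min t d)))"
    have lip': "L-lipschitz_on {c..d} (the \<circ> g)"
      using lipschitz_on_subset[OF lip that(2)] g that(2)
      by (subst lipschitz_on_transform[where f = \<beta>]) auto
    have fin: "variation (the \<circ> g) c t < top" if "c \<le> t" "t \<le> d" for t
    proof -
      have "L-lipschitz_on {c..t} (the \<circ> g)" by (rule lipschitz_on_subset[OF lip']) (use that in auto)
      from variation_le_lipschitz[OF this] show ?thesis by (simp add: order_le_less_trans)
    qed
    have "seg_line_integral \<rho> (the \<circ> g) c d = (\<integral>\<^sup>+t. h t * indicator {c..d} t \<partial>interval_measure ?V)"
      unfolding seg_line_integral_def using that g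
      by (intro nn_integral_cong) (auto simp: indicator_def h_def)
    also have "\<dots> \<le> ennreal L * (\<integral>\<^sup>+t. h t * indicator {c..d} t \<partial>lborel)"
    proof (rule nn_integral_interval_measure_le)
      fix s t :: real assume "s \<le> t"
      define s' t' where "s' = max c (min s d)" and "t' = max c (min t d)"
      have st: "c \<le> s'" "s' \<le> t'" "t' \<le> d" "t' - s' \<le> t - s"
        using \<open>s \<le> t\<close> that by (auto simp: s'_def t'_def)
      show "?V s \<le> ?V t"
        unfolding s'_def[symmetric] t'_def[symmetric]
        using st fin[of t'] by (intro enn2real_mono variation_mono) auto
      have "L-lipschitz_on {c..t'} (the \<circ> g)" by (rule lipschitz_on_subset[OF lip']) (use st in auto)
      then have "variation (the \<circ> g) c t' \<le> variation (the \<circ> g) c s' + ennreal (L * (t' - s'))"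
        using st by (intro variation_extend_le) auto
      then have "enn2real (variation (the \<circ> g) c t') \<le> enn2real (variation (the \<circ> g) c s' + ennreal (L * (t' - s')))"
        using fin[of s'] st by (intro enn2real_mono) auto
      also have "\<dots> = enn2real (variation (the \<circ> g) c s') + L * (t' - s')"
        using fin[of s'] st L by (subst enn2real_plus) auto
      also have "L * (t' - s') \<le> L * (t - s)" using st L by (intro mult_left_mono) auto
      finally show "?V t - ?V s \<le> L * (t - s)"
        unfolding s'_def[symmetric] t'_def[symmetric] by (simp only: diff_le_eq add.commute)
    qed measurable
    finally show ?thesis .
  qed
  show ?thesis
    unfolding line_integral_def
  proof (rule SUP_least)
    fix F assume F: "F \<in> {F. finite F \<and> (\<forall>(c,d)\<in>F. finite_segment (fst ({a..b}, g)) (snd ({a..b}, g)) c d)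
         \<and> (\<forall>(c,d)\<in>F. \<forall>(c',d')\<in>F. (c,d) \<noteq> (c',d') \<longrightarrow> {c..d} \<inter> {c'..d'} = {})}"
    then have cd: "c \<le> d" "{c..d} \<subseteq> {a..b}" if "(c, d) \<in> F" for c d
      using that by (auto simp: finite_segment_def)
    let ?J = "\<lambda>(c,d). {c..d::real}"
    have 1: "(\<Sum>(c,d)\<in>F. seg_line_integral \<rho> (the \<circ> snd ({a..b}, g)) c d) \<le> ennreal L * (\<Sum>p\<in>F. emeasure (density lborel h) (?J p))"
      unfolding sum_distrib_left using seg cd by (intro sum_mono) (auto simp: emeasure_density)
    have "(\<Sum>p\<in>F. emeasure (density lborel h) (?J p)) = emeasure (density lborel h) (\<Union>p\<in>F. ?J p)"
    proof (rule sum_emeasure)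
      have "{c..d} \<inter> {c'..d'} = {}" if "(c,d) \<in> F" "(c',d') \<in> F" "(c,d) \<noteq> (c',d')" for c d c' d'
        using F that by blast
      then show "disjoint_family_on ?J F" unfolding disjoint_family_on_def by (simp add: split_paired_all)
    qed (use F in auto)
    also have "\<dots> \<le> emeasure (density lborel h) {a..b}"
    proof (rule emeasure_mono)
      show "(\<Union>p\<in>F. ?J p) \<subseteq> {a..b}" using cd(2) by blast
    qed simp
    also have "\<dots> = (\<integral>\<^sup>+t\<in>{a..b}. \<rho> (\<beta> t) \<partial>lborel)"
    proof -
      have "emeasure (density lborel h) {a..b} = (\<integral>\<^sup>+t. h t * indicator {a..b} t \<partial>lborel)"
        by (rule emeasure_density) auto
      also have "\<dots> = (\<integral>\<^sup>+t\<in>{a..b}. \<rho> (\<beta> t) \<partial>lborel)"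
        by (rule nn_integral_cong) (auto simp: h_def indicator_def)
      finally show ?thesis .
    qed
    finally have 2: "(\<Sum>p\<in>F. emeasure (density lborel h) (?J p)) \<le> (\<integral>\<^sup>+t\<in>{a..b}. \<rho> (\<beta> t) \<partial>lborel)" .
    show "(\<Sum>(c,d)\<in>F. seg_line_integral \<rho> (the \<circ> snd ({a..b}, g)) c d) \<le> ennreal L * (\<integral>\<^sup>+t\<in>{a..b}. \<rho> (\<beta> t) \<partial>lborel)"
      by (rule order_trans[OF 1 mult_left_mono[OF 2]]) simp
  qed
qed

section \<open>The chordal metric\<close>

text \<open>Inverse stereographic projection onto the sphere of radius 1/2 about
  \<open>(0, 1/2)\<close>, with \<open>None\<close> at the north pole. Chordal distance is Euclidean
  distance of these points, whence the triangle inequality, compactness and the connectedness of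
  caps.\<close>

definition stereo :: "'a::euclidean_space option \<Rightarrow> 'a \<times> real" where
  "stereo p = (case p of Some x \<Rightarrow> ((1 / (1 + (norm x)\<^sup>2)) *\<^sub>R x, (norm x)\<^sup>2 / (1 + (norm x)\<^sup>2)) | None \<Rightarrow> (0, 1))"

lemma stereo_simps [simp]:
  "stereo (Some x) = ((1 / (1 + (norm x)\<^sup>2)) *\<^sub>R x, (norm x)\<^sup>2 / (1 + (norm x)\<^sup>2))"
  "stereo None = (0, 1)"
  by (simp_all add: stereo_def)

lemma dist_stereo_Some_Some:
  fixes x y :: "'a::euclidean_space"
  shows "dist (stereo (Some x)) (stereo (Some y)) = norm (x - y) / (sqrt (1 + (norm x)\<^sup>2) * sqrt (1 + (norm y)\<^sup>2))"
proof -
  define A B where "A = 1 + (norm x)\<^sup>2" and "B = 1 + (norm y)\<^sup>2"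
  have pos: "A > 0" "B > 0" by (simp_all add: A_def B_def add_pos_nonneg)
  have X: "(norm x)\<^sup>2 = A - 1" and Y: "(norm y)\<^sup>2 = B - 1" by (simp_all add: A_def B_def)
  have 1: "(norm (x - y))\<^sup>2 = (A - 1) + (B - 1) - 2 * (x \<bullet> y)"
    by (simp add: X[symmetric] Y[symmetric] power2_norm_eq_inner inner_diff inner_commute)
  have 2: "(norm ((1 / A) *\<^sub>R x - (1 / B) *\<^sub>R y))\<^sup>2 = (A - 1) / A\<^sup>2 + (B - 1) / B\<^sup>2 - 2 * (x \<bullet> y) / (A * B)"
  proof -
    have "(norm ((1 / A) *\<^sub>R x - (1 / B) *\<^sub>R y))\<^sup>2
        = (norm ((1 / A) *\<^sub>R x))\<^sup>2 + (norm ((1 / B) *\<^sub>R y))\<^sup>2 - 2 * (((1 / A) *\<^sub>R x) \<bullet> ((1 / B) *\<^sub>R y))"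
      by (simp only: power2_norm_eq_inner) (simp add: inner_diff inner_commute)
    then show ?thesis using X Y by (simp add: power_divide)
  qed
  have "(norm ((1 / A) *\<^sub>R x - (1 / B) *\<^sub>R y))\<^sup>2 + ((A - 1) / A - (B - 1) / B)\<^sup>2 = (norm (x - y))\<^sup>2 / (A * B)"
    unfolding 1 2 using pos by (simp add: power2_eq_square divide_simps) (simp add: algebra_simps)
  then have "dist (stereo (Some x)) (stereo (Some y)) = sqrt ((norm (x - y))\<^sup>2 / (A * B))"
    by (simp add: dist_Pair_Pair A_def[symmetric] B_def[symmetric] X Y) (simp add: dist_norm)
  also have "\<dots> = norm (x - y) / (sqrt A * sqrt B)"
    by (simp add: real_sqrt_divide real_sqrt_mult)
  finally show ?thesis by (simp add: A_def B_def)
qed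

lemma dist_stereo_Some_None:
  fixes x :: "'a::euclidean_space"
  shows "dist (stereo (Some x)) (stereo None) = 1 / sqrt (1 + (norm x)\<^sup>2)"
proof -
  define A where "A = 1 + (norm x)\<^sup>2"
  have pos: "A > 0" by (simp add: A_def add_pos_nonneg)
  have X: "(norm x)\<^sup>2 = A - 1" by (simp add: A_def)
  have "(norm ((1 / A) *\<^sub>R x))\<^sup>2 + ((A - 1) / A - 1)\<^sup>2 = 1 / A"
    using pos by (simp add: power_mult_distrib X power2_eq_square[of A] power_divide divide_simps)
  then have "dist (stereo (Some x)) (stereo None) = sqrt (1 / A)"
    by (simp add: dist_Pair_Pair A_def[symmetric] X) (simp add: dist_norm)
  then show ?thesis by (simp add: real_sqrt_divide A_def)
qed

lemma chordal_eq_dist: "chordal p q = dist (stereo p) (stereo q)"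
proof (cases p; cases q)
  fix x assume "p = None" "q = Some x"
  then show ?thesis
    by (simp only: chordal_def prod.case option.case dist_commute[of "stereo None"] dist_stereo_Some_None)
qed (simp_all only: chordal_def prod.case option.case dist_stereo_Some_Some dist_stereo_Some_None dist_self)

lemma stereo_surj:
  fixes v :: "'a::euclidean_space \<times> real"
  assumes "v \<in> sphere (0, 1/2) (1/2)"
  shows "v \<in> range stereo"
proof -
  obtain u s where v: "v = (u, s)" by (cases v)
  have "dist (0::'a, 1/2::real) (u, s) = 1/2" using assms unfolding v mem_sphere .
  then have "sqrt ((norm u)\<^sup>2 + (1/2 - s)\<^sup>2) = 1/2"
    unfolding dist_Pair_Pair by (simp add: dist_norm)
  then have "(norm u)\<^sup>2 + (1/2 - s)\<^sup>2 = (1/2)\<^sup>2"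
    by (metis real_sqrt_pow2 add_nonneg_nonneg zero_le_power2)
  then have u: "(norm u)\<^sup>2 = s * (1 - s)" by (simp add: power2_eq_square algebra_simps)
  show ?thesis
  proof (cases "s = 1")
    case True
    then show ?thesis using u v by (metis diff_self mult_zero_right norm_eq_zero power_eq_0_iff rangeI stereo_simps(2))
  next
    case False
    have "s * (1 - s) \<ge> 0" using u by (metis zero_le_power2)
    then have s: "0 \<le> s" "s < 1" using False by (auto simp: zero_le_mult_iff)
    \<comment> \<open>Stereographic projection from the north pole \<open>(0, 1)\<close>.\<close>
    define x where "x = (1 / (1 - s)) *\<^sub>R u"
    have "(norm x)\<^sup>2 = (norm u)\<^sup>2 / (1 - s)\<^sup>2" by (simp add: x_def power_divide)
    also have "\<dots> = s / (1 - s)" unfolding u using s by (simp add: power2_eq_square)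
    finally have nx: "(norm x)\<^sup>2 = s / (1 - s)" .
    then have "1 + (norm x)\<^sup>2 = 1 / (1 - s)" using s by (simp add: field_simps)
    then have "stereo (Some x) = v" using s by (simp add: v nx) (simp add: x_def)
    then show ?thesis by (metis rangeI)
  qed
qed

lemma stereo_in_sphere: "stereo p \<in> sphere (0, 1/2) (1/2)"
proof (cases p)
  case (Some x)
  define A where "A = 1 + (norm x)\<^sup>2"
  have pos: "A > 0" by (simp add: A_def add_pos_nonneg)
  have X: "(norm x)\<^sup>2 = A - 1" by (simp add: A_def)
  have "(norm ((1 / A) *\<^sub>R x))\<^sup>2 + (1/2 - (A - 1) / A)\<^sup>2 = (1/2)\<^sup>2"
    using pos by (simp add: power_mult_distrib X power_divide divide_simps)
       (simp add: power2_eq_square algebra_simps)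
  then have "sqrt ((norm ((1 / A) *\<^sub>R x))\<^sup>2 + (1/2 - (A - 1) / A)\<^sup>2) = 1/2"
    by (metis abs_of_nonneg real_sqrt_abs zero_le_divide_1_iff zero_le_numeral)
  then show ?thesis
    by (simp add: Some dist_Pair_Pair A_def[symmetric] X) (simp add: dist_norm)
qed (simp add: dist_Pair_Pair dist_norm)

lemma range_stereo: "range stereo = sphere (0, 1/2) (1/2)"
  using stereo_surj stereo_in_sphere by blast

lemma inj_stereo: "inj (stereo :: 'a::euclidean_space option \<Rightarrow> _)"
proof (rule injI)
  fix p q :: "'a option" assume "stereo p = stereo q"
  then have "chordal p q = 0" by (simp add: chordal_eq_dist)
  moreover have "sqrt (1 + (norm x)\<^sup>2) \<noteq> 0" for x :: 'a
    by (smt (verit) real_sqrt_eq_zero_cancel_iff zero_le_power2)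
  ultimately show "p = q" by (auto simp: chordal_def split: option.splits)
qed

interpretation Chordal: Metric_space UNIV "chordal :: 'a::euclidean_space option \<Rightarrow> _"
  by unfold_locales (auto simp: chordal_eq_dist dist_commute inj_eq[OF inj_stereo] dist_triangle)

lemma ext_top_eq: "(ext_top :: 'a::euclidean_space option topology) = Chordal.mtopology"
proof -
  have "(\<lambda>U. \<forall>x\<in>U. \<exists>e>0. \<forall>y. chordal x y < e \<longrightarrow> y \<in> U) = (Chordal.mopen :: 'a option set \<Rightarrow> bool)"
    by (auto simp: Chordal.mopen_def Chordal.mball_def fun_eq_iff subset_eq)
  then show ?thesis by (simp add: ext_top_def Chordal.mtopology_def)
qed

lemma topspace_ext_top [simp]: "topspace ext_top = UNIV"
  by (simp add: ext_top_eq)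

lemma openin_ext_top: "openin ext_top U \<longleftrightarrow> (\<forall>x\<in>U. \<exists>e>0. \<forall>y. chordal x y < e \<longrightarrow> y \<in> U)"
  by (auto simp: ext_top_eq Chordal.openin_mtopology Chordal.mball_def subset_eq)

lemma homeomorphic_map_stereo:
  "homeomorphic_map ext_top (top_of_set (sphere (0, 1/2) (1/2))) (stereo :: 'a::euclidean_space option \<Rightarrow> _)"
proof (rule bijective_open_imp_homeomorphic_map)
  show "continuous_map ext_top (top_of_set (sphere (0, 1/2) (1/2))) (stereo :: 'a option \<Rightarrow> _)"
    unfolding continuous_map_in_subtopology
  proof (intro conjI, unfold continuous_map_def, intro conjI allI impI)
    fix U :: "('a \<times> real) set" assume "openin euclidean U"
    then show "openin ext_top {x \<in> topspace ext_top. stereo x \<in> U}"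
      unfolding openin_ext_top
    proof (intro ballI)
      fix p :: "'a option" assume "p \<in> {x \<in> topspace ext_top. stereo x \<in> U}"
      then obtain e where "e > 0" "ball (stereo p) e \<subseteq> U"
        using \<open>openin euclidean U\<close> by (auto elim!: openE)
      then show "\<exists>e>0. \<forall>y. chordal p y < e \<longrightarrow> y \<in> {x \<in> topspace ext_top. stereo x \<in> U}"
        by (intro exI[of _ e]) (auto simp: chordal_eq_dist subset_eq simp del: split_paired_All)
    qed
  qed (use stereo_in_sphere in auto)
  show "open_map ext_top (top_of_set (sphere (0, 1/2) (1/2))) (stereo :: 'a option \<Rightarrow> _)"
    unfolding open_map_def
  proof (intro allI impI)
    fix U :: "'a option set" assume U: "openin ext_top U"
    show "openin (top_of_set (sphere (0, 1/2) (1/2))) (stereo ` U)"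
      unfolding openin_euclidean_subtopology_iff
    proof (intro conjI ballI)
      fix v assume "v \<in> stereo ` U"
      then obtain p where p: "p \<in> U" "v = stereo p" by auto
      then obtain e where "e > 0" "\<And>y. chordal p y < e \<Longrightarrow> y \<in> U" using U by (auto simp: openin_ext_top)
      then show "\<exists>e>0. \<forall>x'\<in>sphere (0, 1/2) (1/2). dist x' v < e \<longrightarrow> x' \<in> stereo ` U"
      proof (intro exI[of _ e] conjI ballI impI)
        fix x' :: "'a \<times> real" assume x': "x' \<in> sphere (0, 1/2) (1/2)" "dist x' v < e"
        then obtain y where "x' = stereo y" using stereo_surj by blast
        then show "x' \<in> stereo ` U"
          using x' p \<open>\<And>y. chordal p y < e \<Longrightarrow> y \<in> U\<close> by (auto simp: chordal_eq_dist dist_commute)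
      qed auto
    qed (use stereo_in_sphere in auto)
  qed
qed (use range_stereo inj_stereo in auto)

lemma compact_space_ext_top: "compact_space (ext_top :: 'a::euclidean_space option topology)"
proof -
  have "(ext_top :: 'a option topology) homeomorphic_space top_of_set (sphere (0, 1/2) (1/2) :: ('a \<times> real) set)"
    using homeomorphic_map_stereo by (rule homeomorphic_map_imp_homeomorphic_space)
  then show ?thesis by (simp add: homeomorphic_compact_space compact_space_subtopology)
qed

text \<open>Radial projection maps the convex set \<open>C\<close>, a ball cut by a half-space, onto
  the cap. The condition \<open>s < r\<close> keeps the centre, where the projection breaks down,
  out of \<open>C\<close>.\<close>

lemma connected_spherical_cap:
  fixes e z :: "'b::euclidean_space"
  assumes "z \<in> sphere e r" "s < r"
  shows "connected {v \<in> sphere e r. dist z v \<le> s}"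
proof (cases "s \<ge> 0")
  case True
  then have r: "r > 0" using assms by simp
  \<comment> \<open>On the sphere \<open>dist z v \<le> s\<close> is a linear condition, because the
    squared distance equals \<open>2 r^2 - 2 (z - e) \<bullet> (v - e)\<close>; \<open>C\<close> is
    translated to have its centre at 0.\<close>
  define C where "C = cball 0 r \<inter> {v. (z - e) \<bullet> v \<ge> r\<^sup>2 - s\<^sup>2 / 2}"
  have nz: "norm (z - e) = r" using assms by (simp add: dist_norm norm_minus_commute)
  have dist_eq: "(dist z v)\<^sup>2 = 2 * r\<^sup>2 - 2 * ((z - e) \<bullet> (v - e))" if "norm (v - e) = r" for v
  proof -
    have "(dist z v)\<^sup>2 = (norm ((z - e) - (v - e)))\<^sup>2" by (simp add: dist_norm)
    also have "\<dots> = (norm (z - e))\<^sup>2 + (norm (v - e))\<^sup>2 - 2 * ((z - e) \<bullet> (v - e))"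
      by (subst power2_norm_eq_inner) (simp add: inner_diff_left inner_diff_right power2_norm_eq_inner inner_commute)
    finally show ?thesis using nz that by simp
  qed
  have "s\<^sup>2 < r\<^sup>2" using True assms by (simp add: power_strict_mono)
  then have k: "r\<^sup>2 - s\<^sup>2 / 2 > 0" using r by (simp add: field_simps) (smt (verit) zero_less_power2)
  have cap: "{v \<in> sphere e r. dist z v \<le> s} = (\<lambda>v. e + (r / norm v) *\<^sub>R v) ` C"
  proof (intro equalityI subsetI)
    fix v assume v: "v \<in> {v \<in> sphere e r. dist z v \<le> s}"
    then have nv: "norm (v - e) = r" by (simp add: dist_norm norm_minus_commute)
    have "(dist z v)\<^sup>2 \<le> s\<^sup>2" using v by (simp add: power_mono)
    then have "v - e \<in> C" using nv dist_eq[OF nv] by (simp add: C_def)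
    moreover have "v = e + (r / norm (v - e)) *\<^sub>R (v - e)" using nv r by simp
    ultimately show "v \<in> (\<lambda>v. e + (r / norm v) *\<^sub>R v) ` C" by blast
  next
    fix u assume "u \<in> (\<lambda>v. e + (r / norm v) *\<^sub>R v) ` C"
    then obtain v where v: "v \<in> C" and u: "u = e + (r / norm v) *\<^sub>R v" by auto
    have "v \<noteq> 0" using v k by (auto simp: C_def)
    then have nu: "norm (u - e) = r" using r by (simp add: u)
    have "1 \<le> r / norm v" using v \<open>v \<noteq> 0\<close> by (simp add: C_def)
    then have "1 * ((z - e) \<bullet> v) \<le> (r / norm v) * ((z - e) \<bullet> v)"
      using v k by (intro mult_right_mono) (auto simp: C_def)
    then have "(z - e) \<bullet> (u - e) \<ge> r\<^sup>2 - s\<^sup>2 / 2" using v by (simp add: u C_def)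
    then have "(dist z u)\<^sup>2 \<le> s\<^sup>2" using dist_eq[OF nu] by simp
    then have "dist z u \<le> s" using True by (rule power2_le_imp_le)
    then show "u \<in> {v \<in> sphere e r. dist z v \<le> s}"
      using nu by (simp add: dist_norm norm_minus_commute)
  qed
  have "convex C" unfolding C_def by (intro convex_Int convex_cball convex_halfspace_ge)
  moreover have "0 \<notin> C" using k by (simp add: C_def)
  ultimately show ?thesis
    unfolding cap by (intro connected_continuous_image convex_connected continuous_intros) auto
next
  case False
  then have "\<not> dist z v \<le> s" for v by (smt (verit) zero_le_dist)
  then show ?thesis by simp
qed

text \<open>The bound 1/2 is the radius of the model sphere; the conditions \<open>s < 1/2\<close>
  in later estimates come from here.\<close>

lemma connectedin_chordal_cball:
  assumes "s < 1/2"
  shows "connectedin ext_top {y. chordal z y \<le> s}"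
proof -
  have "stereo ` {y. chordal z y \<le> s} = {v \<in> sphere (0, 1/2) (1/2). dist (stereo z) v \<le> s}"
  proof (intro equalityI subsetI)
    fix v assume v: "v \<in> {v \<in> sphere (0, 1/2) (1/2). dist (stereo z) v \<le> s}"
    then obtain y where "v = stereo y" using stereo_surj[of v] by auto
    then show "v \<in> stereo ` {y. chordal z y \<le> s}" using v by (auto simp: chordal_eq_dist)
  qed (use stereo_in_sphere in \<open>auto simp: chordal_eq_dist simp del: mem_sphere\<close>)
  moreover have "connected {v \<in> sphere (0, 1/2) (1/2). dist (stereo z) v \<le> s}"
    by (rule connected_spherical_cap[OF stereo_in_sphere assms])
  ultimately show ?thesis
    by (subst homeomorphic_map_connectedness_eq[OF homeomorphic_map_stereo])
       (auto simp: connectedin_subtopology simp del: mem_sphere)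
qed

lemma compactin_chordal_cball: "compactin ext_top {y. chordal z y \<le> s}"
proof -
  have "closedin ext_top {y. chordal z y \<le> s}"
    using Chordal.closedin_mcball[of z s] by (simp add: ext_top_eq Chordal.mcball_def)
  then show ?thesis by (rule closedin_compact_space[OF compact_space_ext_top])
qed

text \<open>A connected cap that meets both \<open>A\<close> and its complement meets the frontier
  of \<open>A\<close>, but frontier points are at distance at least \<open>\<delta> > s\<close> from
  the centre.\<close>

lemma chordal_cball_subset:
  assumes "z \<in> A" "\<And>y. y \<in> ext_top frontier_of A \<Longrightarrow> \<delta> \<le> chordal z y" "0 \<le> s" "s < \<delta>" "s < 1/2"
  shows "{y. chordal z y \<le> s} \<subseteq> A"
proof (rule ccontr)
  assume *: "\<not> ?thesis"
  have "z \<in> {y. chordal z y \<le> s}" using assms by simp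
  then have "{y. chordal z y \<le> s} \<inter> ext_top frontier_of A \<noteq> {}"
    using assms(1) * by (intro connectedin_Int_frontier_of connectedin_chordal_cball assms) blast+
  then show False using assms by fastforce
qed

lemma chordal_le_dist: "chordal (Some x) (Some y) \<le> norm (x - y)"
proof -
  have "1 * 1 \<le> sqrt (1 + (norm x)\<^sup>2) * sqrt (1 + (norm y)\<^sup>2)" by (intro mult_mono) auto
  then have "norm (x - y) / (sqrt (1 + (norm x)\<^sup>2) * sqrt (1 + (norm y)\<^sup>2)) \<le> norm (x - y) / 1"
    by (intro divide_left_mono) auto
  then show ?thesis by (simp add: chordal_def)
qed

lemma chordal_le_1: "chordal p q \<le> 1"
proof -
  have "dist (stereo p) (stereo q) \<le> dist (stereo p) (0, 1/2) + dist (stereo q) (0, 1/2)"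
    by (rule dist_triangle2)
  also have "\<dots> = 1" using stereo_in_sphere[of p] stereo_in_sphere[of q] by (simp add: dist_commute)
  finally show ?thesis by (simp add: chordal_eq_dist)
qed

text \<open>A local converse of \<open>chordal_le_dist\<close>, with constants explicit in
  \<open>norm x\<close>. With \<open>A\<close> and \<open>B\<close> the square roots belonging to
  \<open>x\<close> and \<open>y\<close>, the bound \<open>B \<le> A + norm (y - x)\<close> estimates
  the displacement by \<open>t * A^2\<close> plus at most half of itself.\<close>

lemma chordal_small:
  fixes x :: "'a::euclidean_space"
  assumes "chordal (Some x) q \<le> t" "2 * t * sqrt (1 + (norm x)\<^sup>2) \<le> 1"
  obtains y where "q = Some y" "norm (y - x) \<le> 2 * t * (1 + (norm x)\<^sup>2)"
proof -
  define A where "A = sqrt (1 + (norm x)\<^sup>2)"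
  have A: "A \<ge> 1" "A\<^sup>2 = 1 + (norm x)\<^sup>2" by (auto simp: A_def add_nonneg_nonneg)
  have "q \<noteq> None"
  proof
    assume "q = None"
    then have "1 / A \<le> t" using assms by (simp add: chordal_def A_def)
    then have "1 \<le> t * A" using A by (simp add: field_simps)
    then show False using assms(2) by (simp add: A_def[symmetric])
  qed
  then obtain y where y: "q = Some y" by auto
  define B d where "B = sqrt (1 + (norm y)\<^sup>2)" and "d = norm (y - x)"
  have B: "B \<ge> 1" by (simp add: B_def)
  have t: "t \<ge> 0" using assms(1) Chordal.nonneg order_trans by blast
  have "B \<le> A + d"
  proof -
    \<comment> \<open>The square roots are the norms of \<open>(1, x)\<close> and
      \<open>(1, y)\<close>.\<close>
    have "norm (1::real, y) \<le> norm (1::real, x) + norm (0::real, y - x)"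
      using norm_triangle_ineq[of "(1::real, x)" "(0::real, y - x)"] by simp
    then show ?thesis by (simp add: norm_Pair A_def B_def d_def)
  qed
  have "d / (A * B) \<le> t" using assms(1) by (simp add: y chordal_def A_def B_def d_def norm_minus_commute)
  then have "d \<le> t * A * B" using A B by (simp add: field_simps)
  also have "\<dots> \<le> t * A * (A + d)" using t A \<open>B \<le> A + d\<close> by (intro mult_left_mono) auto
  also have "\<dots> = t * A\<^sup>2 + t * A * d" by (simp add: power2_eq_square algebra_simps)
  also have "t * A * d \<le> 1/2 * d" using assms(2) by (intro mult_right_mono) (auto simp: A_def d_def)
  finally have "d \<le> 2 * t * A\<^sup>2" by simp
  then show thesis using that y A by (simp add: d_def)
qed

lemma continuous_map_Some: "continuous_map euclidean ext_top (Some :: 'a::euclidean_space \<Rightarrow> _)"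
unfolding continuous_map_def
proof (intro conjI allI impI)
  fix U :: "'a option set" assume U: "openin ext_top U"
  have "open {x. Some x \<in> U}"
    unfolding open_dist
  proof
    fix x :: 'a assume "x \<in> {x. Some x \<in> U}"
    then obtain e where e: "e > 0" "\<And>y. chordal (Some x) y < e \<Longrightarrow> y \<in> U" using U by (auto simp: openin_ext_top)
    have "Some y \<in> U" if "dist y x < e" for y
      using that chordal_le_dist[of x y] by (intro e) (simp add: dist_norm norm_minus_commute)
    then show "\<exists>e>0. \<forall>y. dist y x < e \<longrightarrow> y \<in> {x. Some x \<in> U}" using e(1) by auto
  qed
  then show "openin euclidean {x \<in> topspace euclidean. Some x \<in> U}" by simp
qed auto

lemma openin_Some_image:
  fixes V :: "'a::euclidean_space set"
  assumes "open V"
  shows "openin ext_top (Some ` V)"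
  unfolding openin_ext_top
proof
  fix p assume "p \<in> Some ` V"
  then obtain x where x: "p = Some x" "x \<in> V" by auto
  then obtain \<eta> where \<eta>: "\<eta> > 0" "ball x \<eta> \<subseteq> V" using assms by (meson openE)
  define A where "A = sqrt (1 + (norm x)\<^sup>2)"
  have A: "A \<ge> 1" "A\<^sup>2 = 1 + (norm x)\<^sup>2" by (auto simp: A_def add_nonneg_nonneg)
  define t where "t = min (1 / (2 * A)) (\<eta> / (4 * A\<^sup>2))"
  have t: "t > 0" using A(1) \<eta> by (simp add: t_def)
  have "q \<in> Some ` V" if "chordal p q < t" for q
  proof -
    have "2 * t * A \<le> 1"
    proof -
      have "t \<le> 1 / (2 * A)" by (simp add: t_def)
      then show ?thesis using A by (simp add: field_simps)
    qed
    then have "2 * t * sqrt (1 + (norm x)\<^sup>2) \<le> 1" unfolding A_def .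
    moreover have "chordal (Some x) q \<le> t" using that x by simp
    ultimately obtain y where y: "q = Some y" "norm (y - x) \<le> 2 * t * A\<^sup>2"
      unfolding A(2) by (metis chordal_small)
    have "t \<le> \<eta> / (4 * A\<^sup>2)" by (simp add: t_def)
    then have "2 * t * A\<^sup>2 \<le> \<eta> / 2" using A(1) by (simp add: field_simps)
    then have "y \<in> ball x \<eta>" using y \<eta> by (simp add: dist_norm norm_minus_commute)
    then show ?thesis using \<eta> y by auto
  qed
  then show "\<exists>e>0. \<forall>y. chordal p y < e \<longrightarrow> y \<in> Some ` V" using t by blast
qed

lemma openin_compl_Some_cball: "openin ext_top (- Some ` cball (c::'a::euclidean_space) R)"
proof -
  have "compactin ext_top (Some ` cball c R)"
    by (rule image_compactin[OF _ continuous_map_Some]) simp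
  moreover have "Hausdorff_space (ext_top :: 'a option topology)"
    by (simp add: ext_top_eq Chordal.Hausdorff_space_mtopology)
  ultimately have "closedin ext_top (Some ` cball c R)"
    by (simp add: compactin_imp_closedin)
  then show ?thesis by (simp add: closedin_def Compl_eq_Diff_UNIV)
qed

lemma connectedin_meets_sphere:
  assumes "connectedin ext_top S" "p \<in> S" "q \<in> S" "p \<in> Some ` ball c R" "q \<notin> Some ` cball c R"
  shows "\<exists>y \<in> sphere c R. Some y \<in> S"
proof (rule ccontr)
  assume "\<not> ?thesis"
  then have "S \<subseteq> Some ` ball c R \<union> - Some ` cball c R"
    by (auto simp: image_iff)
  moreover have "Some ` ball c R \<inter> - Some ` cball c R \<inter> S = {}" by auto
  ultimately show False
    using connectedinD[OF assms(1) openin_Some_image[OF open_ball, of c R] openin_compl_Some_cball[of c R]] assms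
    by blast
qed

section \<open>Lower bound for the modulus\<close>

lemma norm_sgn_diff_le:
  fixes x y :: "'a::euclidean_space"
  assumes "norm x \<ge> 1/2" "norm y \<ge> 1/2"
  shows "norm (sgn x - sgn y) \<le> 4 * norm (x - y)"
proof -
  have nz: "norm x > 0" "norm y > 0" using assms by auto
  have "sgn x - sgn y = (1 / norm x) *\<^sub>R (x - y) + (1 / norm x - 1 / norm y) *\<^sub>R y"
    by (simp add: sgn_div_norm algebra_simps inverse_eq_divide)
  then have "norm (sgn x - sgn y) \<le> norm ((1 / norm x) *\<^sub>R (x - y)) + norm ((1 / norm x - 1 / norm y) *\<^sub>R y)"
    by (simp only: norm_triangle_ineq)
  also have "norm ((1 / norm x - 1 / norm y) *\<^sub>R y) = \<bar>norm y - norm x\<bar> / norm x"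
    using nz by (simp add: divide_simps abs_if)
  also have "norm ((1 / norm x) *\<^sub>R (x - y)) + \<dots> \<le> 2 * (norm (x - y) / norm x)"
    using norm_triangle_ineq3[of y x] by (simp add: norm_minus_commute divide_right_mono flip: add_divide_distrib)
  also have "\<dots> \<le> 2 * (norm (x - y) / (1/2))"
    using assms by (intro mult_left_mono divide_left_mono) auto
  finally show ?thesis by simp
qed

lemma exists_orthogonal_unit:
  fixes a :: "'a::euclidean_space"
  assumes "DIM('a) \<ge> 2"
  shows "\<exists>w. norm w = 1 \<and> a \<bullet> w = 0"
proof -
  obtain v where "v \<noteq> 0" "orthogonal a v" using orthogonal_to_vector_exists[OF assms] .
  then show ?thesis by (intro exI[of _ "sgn v"]) (auto simp: norm_sgn orthogonal_def sgn_div_norm)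
qed

text \<open>Between unit vectors at a non-obtuse angle the chord has squared norm at least 1/2,
  hence norm at least 7/10; moving one end by less than 1/5 leaves at least 1/2. This is the origin
  of the radius 1/5.\<close>

lemma norm_segment_ge_half:
  fixes a w v :: "'a::euclidean_space"
  assumes "norm a = 1" "norm w = 1" "a \<bullet> w \<ge> 0" "v \<in> ball w (1/5)" "t \<in> {0..1}"
  shows "norm ((1 - t) *\<^sub>R a + t *\<^sub>R v) \<ge> 1/2"
proof -
  let ?m = "(1 - t) *\<^sub>R a + t *\<^sub>R w"
  have "(norm (x + y))\<^sup>2 = (norm x)\<^sup>2 + (norm y)\<^sup>2 + 2 * (x \<bullet> y)" for x y :: 'a
    by (simp add: power2_norm_eq_inner inner_add inner_commute)
  from this[of "(1 - t) *\<^sub>R a" "t *\<^sub>R w"]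
  have "(norm ?m)\<^sup>2 = (1 - t)\<^sup>2 + t\<^sup>2 + 2 * (1 - t) * t * (a \<bullet> w)"
    using assms(1,2) by simp
  moreover have "2 * (1 - t) * t * (a \<bullet> w) \<ge> 0" using assms by (intro mult_nonneg_nonneg) auto
  moreover have "(1 - t)\<^sup>2 + t\<^sup>2 \<ge> (7/10)\<^sup>2"
    using zero_le_power2[of "2 * t - 1"] by (simp add: power2_eq_square algebra_simps)
  ultimately have "(7/10)\<^sup>2 \<le> (norm ?m)\<^sup>2" by linarith
  then have "7/10 \<le> norm ?m" by (rule power2_le_imp_le) simp
  moreover have "norm (t *\<^sub>R (w - v)) \<le> 1 * (1/5)"
    using assms by (simp only: norm_scaleR, intro mult_mono) (auto simp: dist_norm)
  moreover have eq: "(1 - t) *\<^sub>R a + t *\<^sub>R v = ?m - t *\<^sub>R (w - v)" by (simp add: algebra_simps)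
  ultimately show ?thesis unfolding eq using norm_triangle_ineq2[of ?m "t *\<^sub>R (w - v)"] by linarith
qed

text \<open>The constant 12 combines the speed bound 3 of the chord with the Lipschitz bound 4 of
  \<open>norm_sgn_diff_le\<close>.\<close>

lemma lipschitz_radial_projection_segment:
  fixes a v c :: "'a::euclidean_space"
  assumes "\<And>t. t \<in> {0..1} \<Longrightarrow> norm ((1 - t) *\<^sub>R a + t *\<^sub>R v) \<ge> 1/2" "norm (v - a) \<le> 3" "R > 0"
  shows "(12 * R)-lipschitz_on {0..1} (\<lambda>t. c + R *\<^sub>R sgn ((1 - t) *\<^sub>R a + t *\<^sub>R v))"
proof (rule lipschitz_onI)
  fix s t :: real assume st: "s \<in> {0..1}" "t \<in> {0..1}"
  let ?m = "\<lambda>t. (1 - t) *\<^sub>R a + t *\<^sub>R v"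
  have "?m s - ?m t = (s - t) *\<^sub>R (v - a)" by (simp add: algebra_simps)
  then have "norm (?m s - ?m t) \<le> \<bar>s - t\<bar> * 3" using assms(2) by (simp add: mult_left_mono)
  then have "norm (sgn (?m s) - sgn (?m t)) \<le> 12 * \<bar>s - t\<bar>"
    using norm_sgn_diff_le[OF assms(1) assms(1), OF st] by linarith
  then have "R * norm (sgn (?m s) - sgn (?m t)) \<le> R * (12 * \<bar>s - t\<bar>)" using assms(3) by (intro mult_left_mono) auto
  moreover have "dist (c + R *\<^sub>R sgn (?m s)) (c + R *\<^sub>R sgn (?m t)) = R * norm (sgn (?m s) - sgn (?m t))"
    using assms(3) by (simp add: dist_norm flip: scaleR_diff_right)
  ultimately show "dist (c + R *\<^sub>R sgn (?m s)) (c + R *\<^sub>R sgn (?m t)) \<le> 12 * R * dist s t"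
    by (simp add: dist_real_def)
qed (use assms in simp)

text \<open>The path follows the projected chord from \<open>a\<close> to \<open>v\<close> on
  \<open>{0..1}\<close> and the one from \<open>b\<close> to \<open>v\<close> backwards on
  \<open>{1..2}\<close>. Both legs end at the free vertex \<open>v\<close>, over which
  \<open>sphere_length_area\<close> averages.\<close>

lemma spherical_path:
  fixes a b w v c :: "'a::euclidean_space"
  assumes unit: "norm a = 1" "norm b = 1" "norm w = 1" and "a \<bullet> w \<ge> 0" "b \<bullet> w \<ge> 0"
    and v: "v \<in> ball w (1/5)" and R: "R > 0"
  shows "\<exists>\<beta> :: real \<Rightarrow> 'a. (12 * R)-lipschitz_on {0..2} \<beta> \<and> \<beta> 0 = c + R *\<^sub>R a \<and> \<beta> 2 = c + R *\<^sub>R b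
    \<and> \<beta> ` {0..2} \<subseteq> sphere c R
    \<and> (\<forall>\<rho>\<in>borel_measurable borel. (\<integral>\<^sup>+t\<in>{0..2}. \<rho> (\<beta> t) \<partial>lborel) \<le>
       arc_integral (\<lambda>\<theta>. \<rho> (c + R *\<^sub>R \<theta>)) a v
       + arc_integral (\<lambda>\<theta>. \<rho> (c + R *\<^sub>R \<theta>)) b v)"
proof -
  define \<alpha> where "\<alpha> = (\<lambda>a t. c + R *\<^sub>R sgn ((1 - t) *\<^sub>R a + t *\<^sub>R v))"
  have dist3: "norm (v - x) \<le> 3" if "norm x = 1" for x
  proof -
    have "norm (v - x) \<le> norm (v - w) + norm w + norm x"
      by (smt (verit) norm_triangle_ineq norm_triangle_ineq4 diff_add_cancel)
    then show ?thesis using v unit that by (simp add: dist_norm norm_minus_commute)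
  qed
  have half: "norm ((1 - t) *\<^sub>R a + t *\<^sub>R v) \<ge> 1/2" "norm ((1 - t) *\<^sub>R b + t *\<^sub>R v) \<ge> 1/2" if "t \<in> {0..1}" for t
    by (rule norm_segment_ge_half[OF _ unit(3) _ v that], (rule assms)+)+
  have la: "(12 * R)-lipschitz_on {0..1} (\<alpha> a)" and lb: "(12 * R)-lipschitz_on {0..1} (\<alpha> b)"
    unfolding \<alpha>_def using half dist3 unit R by (auto intro!: lipschitz_radial_projection_segment)
  have \<alpha>: "\<alpha> a t \<in> sphere c R" "\<alpha> b t \<in> sphere c R" if "t \<in> {0..1}" for t
  proof -
    have "(1 - t) *\<^sub>R a + t *\<^sub>R v \<noteq> 0" "(1 - t) *\<^sub>R b + t *\<^sub>R v \<noteq> 0"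
      using half[OF that] by auto
    then show "\<alpha> a t \<in> sphere c R" "\<alpha> b t \<in> sphere c R" using R by (auto simp: \<alpha>_def dist_norm norm_sgn)
  qed
  have lb': "(12 * R)-lipschitz_on {1..2} (\<lambda>t. \<alpha> b (2 - t))"
  proof (rule lipschitz_onI)
    fix s t :: real assume "s \<in> {1..2}" "t \<in> {1..2}"
    then show "dist (\<alpha> b (2 - s)) (\<alpha> b (2 - t)) \<le> 12 * R * dist s t"
      using lipschitz_onD[OF lb, of "2 - s" "2 - t"] by (simp add: dist_real_def abs_minus_commute)
  qed (use R in simp)
  define \<beta> where "\<beta> = (\<lambda>t. if t \<le> 1 then \<alpha> a t else \<alpha> b (2 - t))"
  show ?thesis
  proof (intro exI[of _ \<beta>] conjI ballI)
    show "(12 * R)-lipschitz_on {0..2} \<beta>" unfolding \<beta>_def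
      using la lb' by (rule lipschitz_on_concat) (simp add: \<alpha>_def)
    have "sgn a = a" "sgn b = b" using unit by (auto simp: sgn_div_norm)
    then show "\<beta> 0 = c + R *\<^sub>R a" "\<beta> 2 = c + R *\<^sub>R b" by (auto simp: \<beta>_def \<alpha>_def)
    show "\<beta> ` {0..2} \<subseteq> sphere c R"
      using \<alpha> by (auto simp: \<beta>_def simp del: mem_sphere)
    fix \<rho> :: "'a \<Rightarrow> ennreal" assume [measurable]: "\<rho> \<in> borel_measurable borel"
    have [measurable]: "\<alpha> x \<in> borel_measurable borel" for x unfolding \<alpha>_def by measurable
    have "(\<integral>\<^sup>+t\<in>{0..2}. \<rho> (\<beta> t) \<partial>lborel)
      \<le> (\<integral>\<^sup>+t. \<rho> (\<alpha> a t) * indicator {0..1} t + \<rho> (\<alpha> b (2 - t)) * indicator {0..1} (2 - t) \<partial>lborel)"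
      by (intro nn_integral_mono) (auto simp: \<beta>_def indicator_def)
    also have "\<dots> = (\<integral>\<^sup>+t\<in>{0..1}. \<rho> (\<alpha> a t) \<partial>lborel) + (\<integral>\<^sup>+t. \<rho> (\<alpha> b (2 - t)) * indicator {0..1} (2 - t) \<partial>lborel)"
      by (rule nn_integral_add) auto
    also have "(\<integral>\<^sup>+t. \<rho> (\<alpha> b (2 - t)) * indicator {0..1} (2 - t) \<partial>lborel) = (\<integral>\<^sup>+t\<in>{0..1}. \<rho> (\<alpha> b t) \<partial>lborel)"
      by (subst nn_integral_real_affine[where c = "-1" and t = 2 and f = "\<lambda>t. \<rho> (\<alpha> b t) * indicator {0..1} t"]) auto
    finally show "(\<integral>\<^sup>+t\<in>{0..2}. \<rho> (\<beta> t) \<partial>lborel) \<le>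
       arc_integral (\<lambda>\<theta>. \<rho> (c + R *\<^sub>R \<theta>)) a v
       + arc_integral (\<lambda>\<theta>. \<rho> (c + R *\<^sub>R \<theta>)) b v"
      by (simp only: \<alpha>_def)
  qed
qed

abbreviation ext_homeomorphism :: "'a::euclidean_space set \<Rightarrow> ('a \<Rightarrow> 'a option) \<Rightarrow> bool" where
  "ext_homeomorphism D f \<equiv> homeomorphic_map (top_of_set D) (subtopology ext_top (f ` D)) f"

abbreviation ring_image_modulus :: "('a::euclidean_space \<Rightarrow> 'a option) \<Rightarrow> 'a set \<Rightarrow> 'a \<Rightarrow> real \<Rightarrow> real \<Rightarrow> ennreal" where
  "ring_image_modulus f D w r1 r2 \<equiv>
     modulus (image_family f D (path_family (Some ` sphere w r1) (Some ` sphere w r2) (Some ` D)))"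

text \<open>The pull-back of \<open>\<beta>\<close> under \<open>f\<close> starts within distance
  \<open>r1\<close> of \<open>w\<close> and ends at distance at least \<open>r2\<close>, so the
  intermediate value theorem cuts out a subpath from one sphere to the other. Members of the family
  only have to stay in \<open>D\<close>, so the subpath may leave the annulus in between.\<close>

lemma image_path_through_ring:
  fixes f :: "'a::euclidean_space \<Rightarrow> 'a option" and \<beta> :: "real \<Rightarrow> 'a"
  assumes f: "ext_homeomorphism D f"
    and \<beta>: "continuous_on {0..2} \<beta>" "\<And>t. t \<in> {0..2} \<Longrightarrow> Some (\<beta> t) \<in> f ` D"
    and u: "u \<in> D" "f u = Some (\<beta> 0)" "dist u w \<le> r1"
    and u': "u' \<in> D" "f u' = Some (\<beta> 2)" "r2 \<le> dist u' w" and "r1 < r2"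
  shows "\<exists>a b g. 0 \<le> a \<and> b \<le> 2 \<and> (\<forall>t\<in>{a..b}. g t = Some (\<beta> t)) \<and>
    ({a..b}, g) \<in> image_family f D (path_family (Some ` sphere w r1) (Some ` sphere w r2) (Some ` D))"
proof -
  obtain g where g: "homeomorphic_maps (top_of_set D) (subtopology ext_top (f ` D)) f g"
    using f homeomorphic_map_maps by blast
  then have gc: "continuous_map (subtopology ext_top (f ` D)) (top_of_set D) g"
    and gf: "\<And>x. x \<in> D \<Longrightarrow> g (f x) = x" and fg: "\<And>y. y \<in> f ` D \<Longrightarrow> f (g y) = y"
    by (auto simp: homeomorphic_maps_def)
  define \<gamma> where "\<gamma> = (\<lambda>t. g (Some (\<beta> t)))"
  have "continuous_map (top_of_set {0..2}) ext_top (Some \<circ> \<beta>)"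
    using \<beta>(1) by (intro continuous_map_compose[OF _ continuous_map_Some]) simp
  then have "continuous_map (top_of_set {0..2}) (subtopology ext_top (f ` D)) (Some \<circ> \<beta>)"
    using \<beta>(2) by (auto simp: continuous_map_in_subtopology)
  then have "continuous_map (top_of_set {0..2}) (top_of_set D) (g \<circ> (Some \<circ> \<beta>))"
    using gc by (rule continuous_map_compose)
  then have \<gamma>: "continuous_on {0..2} \<gamma>" "\<And>t. t \<in> {0..2} \<Longrightarrow> \<gamma> t \<in> D"
    by (auto simp: \<gamma>_def o_def continuous_map_in_subtopology)
  have f\<gamma>: "f (\<gamma> t) = Some (\<beta> t)" if "t \<in> {0..2}" for t
    using fg \<beta>(2)[OF that] by (simp add: \<gamma>_def)
  have ends: "\<gamma> 0 = u" "\<gamma> 2 = u'" using gf u u' unfolding \<gamma>_def by metis+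
  have cd: "continuous_on {0..2} (\<lambda>t. dist (\<gamma> t) w)" by (intro continuous_intros \<gamma>)
  obtain a where a: "0 \<le> a" "a \<le> 2" "dist (\<gamma> a) w = r1"
    using IVT'[of "\<lambda>t. dist (\<gamma> t) w" 0 r1 2] cd ends u u' \<open>r1 < r2\<close> by auto
  have "continuous_on {a..2} (\<lambda>t. dist (\<gamma> t) w)" by (rule continuous_on_subset[OF cd]) (use a in auto)
  then obtain b where b: "a \<le> b" "b \<le> 2" "dist (\<gamma> b) w = r2"
    using IVT'[of "\<lambda>t. dist (\<gamma> t) w" a r2 2] a ends u' \<open>r1 < r2\<close> by auto
  have "a \<noteq> b" using a b \<open>r1 < r2\<close> by auto
  then have ab: "a < b" "{a..b} \<subseteq> {0..2}" using a b by auto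
  have "continuous_map (top_of_set {a..b}) ext_top (Some \<circ> \<gamma>)"
    using continuous_on_subset[OF \<gamma>(1) ab(2)] by (intro continuous_map_compose[OF _ continuous_map_Some]) simp
  then have "({a..b}, Some \<circ> \<gamma>) \<in> path_family (Some ` sphere w r1) (Some ` sphere w r2) (Some ` D)"
    unfolding path_family_def using ab a b \<gamma>(2)
    by (auto intro!: exI[of _ a] exI[of _ b] exI[of _ "Some \<circ> \<gamma>"] simp: dist_commute)
  then have "({t \<in> {a..b}. (Some \<circ> \<gamma>) t \<in> Some ` D}, \<lambda>t. f (the ((Some \<circ> \<gamma>) t)))
      \<in> image_family f D (path_family (Some ` sphere w r1) (Some ` sphere w r2) (Some ` D))"
    unfolding image_family_def by blast
  moreover have "{t \<in> {a..b}. (Some \<circ> \<gamma>) t \<in> Some ` D} = {a..b}" using \<gamma>(2) ab by auto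
  ultimately have "({a..b}, \<lambda>t. f (\<gamma> t)) \<in> image_family f D (path_family (Some ` sphere w r1) (Some ` sphere w r2) (Some ` D))"
    by simp
  then show ?thesis using f\<gamma> ab a b by (intro exI[of _ a] exI[of _ b] exI[of _ "\<lambda>t. f (\<gamma> t)"]) auto
qed

lemma nn_integral_inverse_interval:
  assumes "0 < a" "a \<le> b"
  shows "(\<integral>\<^sup>+r. ennreal (1 / r) * indicator {a..b} r \<partial>lborel) = ennreal (ln (b / a))"
proof -
  have "(\<integral>\<^sup>+r. ennreal (1 / r) * indicator {a..b} r \<partial>lborel) = ennreal (ln b - ln a)"
    using assms by (intro nn_integral_FTC_Icc) (auto intro!: derivative_eq_intros DERIV_subset[OF DERIV_ln_divide])
  then show ?thesis using assms by (simp add: ln_div)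
qed

text \<open>On each sphere \<open>sphere_length_area\<close> with \<open>L = 12 * R\<close> bounds
  the integral of \<open>\<rho> ^ n\<close> over directions from below by
  \<open>c1 / (12 * R) ^ n\<close>; the polar weight \<open>R ^ (n-1)\<close> turns this into a
  multiple of \<open>1 / R\<close>, whose integral is the logarithm. \<open>c0\<close> depends on
  the dimension alone, so the bound is the same for every \<open>f\<close>, \<open>D\<close> and
  ring.\<close>

lemma modulus_image_ring_ge:
  assumes dim: "DIM('a::euclidean_space) \<ge> 2"
  shows "\<exists>c0>0. \<forall>D (f :: 'a \<Rightarrow> 'a option) w r1 r2 c R0 R1.
      ext_homeomorphism D f \<and> r1 < r2 \<and> 0 < R0 \<and> R0 < R1 \<and>
      (\<forall>R. R0 < R \<longrightarrow> R < R1 \<longrightarrow> Some ` sphere c R \<subseteq> f ` D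
          \<and> (\<exists>u\<in>D. dist u w \<le> r1 \<and> f u \<in> Some ` sphere c R) \<and> (\<exists>u\<in>D. r2 \<le> dist u w \<and> f u \<in> Some ` sphere c R))
      \<longrightarrow> ennreal (c0 * ln (R1 / R0)) \<le> ring_image_modulus f D w r1 r2"
proof -
  let ?n = "DIM('a)"
  obtain k where k: "?n = Suc k" using DIM_positive[where 'a='a] by (cases ?n) auto
  obtain c1 where c1: "c1 > 0" and area: "\<forall>G\<in>borel_measurable (borel :: 'a measure). \<forall>a b w L.
      norm a = 1 \<and> norm b = 1 \<and> norm w = 1 \<and> L > 0 \<and>
      (\<forall>u\<in>ball w (1/5). 1 \<le> ennreal L * (arc_integral G a u
          + arc_integral G b u))
      \<longrightarrow> ennreal (c1 / L ^ DIM('a)) \<le> (\<integral>\<^sup>+\<theta>. G \<theta> ^ DIM('a) \<partial>cone_measure)"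
    using sphere_length_area[where 'a='a] by blast
  define c0 where "c0 = ?n * c1 / 12 ^ ?n"
  have c0: "c0 > 0" using c1 by (simp add: c0_def)
  show ?thesis
  proof (intro exI[of _ c0] conjI allI impI, rule c0)
    fix D :: "'a set" and f :: "'a \<Rightarrow> 'a option" and w c :: 'a and r1 r2 R0 R1 :: real
    assume asm: "ext_homeomorphism D f \<and> r1 < r2 \<and> 0 < R0 \<and> R0 < R1 \<and>
      (\<forall>R. R0 < R \<longrightarrow> R < R1 \<longrightarrow> Some ` sphere c R \<subseteq> f ` D
          \<and> (\<exists>u\<in>D. dist u w \<le> r1 \<and> f u \<in> Some ` sphere c R) \<and> (\<exists>u\<in>D. r2 \<le> dist u w \<and> f u \<in> Some ` sphere c R))"
    then have f: "ext_homeomorphism D f" and r: "r1 < r2" and R: "0 < R0" "R0 < R1"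
      by auto
    have sph: "Some ` sphere c R \<subseteq> f ` D \<and> (\<exists>u\<in>D. dist u w \<le> r1 \<and> f u \<in> Some ` sphere c R)
       \<and> (\<exists>u\<in>D. r2 \<le> dist u w \<and> f u \<in> Some ` sphere c R)" if "R0 < R" "R < R1" for R
      using asm that by blast
    let ?\<Gamma> = "image_family f D (path_family (Some ` sphere w r1) (Some ` sphere w r2) (Some ` D))"
    show "ennreal (c0 * ln (R1 / R0)) \<le> modulus ?\<Gamma>"
      unfolding modulus_def
    proof (rule INF_greatest)
      fix \<rho> assume "\<rho> \<in> {\<rho>. admissible \<rho> ?\<Gamma>}"
      then have \<rho> [measurable]: "\<rho> \<in> borel_measurable borel"
        and adm: "\<And>p. p \<in> ?\<Gamma> \<Longrightarrow> locally_rectifiable p \<Longrightarrow> 1 \<le> line_integral \<rho> p"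
        by (auto simp: admissible_def)
      have \<Psi>: "ennreal (c1 / (12 * R) ^ ?n) \<le> (\<integral>\<^sup>+\<theta>. \<rho> (c + R *\<^sub>R \<theta>) ^ ?n \<partial>cone_measure)" if RR: "R0 < R" "R < R1" for R
      proof -
        have Rpos: "R > 0" using R RR by simp
        obtain u u' y y' where u: "u \<in> D" "dist u w \<le> r1" "f u = Some y" "y \<in> sphere c R"
          and u': "u' \<in> D" "r2 \<le> dist u' w" "f u' = Some y'" "y' \<in> sphere c R"
          using sph[OF RR] by blast
        define a b where "a = (1 / R) *\<^sub>R (y - c)" and "b = (1 / R) *\<^sub>R (y' - c)"
        have ab: "norm a = 1" "norm b = 1" "y = c + R *\<^sub>R a" "y' = c + R *\<^sub>R b"
          using u u' Rpos by (auto simp: a_def b_def dist_norm norm_minus_commute)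
        \<comment> \<open>Some unit vector is orthogonal to \<open>a\<close> because the dimension
          is at least 2; it or its negative makes a non-obtuse angle with \<open>b\<close>, so the
          chords from both points to its neighbourhood avoid the origin.\<close>
        obtain w0 where w0: "norm w0 = 1" "a \<bullet> w0 = 0" using exists_orthogonal_unit[OF dim] by blast
        obtain v0 where v0: "norm v0 = 1" "a \<bullet> v0 \<ge> 0" "b \<bullet> v0 \<ge> 0"
        proof (cases "b \<bullet> w0 \<ge> 0")
          case True then show ?thesis using that[of w0] w0 by simp
        next
          case False then show ?thesis using that[of "- w0"] w0 by simp
        qed
        have [measurable]: "(\<lambda>\<theta>. \<rho> (c + R *\<^sub>R \<theta>)) \<in> borel_measurable borel" by measurable
        show ?thesis
        proof (rule area[rule_format, of "\<lambda>\<theta>. \<rho> (c + R *\<^sub>R \<theta>)" a b v0 "12 * R"], measurable, intro conjI ballI)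
          fix v assume v: "v \<in> ball v0 (1/5)"
          let ?I = "arc_integral (\<lambda>\<theta>. \<rho> (c + R *\<^sub>R \<theta>)) a v
             + arc_integral (\<lambda>\<theta>. \<rho> (c + R *\<^sub>R \<theta>)) b v"
          obtain \<beta> :: "real \<Rightarrow> 'a" where \<beta>: "(12 * R)-lipschitz_on {0..2} \<beta>" "\<beta> 0 = c + R *\<^sub>R a" "\<beta> 2 = c + R *\<^sub>R b"
            "\<beta> ` {0..2} \<subseteq> sphere c R"
            and I: "\<forall>\<rho>\<in>borel_measurable borel. (\<integral>\<^sup>+t\<in>{0..2}. \<rho> (\<beta> t) \<partial>lborel) \<le>
              arc_integral (\<lambda>\<theta>. \<rho> (c + R *\<^sub>R \<theta>)) a v
              + arc_integral (\<lambda>\<theta>. \<rho> (c + R *\<^sub>R \<theta>)) b v"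
            using spherical_path[OF ab(1,2) v0 v Rpos, of c] by (elim exE conjE)
          have inD: "\<And>t. t \<in> {0..2} \<Longrightarrow> Some (\<beta> t) \<in> f ` D" using \<beta>(4) sph[OF RR] by blast
          have fu: "f u = Some (\<beta> 0)" "f u' = Some (\<beta> 2)" using u(3) u'(3) ab \<beta>(2,3) by auto
          obtain s1 s2 g where s: "0 \<le> s1" "s2 \<le> 2" "\<forall>t\<in>{s1..s2}. g t = Some (\<beta> t)" "({s1..s2}, g) \<in> ?\<Gamma>"
            using image_path_through_ring[OF f lipschitz_on_continuous_on[OF \<beta>(1)] inD u(1) fu(1) u(2) u'(1) fu(2) u'(2) r] by blast
          have lip: "(12 * R)-lipschitz_on {s1..s2} \<beta>" by (rule lipschitz_on_subset[OF \<beta>(1)]) (use s in auto)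
          have "1 \<le> line_integral \<rho> ({s1..s2}, g)"
            using adm[OF s(4) locally_rectifiable_lipschitz[OF lip bspec[OF s(3)]]] by simp
          also have "\<dots> \<le> ennreal (12 * R) * (\<integral>\<^sup>+t\<in>{s1..s2}. \<rho> (\<beta> t) \<partial>lborel)"
            by (rule line_integral_le_lipschitz[OF lip bspec[OF s(3)] \<rho>])
          also have "\<dots> \<le> ennreal (12 * R) * (\<integral>\<^sup>+t\<in>{0..2}. \<rho> (\<beta> t) \<partial>lborel)"
            using s by (intro mult_left_mono nn_integral_mono mult_left_mono) (auto simp: indicator_def)
          also have "\<dots> \<le> ennreal (12 * R) * ?I" using bspec[OF I \<rho>] by (intro mult_left_mono) auto
          finally show "1 \<le> ennreal (12 * R) * ?I" .
        qed (use ab v0 Rpos in auto)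
      qed
      have "ennreal (c0 * ln (R1 / R0)) = ennreal c0 * (\<integral>\<^sup>+r. ennreal (1 / r) * indicator {R0..R1} r \<partial>lborel)"
        using R c0 by (simp add: nn_integral_inverse_interval ennreal_mult')
      also have "\<dots> = (\<integral>\<^sup>+r. ennreal c0 * (ennreal (1 / r) * indicator {R0..R1} r) \<partial>lborel)"
        by (rule nn_integral_cmult[symmetric]) auto
      also have "\<dots> \<le> (\<integral>\<^sup>+r. of_nat ?n * (ennreal (indicator {0<..} r * r ^ (?n - 1)) * (\<integral>\<^sup>+\<theta>. \<rho> (c + r *\<^sub>R \<theta>) ^ ?n \<partial>cone_measure)) \<partial>lborel)"
      proof (rule nn_integral_mono_AE)
        have "AE r::real in lborel. r \<noteq> R0" "AE r::real in lborel. r \<noteq> R1" by (rule AE_lborel_singleton)+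
        then show "AE r in lborel. ennreal c0 * (ennreal (1 / r) * indicator {R0..R1} r)
           \<le> of_nat ?n * (ennreal (indicator {0<..} r * r ^ (?n - 1)) * (\<integral>\<^sup>+\<theta>. \<rho> (c + r *\<^sub>R \<theta>) ^ ?n \<partial>cone_measure))"
        proof eventually_elim
          case (elim r)
          show ?case
          proof (cases "r \<in> {R0..R1}")
            case True
            then have rr: "R0 < r" "r < R1" "r > 0" using elim R by auto
            have "c0 * (1 / r) = ?n * (r ^ (?n - 1) * (c1 / (12 * r) ^ ?n))"
              using rr k by (simp add: c0_def power_mult_distrib field_simps)
            then have "ennreal c0 * ennreal (1 / r) = ennreal (?n * (r ^ (?n - 1) * (c1 / (12 * r) ^ ?n)))"
              using c0 rr by (simp flip: ennreal_mult')
            also have "\<dots> = of_nat ?n * (ennreal (r ^ (?n - 1)) * ennreal (c1 / (12 * r) ^ ?n))"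
              using rr c1 by (subst ennreal_mult, simp, simp, subst ennreal_mult) (auto simp: ennreal_of_nat_eq_real_of_nat)
            also have "\<dots> \<le> of_nat ?n * (ennreal (r ^ (?n - 1)) * (\<integral>\<^sup>+\<theta>. \<rho> (c + r *\<^sub>R \<theta>) ^ ?n \<partial>cone_measure))"
              using \<Psi>[OF rr(1,2)] by (intro mult_left_mono) auto
            finally show ?thesis using True rr by simp
          qed simp
        qed
      qed
      also have "\<dots> = of_nat ?n * (\<integral>\<^sup>+r. ennreal (indicator {0<..} r * r ^ (?n - 1)) * (\<integral>\<^sup>+\<theta>. \<rho> (c + r *\<^sub>R \<theta>) ^ ?n \<partial>cone_measure) \<partial>lborel)"
      proof (rule nn_integral_cmult)
        interpret sigma_finite_measure "cone_measure :: 'a measure" by (rule sigma_finite_cone_measure)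
        show "(\<lambda>r. ennreal (indicator {0<..} r * r ^ (?n - 1)) * (\<integral>\<^sup>+\<theta>. \<rho> (c + r *\<^sub>R \<theta>) ^ ?n \<partial>cone_measure)) \<in> borel_measurable lborel"
          by measurable
      qed
      also have "\<dots> = (\<integral>\<^sup>+x. \<rho> (c + x) ^ ?n \<partial>lborel)"
        by (rule nn_integral_polar[symmetric]) measurable
      also have "\<dots> = (\<integral>\<^sup>+x. \<rho> x ^ ?n \<partial>lborel)"
        using nn_integral_lborel_scaleR[of "\<lambda>x. \<rho> x ^ ?n" 1 c] by simp
      finally show "ennreal (c0 * ln (R1 / R0)) \<le> (\<integral>\<^sup>+x. \<rho> x ^ ?n \<partial>lborel)" .
    qed
  qed
qed

section \<open>Hausdorff measure\<close>

definition hausdorff_weight :: "real \<Rightarrow> 'a::euclidean_space set \<Rightarrow> ennreal" where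
  "hausdorff_weight s C = ennreal (pi powr (s/2) / Gamma (s/2 + 1) * (diameter C / 2) powr s)"

definition hausdorff_covers :: "real \<Rightarrow> 'a::euclidean_space set \<Rightarrow> (nat \<Rightarrow> 'a set) set" where
  "hausdorff_covers \<epsilon> E = {C. E \<subseteq> (\<Union>i. C i) \<and> (\<forall>i. bounded (C i) \<and> diameter (C i) \<le> \<epsilon>)}"

lemma hausdorff_delta_alt:
  "hausdorff_delta s \<epsilon> E = (INF C \<in> hausdorff_covers \<epsilon> E. \<Sum>i. hausdorff_weight s (C i))"
  by (simp add: hausdorff_delta_def hausdorff_weight_def hausdorff_covers_def)

text \<open>\<open>0 powr s\<close> is 0 for every \<open>s\<close>, so covers can be padded with
  empty sets at no cost.\<close>

lemma hausdorff_weight_empty [simp]: "hausdorff_weight s {} = 0"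
  by (simp add: hausdorff_weight_def)

lemma hausdorff_delta_empty:
  assumes "\<epsilon> > 0"
  shows "hausdorff_delta s \<epsilon> ({} :: 'a::euclidean_space set) = 0"
proof -
  have "(\<lambda>_. {} :: 'a set) \<in> hausdorff_covers \<epsilon> {}" using assms by (simp add: hausdorff_covers_def)
  then have "hausdorff_delta s \<epsilon> ({} :: 'a set) \<le> (\<Sum>i::nat. hausdorff_weight s ({} :: 'a set))"
    unfolding hausdorff_delta_alt by (rule INF_lower2) simp
  then show ?thesis by simp
qed

lemma hausdorff_delta_mono:
  assumes "A \<subseteq> B" "\<epsilon>' \<le> \<epsilon>"
  shows "hausdorff_delta s \<epsilon> A \<le> hausdorff_delta s \<epsilon>' B"
  unfolding hausdorff_delta_alt
  by (rule INF_superset_mono) (use assms in \<open>auto simp: hausdorff_covers_def intro: order_trans\<close>)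

text \<open>Covers that are optimal up to \<open>e / 2 ^ (k+1)\<close> are merged into one sequence
  by \<open>prod_decode\<close>.\<close>

lemma hausdorff_delta_subadditive:
  "hausdorff_delta s \<epsilon> (\<Union>k. A k) \<le> (\<Sum>k. hausdorff_delta s \<epsilon> (A k :: 'a::euclidean_space set))"
proof (rule ennreal_le_epsilon)
  fix e :: real assume e: "e > 0" and fin: "(\<Sum>k. hausdorff_delta s \<epsilon> (A k)) < top"
  have "\<exists>C\<in>hausdorff_covers \<epsilon> (A k). (\<Sum>i. hausdorff_weight s (C i)) \<le> hausdorff_delta s \<epsilon> (A k) + ennreal (e * (1/2) ^ Suc k)" for k
  proof -
    have "hausdorff_delta s \<epsilon> (A k) \<noteq> top" using ennreal_suminf_lessD[OF fin, of k] by simp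
    then have "hausdorff_delta s \<epsilon> (A k) < hausdorff_delta s \<epsilon> (A k) + ennreal (e * (1/2) ^ Suc k)"
      using e by (simp add: ennreal_add_left_cancel_less[of _ 0, simplified] less_top)
    then show ?thesis unfolding hausdorff_delta_alt[of s \<epsilon> "A k"] INF_less_iff by (auto intro: less_imp_le)
  qed
  then obtain C where C: "\<And>k. C k \<in> hausdorff_covers \<epsilon> (A k)"
    "\<And>k. (\<Sum>i. hausdorff_weight s (C k i)) \<le> hausdorff_delta s \<epsilon> (A k) + ennreal (e * (1/2) ^ Suc k)"
    by metis
  have "(\<lambda>m. case_prod C (prod_decode m)) \<in> hausdorff_covers \<epsilon> (\<Union>k. A k)"
    unfolding hausdorff_covers_def
  proof (intro CollectI conjI allI)
    show "(\<Union>k. A k) \<subseteq> (\<Union>m. case_prod C (prod_decode m))"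
    proof
      fix x assume "x \<in> (\<Union>k. A k)"
      then obtain k i where "x \<in> C k i" using C(1) by (fastforce simp: hausdorff_covers_def)
      then have "x \<in> case_prod C (prod_decode (prod_encode (k, i)))" by simp
      then show "x \<in> (\<Union>m. case_prod C (prod_decode m))" by (rule UN_I[OF UNIV_I])
    qed
  qed (use C(1) in \<open>auto simp: hausdorff_covers_def split: prod.split\<close>)
  then have "hausdorff_delta s \<epsilon> (\<Union>k. A k) \<le> (\<Sum>m. hausdorff_weight s (case_prod C (prod_decode m)))"
    unfolding hausdorff_delta_alt by (rule INF_lower)
  also have "\<dots> = (\<Sum>m. (\<lambda>(k, i). hausdorff_weight s (C k i)) (prod_decode m))"
    by (simp add: case_prod_unfold)
  also have "\<dots> = (\<Sum>k. \<Sum>i. hausdorff_weight s (C k i))"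
    by (rule suminf_ennreal_2dimen) simp
  also have "\<dots> \<le> (\<Sum>k. hausdorff_delta s \<epsilon> (A k) + ennreal (e * (1/2) ^ Suc k))"
    by (intro suminf_le C(2)) auto
  also have "\<dots> = (\<Sum>k. hausdorff_delta s \<epsilon> (A k)) + (\<Sum>k. ennreal (e * (1/2) ^ Suc k))"
    by (rule suminf_add[symmetric]) auto
  also have "(\<Sum>k. ennreal (e * (1/2) ^ Suc k)) = ennreal e"
    using e sums_mult[OF power_half_series, of e] by (intro suminf_ennreal_eq) auto
  finally show "hausdorff_delta s \<epsilon> (\<Union>k. A k) \<le> (\<Sum>k. hausdorff_delta s \<epsilon> (A k)) + ennreal e" .
qed

lemma hausdorff_delta_le_outer: "\<epsilon> > 0 \<Longrightarrow> hausdorff_delta s \<epsilon> A \<le> hausdorff_outer s A"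
  unfolding hausdorff_outer_def by (rule SUP_upper) simp

lemma hausdorff_outer_mono: "A \<subseteq> B \<Longrightarrow> hausdorff_outer s A \<le> hausdorff_outer s B"
  unfolding hausdorff_outer_def by (rule SUP_mono) (auto intro!: hausdorff_delta_mono)

lemma hausdorff_outer_empty [simp]: "hausdorff_outer s {} = 0"
  by (simp add: hausdorff_outer_def hausdorff_delta_empty)

lemma hausdorff_outer_countable_subadditive:
  "hausdorff_outer s (\<Union>k. A k) \<le> (\<Sum>k. hausdorff_outer s (A k))"
  unfolding hausdorff_outer_def[of s "\<Union>k. A k"]
proof (rule SUP_least)
  fix \<epsilon> :: real assume "\<epsilon> \<in> {0<..}"
  then have "(\<Sum>k. hausdorff_delta s \<epsilon> (A k)) \<le> (\<Sum>k. hausdorff_outer s (A k))"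
    by (intro suminf_le hausdorff_delta_le_outer) auto
  then show "hausdorff_delta s \<epsilon> (\<Union>k. A k) \<le> (\<Sum>k. hausdorff_outer s (A k))"
    using hausdorff_delta_subadditive order_trans by blast
qed

lemma outer_measure_space_hausdorff: "outer_measure_space (Pow UNIV) (hausdorff_outer s)"
  unfolding outer_measure_space_def positive_def increasing_def countably_subadditive_def
  using hausdorff_outer_mono hausdorff_outer_countable_subadditive by auto

lemma hausdorff_outer_Un_le:
  "hausdorff_outer s (A \<union> B :: 'a::euclidean_space set) \<le> hausdorff_outer s A + hausdorff_outer s B"
proof -
  interpret sigma_algebra UNIV "Pow UNIV :: 'a set set" by (rule sigma_algebra_Pow)
  have "subadditive (Pow UNIV) (hausdorff_outer s :: 'a set \<Rightarrow> ennreal)"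
    using outer_measure_space_hausdorff[of s] countably_subadditive_subadditive
    by (metis outer_measure_space_def)
  then show ?thesis using hausdorff_outer_mono[of "A \<union> B" "A \<union> (B - A)" s] hausdorff_outer_mono[of "B - A" B s]
    unfolding subadditive_def by (metis Diff_disjoint Diff_subset Pow_UNIV UNIV_I Un_Diff_cancel add_left_mono order_trans)
qed

text \<open>A covering set of diameter below the distance of \<open>A\<close> and \<open>B\<close> meets only one of the two.\<close>

lemma hausdorff_outer_separated:
  fixes A B :: "'a::euclidean_space set"
  assumes d: "d > 0" and sep: "\<And>a b. a \<in> A \<Longrightarrow> b \<in> B \<Longrightarrow> d \<le> dist a b"
  shows "hausdorff_outer s A + hausdorff_outer s B \<le> hausdorff_outer s (A \<union> B)"
proof -
  have 1: "hausdorff_delta s \<epsilon> A + hausdorff_delta s \<epsilon> B \<le> hausdorff_delta s \<epsilon> (A \<union> B)" if \<epsilon>: "0 < \<epsilon>" "\<epsilon> < d" for \<epsilon>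
    unfolding hausdorff_delta_alt[of s \<epsilon> "A \<union> B"]
  proof (rule INF_greatest)
    fix C assume C: "C \<in> hausdorff_covers \<epsilon> (A \<union> B)"
    define CA CB where "CA = (\<lambda>i. if C i \<inter> A \<noteq> {} then C i else {})" and "CB = (\<lambda>i. if C i \<inter> A \<noteq> {} then {} else C i)"
    have "C i \<inter> B = {}" if CA: "C i \<inter> A \<noteq> {}" for i
    proof (rule ccontr)
      assume "C i \<inter> B \<noteq> {}"
      then obtain a b where "a \<in> A" "b \<in> B" "a \<in> C i" "b \<in> C i" using CA by blast
      moreover have "bounded (C i)" "diameter (C i) \<le> \<epsilon>" using C by (auto simp: hausdorff_covers_def)
      ultimately show False using sep[of a b] diameter_bounded_bound[of "C i" a b] \<epsilon> by linarith
    qed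
    note disj = this
    have sub: "A \<union> B \<subseteq> (\<Union>i. C i)" and bd: "\<And>i. bounded (C i)" "\<And>i. diameter (C i) \<le> \<epsilon>"
      using C by (auto simp: hausdorff_covers_def)
    have "A \<subseteq> (\<Union>i. CA i)"
    proof
      fix x assume "x \<in> A"
      then obtain i where "x \<in> C i" using sub by blast
      then show "x \<in> (\<Union>i. CA i)" using \<open>x \<in> A\<close> by (intro UN_I[of i]) (auto simp: CA_def)
    qed
    moreover have "B \<subseteq> (\<Union>i. CB i)"
    proof
      fix x assume "x \<in> B"
      then obtain i where "x \<in> C i" using sub by blast
      then show "x \<in> (\<Union>i. CB i)" using \<open>x \<in> B\<close> disj[of i] by (intro UN_I[of i]) (auto simp: CB_def)
    qed
    ultimately have "CA \<in> hausdorff_covers \<epsilon> A" "CB \<in> hausdorff_covers \<epsilon> B"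
      using bd \<epsilon> by (auto simp: hausdorff_covers_def CA_def CB_def)
    then have "hausdorff_delta s \<epsilon> A + hausdorff_delta s \<epsilon> B \<le> (\<Sum>i. hausdorff_weight s (CA i)) + (\<Sum>i. hausdorff_weight s (CB i))"
      unfolding hausdorff_delta_alt by (intro add_mono INF_lower)
    also have "\<dots> = (\<Sum>i. hausdorff_weight s (CA i) + hausdorff_weight s (CB i))" by (rule suminf_add) auto
    also have "\<dots> = (\<Sum>i. hausdorff_weight s (C i))" by (rule suminf_cong) (simp add: CA_def CB_def)
    finally show "hausdorff_delta s \<epsilon> A + hausdorff_delta s \<epsilon> B \<le> (\<Sum>i. hausdorff_weight s (C i))" .
  qed
  \<comment> \<open>The two suprema range over independent scales; a common scale below
    \<open>d\<close> dominates any pair, since finer covers only increase the value.\<close>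
  have 2: "hausdorff_delta s \<epsilon>1 A + hausdorff_delta s \<epsilon>2 B \<le> hausdorff_outer s (A \<union> B)" if "\<epsilon>1 > 0" "\<epsilon>2 > 0" for \<epsilon>1 \<epsilon>2
  proof -
    define m where "m = min (min \<epsilon>1 \<epsilon>2) (d / 2)"
    have m: "0 < m" "m < d" "m \<le> \<epsilon>1" "m \<le> \<epsilon>2" using that d by (auto simp: m_def)
    have "hausdorff_delta s \<epsilon>1 A + hausdorff_delta s \<epsilon>2 B \<le> hausdorff_delta s m A + hausdorff_delta s m B"
      using m by (intro add_mono hausdorff_delta_mono) auto
    also have "\<dots> \<le> hausdorff_delta s m (A \<union> B)" using 1 m by blast
    also have "\<dots> \<le> hausdorff_outer s (A \<union> B)" using m by (intro hausdorff_delta_le_outer)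
    finally show ?thesis .
  qed
  have "hausdorff_delta s \<epsilon> A + hausdorff_outer s B \<le> hausdorff_outer s (A \<union> B)" if "\<epsilon> > 0" for \<epsilon>
  proof -
    have "hausdorff_outer s B + hausdorff_delta s \<epsilon> A = (SUP \<epsilon>2\<in>{0<..}. hausdorff_delta s \<epsilon>2 B + hausdorff_delta s \<epsilon> A)"
      unfolding hausdorff_outer_def by (subst ennreal_SUP_add_left) auto
    also have "\<dots> \<le> hausdorff_outer s (A \<union> B)" using 2[OF that] by (intro SUP_least) (auto simp: add.commute)
    finally show ?thesis by (simp add: add.commute)
  qed
  then show ?thesis
    unfolding hausdorff_outer_def[of s A] by (subst ennreal_SUP_add_left[symmetric]) (auto intro: SUP_least)
qed

text \<open>Caratheodory's criterion for metric outer measures. \<open>A - C\<close> is sliced by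
  distance to \<open>C\<close>; slices of equal parity are a positive distance apart, so the slice
  measures have a sum \<open>T\<close> of at most twice the measure of \<open>A\<close>. The part
  \<open>B k\<close> of \<open>A\<close>, at distance at least \<open>1 / (k+1)\<close> from
  \<open>C\<close>, is separated from \<open>A \<inter> C\<close>.\<close>

lemma closed_hausdorff_measurable:
  fixes C A :: "'a::euclidean_space set"
  assumes C: "closed C" "C \<noteq> {}"
  shows "hausdorff_outer s (A \<inter> C) + hausdorff_outer s (A - C) \<le> hausdorff_outer s A"
proof (cases "hausdorff_outer s A = top")
  case False
  let ?H = "hausdorff_outer s"
  define g where "g = (\<lambda>x. infdist x C)"
  have lip: "g x \<le> g y + dist x y" for x y unfolding g_def by (rule infdist_triangle)
  define R where "R = (\<lambda>k. {x \<in> A. 1 / real (k + 2) \<le> g x \<and> g x < 1 / real (k + 1)})"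
  define B where "B = (\<lambda>k. {x \<in> A. 1 / real (k + 1) \<le> g x})"
  \<comment> \<open>Consecutive slices may touch, those of equal parity may not. The case
    \<open>N = 0\<close> is treated apart because for \<open>p = 0\<close> the gap would involve a
    division by zero.\<close>
  have sepR: "(\<Sum>i<N. ?H (R (2 * i + p))) \<le> ?H (\<Union>i<N. R (2 * i + p))" for N p
  proof (induction N)
    case (Suc N)
    show ?case
    proof (cases "N = 0")
      case False
      let ?d = "1 / real (2 * N + p) - 1 / real (2 * N + p + 1)"
      have "1 / real (2 * N + p + 1) < 1 / real (2 * N + p)" using False by (intro divide_strict_left_mono) auto
      then have "?d > 0" by simp
      moreover have "?d \<le> dist x y" if xy: "x \<in> (\<Union>i<N. R (2 * i + p))" "y \<in> R (2 * N + p)" for x y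
      proof -
        obtain i where i: "i < N" "x \<in> R (2 * i + p)" using xy by blast
        have "1 / real (2 * N + p) \<le> 1 / real (2 * i + p + 2)"
          using i False by (intro divide_left_mono) auto
        then have "1 / real (2 * N + p) \<le> g x" using i by (simp add: R_def add_ac)
        moreover have "g y < 1 / real (2 * N + p + 1)" using xy by (simp add: R_def)
        ultimately show ?thesis using lip[of x y] by linarith
      qed
      ultimately have "?H (\<Union>i<N. R (2 * i + p)) + ?H (R (2 * N + p)) \<le> ?H ((\<Union>i<N. R (2 * i + p)) \<union> R (2 * N + p))"
        by (rule hausdorff_outer_separated)
      then have "(\<Sum>i<N. ?H (R (2 * i + p))) + ?H (R (2 * N + p)) \<le> ?H ((\<Union>i<N. R (2 * i + p)) \<union> R (2 * N + p))"
        using add_right_mono[OF Suc] order_trans by blast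
      then show ?thesis by (simp add: lessThan_Suc Un_commute add.commute)
    qed (simp add: lessThan_Suc)
  qed simp
  have "(\<Sum>i. ?H (R (2 * i + p))) \<le> ?H A" for p
  proof (rule suminf_le_const)
    fix N
    have "?H (\<Union>i<N. R (2 * i + p)) \<le> ?H A" by (rule hausdorff_outer_mono) (auto simp: R_def)
    then show "(\<Sum>i<N. ?H (R (2 * i + p))) \<le> ?H A" using sepR order_trans by blast
  qed simp
  note par = this
  have sumle: "(\<Sum>i<k. ?H (R i)) \<le> ?H A + ?H A" for k
  proof -
    have "(\<Sum>i<k. ?H (R i)) \<le> (\<Sum>i<2 * k. ?H (R i))" by (rule sum_mono2) auto
    also have "\<dots> = (\<Sum>i<k. ?H (R (2 * i + 0))) + (\<Sum>i<k. ?H (R (2 * i + 1)))"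
      by (induction k) (simp_all add: add_ac)
    also have "\<dots> \<le> (\<Sum>i. ?H (R (2 * i + 0))) + (\<Sum>i. ?H (R (2 * i + 1)))"
      by (intro add_mono sum_le_suminf) auto
    also have "\<dots> \<le> ?H A + ?H A" by (intro add_mono par)
    finally show ?thesis .
  qed
  define T where "T = (\<Sum>i. ?H (R i))"
  have "T \<le> ?H A + ?H A" unfolding T_def by (rule suminf_le_const) (use sumle in auto)
  then have T: "T < top" using False by (auto simp: less_top top_unique order_le_less_trans)
  have AC: "A - C \<subseteq> B k \<union> (\<Union>i. R (i + k))" for k
  proof
    fix x assume x: "x \<in> A - C"
    then have gx: "g x > 0" using C infdist_pos_not_in_closed by (auto simp: g_def)
    show "x \<in> B k \<union> (\<Union>i. R (i + k))"
    proof (cases "1 / real (k + 1) \<le> g x")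
      case False
      obtain n where "1 / g x < real n" using reals_Archimedean2 by blast
      then have n: "1 / real (n + 1) \<le> g x" using gx by (simp add: field_simps)
      define m where "m = (LEAST m. 1 / real (m + 1) \<le> g x)"
      have m: "1 / real (m + 1) \<le> g x" unfolding m_def by (rule LeastI[of _ n]) (rule n)
      have "k < m"
      proof (rule ccontr)
        assume "\<not> k < m"
        then have "1 / real (k + 1) \<le> 1 / real (m + 1)" by (intro divide_left_mono) auto
        then show False using False m by linarith
      qed
      then obtain j where j: "m = Suc (j + k)" by (metis add.commute less_imp_Suc_add)
      have "\<not> 1 / real (j + k + 1) \<le> g x" using not_less_Least[of "j + k" "\<lambda>m. 1 / real (m + 1) \<le> g x"] j by (simp add: m_def)
      then have "x \<in> R (j + k)" using m j x by (simp add: R_def)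
      then show ?thesis by blast
    qed (use x in \<open>auto simp: B_def\<close>)
  qed
  \<comment> \<open>Adding the first \<open>k\<close> slices completes the tail of the series to the
    constant \<open>T\<close>. In the limit \<open>T\<close> stands on both sides and cancels, being
    finite.\<close>
  have "?H (A \<inter> C) + ?H (A - C) + (\<Sum>i<k. ?H (R i)) \<le> ?H A + T" for k
  proof -
    have "?H (A - C) \<le> ?H (B k \<union> (\<Union>i. R (i + k)))" by (rule hausdorff_outer_mono[OF AC])
    also have "\<dots> \<le> ?H (B k) + (\<Sum>i. ?H (R (i + k)))"
      by (rule order_trans[OF hausdorff_outer_Un_le add_left_mono[OF hausdorff_outer_countable_subadditive]])
    finally have 1: "?H (A - C) \<le> ?H (B k) + (\<Sum>i. ?H (R (i + k)))" .
    have "?H (A \<inter> C) + ?H (B k) \<le> ?H ((A \<inter> C) \<union> B k)"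
    proof (rule hausdorff_outer_separated)
      fix a b assume "a \<in> A \<inter> C" "b \<in> B k"
      then show "1 / real (k + 1) \<le> dist a b" using lip[of b a] by (simp add: B_def g_def dist_commute)
    qed simp
    also have "\<dots> \<le> ?H A" by (rule hausdorff_outer_mono) (auto simp: B_def)
    finally have 2: "?H (A \<inter> C) + ?H (B k) \<le> ?H A" .
    have "?H (A \<inter> C) + ?H (A - C) + (\<Sum>i<k. ?H (R i)) \<le> ?H (A \<inter> C) + (?H (B k) + (\<Sum>i. ?H (R (i + k)))) + (\<Sum>i<k. ?H (R i))"
      using 1 by (intro add_right_mono add_left_mono)
    also have "\<dots> = (?H (A \<inter> C) + ?H (B k)) + ((\<Sum>i. ?H (R (i + k))) + (\<Sum>i<k. ?H (R i)))" by (simp add: add_ac)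
    also have "(\<Sum>i. ?H (R (i + k))) + (\<Sum>i<k. ?H (R i)) = T"
      unfolding T_def by (rule suminf_offset[symmetric]) simp
    also have "(?H (A \<inter> C) + ?H (B k)) + T \<le> ?H A + T" using 2 by (rule add_right_mono)
    finally show ?thesis .
  qed
  moreover have "(\<lambda>k. ?H (A \<inter> C) + ?H (A - C) + (\<Sum>i<k. ?H (R i))) \<longlonglongrightarrow> ?H (A \<inter> C) + ?H (A - C) + T"
    unfolding T_def by (intro tendsto_intros summable_LIMSEQ) auto
  ultimately have "?H (A \<inter> C) + ?H (A - C) + T \<le> ?H A + T" by (intro LIMSEQ_le_const2) auto
  then show ?thesis using less_imp_neq[OF T] by (simp add: add.commute[of _ T] ennreal_add_left_cancel_le)
qed simp

text \<open>\<open>measure_of\<close> takes the intended values only when its arguments form a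
  measure space. The measurable sets here are the \<open>lambda_system\<close> of the outer measure,
  for which Caratheodory's lemma provides this; Borel sets belong to it because closed sets
  do.\<close>

lemma sets_borel_subset_hausdorff_measure: "sets borel \<subseteq> sets (hausdorff_measure s :: 'a::euclidean_space measure)"
  and emeasure_hausdorff_measure: "A \<in> sets borel \<Longrightarrow> emeasure (hausdorff_measure s) A = hausdorff_outer s (A :: 'a set)"
proof -
  let ?H = "hausdorff_outer s :: 'a set \<Rightarrow> ennreal"
  define L where "L = lambda_system UNIV (Pow UNIV) ?H"
  have L: "{A. \<forall>B. ?H B = ?H (B \<inter> A) + ?H (B - A)} = L"
  proof (rule set_eqI)
    fix A :: "'a set"
    have "?H B = ?H (B \<inter> A) + ?H (B - A) \<longleftrightarrow> ?H (A \<inter> B) + ?H ((UNIV - A) \<inter> B) = ?H B" for B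
    proof -
      have "B \<inter> A = A \<inter> B" "B - A = (UNIV - A) \<inter> B" by auto
      then show ?thesis by metis
    qed
    then show "A \<in> {A. \<forall>B. ?H B = ?H (B \<inter> A) + ?H (B - A)} \<longleftrightarrow> A \<in> L"
      unfolding L_def lambda_system_def by blast
  qed
  interpret P: sigma_algebra UNIV "Pow (UNIV :: 'a set)" by (rule sigma_algebra_Pow)
  have ms: "measure_space UNIV L ?H" unfolding L_def by (rule P.caratheodory_lemma[OF outer_measure_space_hausdorff])
  then interpret L: sigma_algebra UNIV L by (simp add: measure_space_def)
  have H: "hausdorff_measure s = measure_of UNIV L ?H" unfolding hausdorff_measure_def L ..
  have sets: "sets (hausdorff_measure s) = L" unfolding H by (simp add: L.sigma_sets_eq)
  have "C \<in> L" if "closed C" for C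
  proof (cases "C = {}")
    case False
    have "?H B = ?H (B \<inter> C) + ?H (B - C)" for B
    proof (rule antisym)
      show "?H B \<le> ?H (B \<inter> C) + ?H (B - C)" by (metis Int_Diff_Un hausdorff_outer_Un_le)
      show "?H (B \<inter> C) + ?H (B - C) \<le> ?H B" by (rule closed_hausdorff_measurable[OF that False])
    qed
    then show ?thesis unfolding L[symmetric] by blast
  qed auto
  then have "UNIV - (- U) \<in> L" if "open U" for U using that by (intro L.compl_sets) auto
  then have "sigma_sets UNIV (Collect open) \<subseteq> L" by (intro L.sigma_sets_subset) (auto simp: Diff_eq)
  then show "sets borel \<subseteq> sets (hausdorff_measure s :: 'a measure)" unfolding sets sets_borel .
  then show "A \<in> sets borel \<Longrightarrow> emeasure (hausdorff_measure s) A = ?H A"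
    unfolding H using ms sets by (intro emeasure_measure_of_sigma) (auto simp: measure_space_def)
qed

section \<open>Integrability over spheres\<close>

text \<open>Here the cone over \<open>A\<close> is cut with a shell of thickness \<open>d\<close>, which lies in a ball of radius \<open>2 d\<close>.\<close>

lemma emeasure_cone_measure_le:
  fixes A :: "'a::euclidean_space set"
  assumes [measurable]: "A \<in> sets borel" and A: "A \<subseteq> cball \<theta>0 d" and d: "d > 0"
  shows "emeasure cone_measure A \<le> ennreal (unit_ball_vol (real DIM('a)) * 2 ^ DIM('a) * d ^ (DIM('a) - 1))"
proof -
  let ?n = "DIM('a)" and ?E = "emeasure cone_measure A"
  let ?b = "unit_ball_vol (real ?n) * 2 ^ ?n * d ^ (?n - 1)"
  let ?S = "\<lambda>r. \<integral>\<^sup>+\<theta>. indicator {1..1 + d} (norm (r *\<^sub>R \<theta>)) * indicator A (sgn (r *\<^sub>R \<theta>)) \<partial>cone_measure"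
  let ?p = "\<lambda>r::real. ennreal (indicator {0<..} r * r ^ (?n - 1))"
  obtain k where k: "?n = Suc k" using DIM_positive[where 'a='a] by (cases ?n) auto
  have "ennreal d * ?E = (\<integral>\<^sup>+r. ?E * indicator {1..1 + d} r \<partial>lborel)"
    using d by (subst nn_integral_cmult_indicator) (auto simp: mult.commute)
  also have "\<dots> \<le> (\<integral>\<^sup>+r. ?p r *
      ?S r \<partial>lborel)"
  proof (rule nn_integral_mono)
    fix r :: real
    show "?E * indicator {1..1 + d} r \<le> ?p r *
      ?S r"
    proof (cases "r \<in> {1..1 + d}")
      case True
      have "?S r
         = (\<integral>\<^sup>+\<theta>. indicator A \<theta> \<partial>cone_measure)"
      proof (rule nn_integral_cong_AE)
        show "AE \<theta> in cone_measure. indicator {1..1 + d} (norm (r *\<^sub>R \<theta>)) * indicator A (sgn (r *\<^sub>R \<theta>)) = (indicator A \<theta> :: ennreal)"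
          using AE_cone_measure_norm[where 'a='a]
          by eventually_elim (use True in \<open>auto simp: sgn_div_norm\<close>)
      qed
      also have "\<dots> = ?E" by simp
      finally have "?S r = ?E" .
      moreover have "1 \<le> r ^ (?n - 1)" using True by (intro one_le_power) auto
      then have "1 * ?E \<le> ennreal (r ^ (?n - 1)) * ?E" by (intro mult_right_mono) auto
      ultimately show ?thesis using True by simp
    qed simp
  qed
  finally have "ennreal d * ?E \<le> (\<integral>\<^sup>+r. ?p r *
      ?S r \<partial>lborel)" .
  then have "1 * (ennreal d * ?E) \<le> of_nat ?n * (\<integral>\<^sup>+r. ?p r *
      ?S r \<partial>lborel)"
    using k by (intro mult_mono) (auto simp del: of_nat_Suc intro: order_trans[OF _ of_nat_mono[of 1 "Suc k"]])
  also have "\<dots> = (\<integral>\<^sup>+v. indicator {1..1 + d} (norm v) * indicator A (sgn v) \<partial>lborel)"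
    by (rule nn_integral_polar[symmetric]) measurable
  also have "\<dots> \<le> (\<integral>\<^sup>+v. indicator (cball \<theta>0 (2 * d)) v \<partial>lborel)"
  proof (rule nn_integral_mono)
    fix v :: 'a
    have "dist \<theta>0 v \<le> 2 * d" if v: "norm v \<in> {1..1 + d}" "sgn v \<in> A"
    proof -
      have "norm v \<noteq> 0" using v by auto
      then have "v - sgn v = (norm v - 1) *\<^sub>R sgn v" by (simp add: sgn_div_norm algebra_simps)
      then have "norm (v - sgn v) \<le> d" using v by (auto simp: norm_sgn)
      moreover have "dist \<theta>0 (sgn v) \<le> d" using A v by auto
      ultimately show ?thesis using dist_triangle[of \<theta>0 v "sgn v"] by (simp add: dist_norm norm_minus_commute)
    qed
    then show "indicator {1..1 + d} (norm v) * indicator A (sgn v) \<le> (indicator (cball \<theta>0 (2 * d)) v :: ennreal)"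
      by (auto simp: indicator_def)
  qed
  also have "\<dots> = emeasure lborel (cball \<theta>0 (2 * d))" by simp
  also have "\<dots> = ennreal (unit_ball_vol (real ?n) * (2 * d) ^ ?n)" using d by (simp add: emeasure_cball)
  also have "unit_ball_vol (real ?n) * (2 * d) ^ ?n = d * (?b)"
    using k by (simp add: power_mult_distrib)
  also have "ennreal \<dots> = ennreal d * ennreal (?b)"
    using d by (simp add: ennreal_mult')
  finally have *: "ennreal d * ?E \<le> ennreal d * ennreal (?b)" by simp
  then have "ennreal (1 / d) * (ennreal d * ?E) \<le> ennreal (1 / d) * (ennreal d * ennreal (?b))"
    by (rule mult_left_mono) simp
  then show ?thesis using d by (simp add: mult.assoc[symmetric] ennreal_mult'[symmetric])
qed

text \<open>Letting the radius tend to \<open>d\<close> from above admits \<open>d = 0\<close>,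
  which occurs when a covering set is a single point.\<close>

lemma emeasure_cone_measure_le_diameter:
  fixes A :: "'a::euclidean_space set"
  assumes dim: "DIM('a) \<ge> 2" and [measurable]: "A \<in> sets borel" and A: "A \<subseteq> cball \<theta>0 d" and d: "d \<ge> 0"
  shows "emeasure cone_measure A \<le> ennreal (unit_ball_vol (real DIM('a)) * 2 ^ DIM('a) * d ^ (DIM('a) - 1))"
proof (rule tendsto_lowerbound)
  let ?F = "\<lambda>e. ennreal (unit_ball_vol (real DIM('a)) * 2 ^ DIM('a) * (d + e) ^ (DIM('a) - 1))"
  have "((\<lambda>e. unit_ball_vol (real DIM('a)) * 2 ^ DIM('a) * (d + e) ^ (DIM('a) - 1))
      \<longlongrightarrow> unit_ball_vol (real DIM('a)) * 2 ^ DIM('a) * (d + 0) ^ (DIM('a) - 1)) (at_right 0)"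
    by (intro tendsto_intros)
  then show "(?F \<longlongrightarrow> ennreal (unit_ball_vol (real DIM('a)) * 2 ^ DIM('a) * d ^ (DIM('a) - 1))) (at_right 0)"
    by (intro tendsto_ennrealI) simp
  show "\<forall>\<^sub>F e in at_right 0. emeasure cone_measure A \<le> ?F e"
  proof (rule eventually_at_rightI[of 0 1])
    fix e :: real assume "e \<in> {0<..<1}"
    then show "emeasure cone_measure A \<le> ?F e"
      using A d by (intro emeasure_cone_measure_le[of A \<theta>0]) auto
  qed simp
qed simp

text \<open>A covering set of diameter \<open>d\<close>, seen from \<open>w\<close> at scale
  \<open>r\<close>, lies in a ball of radius \<open>d / r\<close>, so its cone measure is at most of
  order \<open>(d / r) ^ (n-1)\<close>. Up to the factor \<open>r ^ (n-1)\<close> this is its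
  Hausdorff weight, and the comparison follows by summing over the cover.\<close>

lemma cone_measure_le_hausdorff:
  assumes dim: "DIM('a::euclidean_space) \<ge> 2"
  shows "\<exists>k>0. \<forall>w r. \<forall>B\<in>sets (borel :: 'a measure). r > 0 \<longrightarrow>
    ennreal (k * r ^ (DIM('a) - 1)) * emeasure cone_measure {\<theta>. w + r *\<^sub>R \<theta> \<in> B} \<le> hausdorff_outer (real DIM('a) - 1) B"
proof -
  let ?n = "DIM('a)" and ?s = "real DIM('a) - 1"
  define \<alpha> where "\<alpha> = pi powr (?s/2) / Gamma (?s/2 + 1)"
  define c where "c = unit_ball_vol (real ?n) * 2 ^ ?n"
  \<comment> \<open>Makes \<open>k * r ^ (n-1) * (c * (d / r) ^ (n-1))\<close> equal to the weight
    \<open>\<alpha> * (d / 2) ^ (n-1)\<close>.\<close>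
  define k where "k = \<alpha> / (c * 2 ^ (?n - 1))"
  have "0 \<le> (real ?n - 1) / 2" using dim by simp
  then have "0 < (real ?n - 1) / 2 + 1" by linarith
  then have \<alpha>: "\<alpha> > 0" unfolding \<alpha>_def by (intro divide_pos_pos Gamma_real_pos) auto
  have c: "c > 0" by (simp add: c_def)
  have k: "k > 0" using \<alpha> c by (simp add: k_def)
  have weight: "hausdorff_weight ?s C = ennreal (\<alpha> * (diameter C / 2) ^ (?n - 1))" if "bounded C" for C :: "'a set"
  proof -
    have "(diameter C / 2) powr ?s = (diameter C / 2) ^ (?n - 1)"
    proof (cases "diameter C = 0")
      case False
      then have "diameter C > 0" using diameter_ge_0[OF that] by simp
      then have "(diameter C / 2) powr real (?n - 1) = (diameter C / 2) ^ (?n - 1)" by (intro powr_realpow) simp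
      then show ?thesis using dim by (simp add: of_nat_diff)
    next
      case True
      then show ?thesis using dim by (simp add: power_0_left)
    qed
    then show ?thesis by (simp add: hausdorff_weight_def \<alpha>_def)
  qed
  show ?thesis
  proof (intro exI[of _ k] conjI allI ballI impI, rule k)
    fix w :: 'a and r :: real and B :: "'a set" assume B [measurable]: "B \<in> sets borel" and r: "r > 0"
    let ?P = "\<lambda>S. {\<theta>. w + r *\<^sub>R \<theta> \<in> S}" and ?kr = "ennreal (k * r ^ (?n - 1))"
    have meas: "?P S \<in> sets borel" if "S \<in> sets borel" for S
    proof -
      have "(\<lambda>\<theta>. w + r *\<^sub>R \<theta>) -` S \<inter> space borel \<in> sets borel" using that by (intro measurable_sets[OF _ that]) measurable
      then show ?thesis by (simp add: vimage_def)
    qed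
    have "?kr * emeasure cone_measure (?P B) \<le> hausdorff_delta ?s 1 B"
      unfolding hausdorff_delta_alt
    proof (rule INF_greatest)
      fix C assume C: "C \<in> hausdorff_covers 1 B"
      then have bd: "bounded (C i)" for i by (simp add: hausdorff_covers_def)
      \<comment> \<open>Covering sets are arbitrary; their closures are Borel and have the same
        diameter.\<close>
      let ?e = "\<lambda>i. emeasure cone_measure (?P (closure (C i)))"
      have est: "?kr * ?e i \<le> hausdorff_weight ?s (C i)" for i
      proof (cases "C i = {}")
        case False
        then obtain p where p: "p \<in> C i" by blast
        let ?d = "diameter (C i)"
        have d: "?d \<ge> 0" using bd by (rule diameter_ge_0)
        have "?P (closure (C i)) \<subseteq> cball ((1 / r) *\<^sub>R (p - w)) (?d / r)"
        proof
          fix \<theta> assume "\<theta> \<in> ?P (closure (C i))"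
          then have "dist p (w + r *\<^sub>R \<theta>) \<le> ?d"
            using diameter_bounded_bound[of "closure (C i)" p "w + r *\<^sub>R \<theta>"] p closure_subset[of "C i"] bd[of i]
            by (auto simp: diameter_closure bounded_closure)
          moreover have "(1 / r) *\<^sub>R (p - w) - \<theta> = (1 / r) *\<^sub>R (p - (w + r *\<^sub>R \<theta>))" using r by (simp add: algebra_simps)
          then have "dist ((1 / r) *\<^sub>R (p - w)) \<theta> = dist p (w + r *\<^sub>R \<theta>) / r" using r by (simp add: dist_norm)
          ultimately show "\<theta> \<in> cball ((1 / r) *\<^sub>R (p - w)) (?d / r)" using r by (simp add: divide_right_mono)
        qed
        then have "?e i \<le> ennreal (c * (?d / r) ^ (?n - 1))"
          unfolding c_def using d r by (intro emeasure_cone_measure_le_diameter[OF dim]) (auto intro: meas)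
        then have "?kr * ?e i
           \<le> ?kr * ennreal (c * (?d / r) ^ (?n - 1))" by (rule mult_left_mono) simp
        also have "\<dots> = ennreal (k * r ^ (?n - 1) * (c * (?d / r) ^ (?n - 1)))"
          using k r by (subst ennreal_mult') auto
        also have "k * r ^ (?n - 1) * (c * (?d / r) ^ (?n - 1)) = \<alpha> * (?d / 2) ^ (?n - 1)"
          using r c by (simp add: k_def power_divide)
        finally show ?thesis using weight[OF bd] by simp
      qed simp
      have "emeasure cone_measure (?P B) \<le> emeasure cone_measure (\<Union>i. ?P (closure (C i)))"
      proof (rule emeasure_mono)
        show "?P B \<subseteq> (\<Union>i. ?P (closure (C i)))"
        proof
          fix \<theta> assume "\<theta> \<in> ?P B"
          moreover have "B \<subseteq> (\<Union>i. C i)" using C by (simp add: hausdorff_covers_def)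
          ultimately obtain i where "w + r *\<^sub>R \<theta> \<in> C i" by blast
          then show "\<theta> \<in> (\<Union>i. ?P (closure (C i)))" using closure_subset by (intro UN_I[of i]) auto
        qed
      qed (auto intro!: sets.countable_UN meas)
      also have "\<dots> \<le> (\<Sum>i. ?e i)"
        by (rule emeasure_subadditive_countably) (auto intro!: meas)
      finally have "?kr * emeasure cone_measure (?P B)
         \<le> ?kr * (\<Sum>i. ?e i)" by (rule mult_left_mono) simp
      also have "\<dots> = (\<Sum>i. ?kr * ?e i)" by simp
      also have "\<dots> \<le> (\<Sum>i. hausdorff_weight ?s (C i))" by (intro suminf_le est) auto
      finally show "?kr * emeasure cone_measure (?P B) \<le> (\<Sum>i. hausdorff_weight ?s (C i))" .
    qed
    also have "\<dots> \<le> hausdorff_outer ?s B" by (rule hausdorff_delta_le_outer) simp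
    finally show "?kr * emeasure cone_measure (?P B) \<le> hausdorff_outer ?s B" .
  qed
qed

text \<open>An inequality on all Borel sets is an inequality of measures on \<open>borel\<close>,
  hence of integrals. Pushing \<open>hausdorff_measure\<close> forward by the identity restricts it
  to the Borel sets.\<close>

lemma nn_integral_cone_measure_le_hausdorff:
  assumes dim: "DIM('a::euclidean_space) \<ge> 2"
  shows "\<exists>k>0. \<forall>w r. \<forall>G\<in>borel_measurable (borel :: 'a measure). r > 0 \<longrightarrow>
    ennreal (k * r ^ (DIM('a) - 1)) * (\<integral>\<^sup>+\<theta>. G (w + r *\<^sub>R \<theta>) \<partial>cone_measure) \<le> (\<integral>\<^sup>+x. G x \<partial>hausdorff_measure (real DIM('a) - 1))"
proof -
  let ?H = "hausdorff_measure (real DIM('a) - 1) :: 'a measure"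
  obtain k where k: "k > 0" and le: "\<forall>w r. \<forall>B\<in>sets (borel :: 'a measure). r > 0 \<longrightarrow>
    ennreal (k * r ^ (DIM('a) - 1)) * emeasure cone_measure {\<theta>. w + r *\<^sub>R \<theta> \<in> B} \<le> hausdorff_outer (real DIM('a) - 1) B"
    using cone_measure_le_hausdorff[OF dim] by blast
  show ?thesis
  proof (intro exI[of _ k] conjI allI ballI impI, rule k)
    fix w :: 'a and r :: real and G :: "'a \<Rightarrow> ennreal" assume G [measurable]: "G \<in> borel_measurable borel" and r: "r > 0"
    let ?c = "ennreal (k * r ^ (DIM('a) - 1))"
    have spH: "space ?H = UNIV" by (simp add: hausdorff_measure_def)
    have id: "(\<lambda>x. x) \<in> measurable ?H borel"
      using sets_borel_subset_hausdorff_measure[where 'a='a, of "real DIM('a) - 1"] by (auto simp: measurable_def spH)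
    let ?N = "distr ?H borel (\<lambda>x. x)"
    let ?M = "scale_measure ?c (distr cone_measure borel (\<lambda>\<theta>. w + r *\<^sub>R \<theta>))"
    have "emeasure ?M B \<le> emeasure ?N B" if B: "B \<in> sets borel" for B
    proof -
      have "emeasure ?N B = hausdorff_outer (real DIM('a) - 1) B"
        using B id by (simp add: emeasure_distr spH emeasure_hausdorff_measure)
      moreover have "emeasure ?M B = ?c * emeasure cone_measure {\<theta>. w + r *\<^sub>R \<theta> \<in> B}"
        using B by (simp add: emeasure_distr vimage_def)
      ultimately show ?thesis using le B r by simp
    qed
    then have "?M \<le> ?N" by (subst le_measure) (auto simp: le_fun_def)
    then have "(\<integral>\<^sup>+x. G x \<partial>?M) \<le> (\<integral>\<^sup>+x. G x \<partial>?N)" by (intro nn_integral_mono_measure) auto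
    moreover have "(\<integral>\<^sup>+x. G x \<partial>?N) = (\<integral>\<^sup>+x. G x \<partial>?H)" using id by (simp add: nn_integral_distr)
    moreover have "(\<integral>\<^sup>+x. G x \<partial>?M) = ?c * (\<integral>\<^sup>+\<theta>. G (w + r *\<^sub>R \<theta>) \<partial>cone_measure)"
      by (simp add: nn_integral_scale_measure nn_integral_distr)
    ultimately show "?c * (\<integral>\<^sup>+\<theta>. G (w + r *\<^sub>R \<theta>) \<partial>cone_measure) \<le> (\<integral>\<^sup>+x. G x \<partial>?H)" by simp
  qed
qed


text \<open>\<open>\<eta>\<close> is the normalised indicator of a set of radii on which the
  spherical integral \<open>q\<close> of \<open>Q\<close> is bounded. The difficulty is Lebesgue
  measurability: \<open>Q\<close> and \<open>E1\<close> are replaced by Borel versions, and the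
  exceptional set of \<open>Q\<close> must be shown negligible on almost every sphere.\<close>

lemma ring_density_exists:
  fixes D :: "'a::euclidean_space set" and Q :: "'a \<Rightarrow> ennreal"
  assumes dim: "DIM('a) \<ge> 2" and D: "open D" and Q: "Q \<in> borel_measurable (restrict_space lebesgue D)"
    and cond: "sphere_integrable_cond D Q" and w: "w \<in> D" and r12: "0 < r1" "r1 < r2" and far: "\<exists>x\<in>D. r2 < dist x w"
  shows "\<exists>\<eta>\<in>borel_measurable borel. 1 \<le> (\<integral>\<^sup>+r\<in>{r1<..<r2}. \<eta> r \<partial>lborel)
    \<and> (\<integral>\<^sup>+x\<in>annulus w r1 r2 \<inter> D. Q x * \<eta> (dist x w) ^ DIM('a) \<partial>lebesgue) < \<infinity>"
proof -
  let ?n = "DIM('a)" and ?H = "hausdorff_measure (real DIM('a) - 1) :: 'a measure"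
  let ?Q = "\<lambda>x. indicator D x * Q x"
  have "?Q \<in> borel_measurable lebesgue"
    using Q D by (subst (asm) borel_measurable_restrict_space_iff_ennreal) (auto simp: mult.commute)
  then obtain Q' where Q' [measurable]: "Q' \<in> borel_measurable lborel" and "AE x in lborel. ?Q x = Q' x"
    using completion_ex_borel_measurable by blast
  then obtain N where N: "N \<in> null_sets lborel" and QN: "\<And>x. x \<notin> N \<Longrightarrow> ?Q x = Q' x"
    unfolding eventually_ae_filter by auto
  have Nm [measurable]: "N \<in> sets borel" using N by auto
  interpret C: sigma_finite_measure "cone_measure :: 'a measure" by (rule sigma_finite_cone_measure)
  define q where "q = (\<lambda>r. \<integral>\<^sup>+\<theta>. Q' (w + r *\<^sub>R \<theta>) \<partial>cone_measure)"
  have q [measurable]: "q \<in> borel_measurable borel" unfolding q_def by measurable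
  have shift: "(\<integral>\<^sup>+x. f x \<partial>lborel) = (\<integral>\<^sup>+x. f (w + x) \<partial>lborel)" if "f \<in> borel_measurable borel" for f :: "'a \<Rightarrow> ennreal"
    using nn_integral_lborel_scaleR[OF that, of 1 w] by simp
  \<comment> \<open>By polar coordinates the null set \<open>N\<close> has cone measure 0 on almost
    every sphere about \<open>w\<close>.\<close>
  have "(\<integral>\<^sup>+x. indicator N (w + x) \<partial>lborel) = emeasure lborel N"
    using shift[of "indicator N"] by simp
  then have "(\<integral>\<^sup>+r. ennreal (indicator {0<..} r * r ^ (?n - 1)) * (\<integral>\<^sup>+\<theta>. indicator N (w + r *\<^sub>R \<theta>) \<partial>cone_measure) \<partial>lborel) = 0"
    using N by (subst (asm) nn_integral_polar) auto
  then have ae0: "AE r in lborel. ennreal (indicator {0<..} r * r ^ (?n - 1)) * (\<integral>\<^sup>+\<theta>. indicator N (w + r *\<^sub>R \<theta>) \<partial>cone_measure) = 0"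
    by (subst (asm) nn_integral_0_iff_AE) auto
  obtain E1 where E1: "E1 \<subseteq> {r1..r2}" "E1 \<in> sets lebesgue" "emeasure lebesgue E1 > 0"
    and fin: "\<And>r. r \<in> E1 \<Longrightarrow> (\<integral>\<^sup>+x\<in>sphere w r. ?Q x \<partial>?H) < \<infinity>"
    using cond[unfolded sphere_integrable_cond_def, rule_format, OF w conjI[OF r12(1) conjI[OF r12(2) far]]]
    by (elim exE conjE) simp
  obtain k where k: "k > 0" and le: "\<forall>w r. \<forall>G\<in>borel_measurable (borel :: 'a measure). r > 0 \<longrightarrow>
    ennreal (k * r ^ (?n - 1)) * (\<integral>\<^sup>+\<theta>. G (w + r *\<^sub>R \<theta>) \<partial>cone_measure) \<le> (\<integral>\<^sup>+x. G x \<partial>?H)"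
    using nn_integral_cone_measure_le_hausdorff[OF dim] by blast
  have qfin: "q r < \<infinity>" if r: "r \<in> E1"
    and z: "ennreal (indicator {0<..} r * r ^ (?n - 1)) * (\<integral>\<^sup>+\<theta>. indicator N (w + r *\<^sub>R \<theta>) \<partial>cone_measure) = 0" for r
  proof -
    have rpos: "r > 0" using r E1 r12 by force
    then have "(\<integral>\<^sup>+\<theta>. indicator N (w + r *\<^sub>R \<theta>) \<partial>(cone_measure :: 'a measure)) = 0" using z by simp
    then have aeN: "AE \<theta> in (cone_measure :: 'a measure). indicator N (w + r *\<^sub>R \<theta>) = (0 :: ennreal)"
      by (subst (asm) nn_integral_0_iff_AE) auto
    \<comment> \<open>On \<open>N\<close> the Borel version may exceed \<open>Q\<close>, so
      \<open>N\<close> is removed before comparing with the Hausdorff integral.\<close>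
    define G where "G = (\<lambda>x. indicator (sphere w r - N) x * Q' x)"
    have [measurable]: "sphere w r \<in> sets borel" by simp
    have G: "G \<in> borel_measurable borel" unfolding G_def by measurable
    have "q r = (\<integral>\<^sup>+\<theta>. G (w + r *\<^sub>R \<theta>) \<partial>cone_measure)"
      unfolding q_def
    proof (rule nn_integral_cong_AE)
      show "AE \<theta> in cone_measure. Q' (w + r *\<^sub>R \<theta>) = G (w + r *\<^sub>R \<theta>)"
        using aeN AE_cone_measure_norm[where 'a='a]
        by eventually_elim (use rpos in \<open>auto simp: G_def dist_norm indicator_def split: if_splits\<close>)
    qed
    then have "ennreal (k * r ^ (?n - 1)) * q r \<le> (\<integral>\<^sup>+x. G x \<partial>?H)"
      using le G rpos by simp
    also have "\<dots> \<le> (\<integral>\<^sup>+x\<in>sphere w r. ?Q x \<partial>?H)"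
    proof (rule nn_integral_mono)
      fix x
      show "G x \<le> ?Q x * indicator (sphere w r) x"
        by (cases "x \<in> N") (simp_all add: G_def QN[symmetric] split: split_indicator)
    qed
    also have "\<dots> < \<infinity>" by (rule fin[OF r])
    finally show ?thesis using k rpos by (auto simp: ennreal_mult_less_top less_top[symmetric] ennreal_mult_eq_top_iff)
  qed
  obtain S M M' where S: "E1 = S \<union> M" "M \<subseteq> M'" "M' \<in> null_sets lborel" "S \<in> sets lborel"
    using E1(2) by (rule sets_completionE)
  have Sm [measurable]: "S \<in> sets borel" using S by simp
  \<comment> \<open>Almost every radius of \<open>E1\<close> lies in some \<open>T j\<close>, so if
    all of these were null, \<open>E1\<close> would be null as well.\<close>
  define T where "T = (\<lambda>j::nat. {r \<in> S. q r \<le> of_nat j} \<inter> {r1<..<r2})"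
  have Tm [measurable]: "T j \<in> sets borel" for j unfolding T_def by measurable
  have "\<exists>j. emeasure lborel (T j) > 0"
  proof (rule ccontr)
    assume "\<not> ?thesis"
    then have "T j \<in> null_sets lborel" for j by (auto simp: null_sets_def)
    then have "(\<Union>j. T j) \<in> null_sets lborel" by (rule null_sets_UN)
    then have "AE r in lborel. r \<notin> (\<Union>j. T j)" by (rule AE_not_in)
    moreover have "AE r in lborel. r \<notin> M'" using S(3) by (rule AE_not_in)
    moreover have "AE r in lborel. r \<noteq> r1" "AE r in lborel. r \<noteq> r2" by (rule AE_lborel_singleton)+
    ultimately have "AE r in lborel. r \<notin> E1"
      using ae0
    proof eventually_elim
      case (elim r)
      show ?case
      proof
        assume r: "r \<in> E1"
        then have "r \<in> S" using S elim by auto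
        moreover have "q r < \<infinity>" using qfin[OF r] elim by blast
        then obtain x where x: "q r = ennreal x" "x \<ge> 0" by (cases "q r") auto
        obtain j where "x \<le> real j" using real_arch_simple by blast
        then have "q r \<le> of_nat j" by (simp add: x ennreal_of_nat_eq_real_of_nat ennreal_leI)
        moreover have "r \<in> {r1<..<r2}" using E1(1) r elim by force
        ultimately show False using elim by (auto simp: T_def)
      qed
    qed
    then have "AE r in lebesgue. r \<notin> E1" by (rule AE_completion)
    then have "emeasure lebesgue E1 = 0" using E1(2) by (simp add: AE_iff_measurable[OF E1(2)])
    then show False using E1(3) by simp
  qed
  then obtain j where j: "emeasure lborel (T j) > 0" by blast
  have "emeasure lborel (T j) \<le> emeasure lborel {r1<..<r2}" by (rule emeasure_mono) (auto simp: T_def)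
  also have "\<dots> < \<infinity>" using r12 by simp
  finally obtain m where m: "emeasure lborel (T j) = ennreal m" "m \<ge> 0" by (cases "emeasure lborel (T j)") auto
  then have mpos: "m > 0" using j by simp
  define \<eta> where "\<eta> = (\<lambda>r. indicator (T j) r * ennreal (1 / m))"
  have \<eta> [measurable]: "\<eta> \<in> borel_measurable borel" unfolding \<eta>_def by measurable
  show ?thesis
  proof (intro bexI[OF _ \<eta>] conjI)
    have "(\<integral>\<^sup>+r\<in>{r1<..<r2}. \<eta> r \<partial>lborel) = (\<integral>\<^sup>+r. ennreal (1 / m) * indicator (T j) r \<partial>lborel)"
      by (intro nn_integral_cong) (auto simp: \<eta>_def T_def indicator_def)
    also have "\<dots> = ennreal (1 / m) * ennreal m" using m by (subst nn_integral_cmult_indicator) auto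
    also have "\<dots> = 1" using mpos by (simp add: ennreal_mult'[symmetric])
    finally show "1 \<le> (\<integral>\<^sup>+r\<in>{r1<..<r2}. \<eta> r \<partial>lborel)" by simp
    have "(\<integral>\<^sup>+x\<in>annulus w r1 r2 \<inter> D. Q x * \<eta> (dist x w) ^ ?n \<partial>lebesgue) \<le> (\<integral>\<^sup>+x. ?Q x * \<eta> (dist x w) ^ ?n \<partial>lebesgue)"
      by (intro nn_integral_mono) (auto simp: indicator_def)
    also have "\<dots> = (\<integral>\<^sup>+x. ?Q x * \<eta> (dist x w) ^ ?n \<partial>lborel)" by (rule nn_integral_completion)
    also have "\<dots> = (\<integral>\<^sup>+x. Q' x * \<eta> (dist x w) ^ ?n \<partial>lborel)"
    proof (rule nn_integral_cong_AE)
      show "AE x in lborel. ?Q x * \<eta> (dist x w) ^ ?n = Q' x * \<eta> (dist x w) ^ ?n"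
        using AE_not_in[OF N] by eventually_elim (simp add: QN)
    qed
    also have "\<dots> = (\<integral>\<^sup>+x. Q' (w + x) * \<eta> (dist (w + x) w) ^ ?n \<partial>lborel)"
      by (rule shift) measurable
    also have "\<dots> = of_nat ?n * (\<integral>\<^sup>+r. ennreal (indicator {0<..} r * r ^ (?n - 1)) * (\<integral>\<^sup>+\<theta>. Q' (w + r *\<^sub>R \<theta>) * \<eta> (dist (w + r *\<^sub>R \<theta>) w) ^ ?n \<partial>cone_measure) \<partial>lborel)"
      by (rule nn_integral_polar) measurable
    also have "\<dots> \<le> of_nat ?n * (\<integral>\<^sup>+r. ennreal (r2 ^ (?n - 1) * (1 / m) ^ ?n * j) * indicator (T j) r \<partial>lborel)"
    proof (intro mult_left_mono nn_integral_mono)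
      fix r :: real
      show "ennreal (indicator {0<..} r * r ^ (?n - 1)) * (\<integral>\<^sup>+\<theta>. Q' (w + r *\<^sub>R \<theta>) * \<eta> (dist (w + r *\<^sub>R \<theta>) w) ^ ?n \<partial>cone_measure)
         \<le> ennreal (r2 ^ (?n - 1) * (1 / m) ^ ?n * j) * indicator (T j) r"
      proof (cases "r > 0")
        case True
        have "(\<integral>\<^sup>+\<theta>. Q' (w + r *\<^sub>R \<theta>) * \<eta> (dist (w + r *\<^sub>R \<theta>) w) ^ ?n \<partial>cone_measure) = (\<integral>\<^sup>+\<theta>. Q' (w + r *\<^sub>R \<theta>) * \<eta> r ^ ?n \<partial>cone_measure)"
        proof (rule nn_integral_cong_AE)
          show "AE \<theta> in cone_measure. Q' (w + r *\<^sub>R \<theta>) * \<eta> (dist (w + r *\<^sub>R \<theta>) w) ^ ?n = Q' (w + r *\<^sub>R \<theta>) * \<eta> r ^ ?n"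
            using AE_cone_measure_norm[where 'a='a] by eventually_elim (use True in \<open>simp add: dist_norm\<close>)
        qed
        also have "\<dots> = q r * \<eta> r ^ ?n" unfolding q_def by (rule nn_integral_multc) measurable
        finally have *: "(\<integral>\<^sup>+\<theta>. Q' (w + r *\<^sub>R \<theta>) * \<eta> (dist (w + r *\<^sub>R \<theta>) w) ^ ?n \<partial>cone_measure) = q r * \<eta> r ^ ?n" .
        show ?thesis
        proof (cases "r \<in> T j")
          case rT: True
          then have "r \<le> r2" "q r \<le> ennreal j" by (auto simp: T_def ennreal_of_nat_eq_real_of_nat)
          then have "ennreal (r ^ (?n - 1)) * (q r * ennreal (1 / m) ^ ?n) \<le> ennreal (r2 ^ (?n - 1)) * (ennreal j * ennreal (1 / m) ^ ?n)"
            using True by (intro mult_mono ennreal_leI power_mono) auto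
          also have "\<dots> = ennreal (r2 ^ (?n - 1) * (1 / m) ^ ?n * j)"
            using r12 mpos by (simp add: ennreal_power ennreal_mult mult_ac)
          finally show ?thesis unfolding * using True rT by (simp add: \<eta>_def)
        next
          case False
          then show ?thesis unfolding * by (simp add: \<eta>_def power_0_left)
        qed
      qed simp
    qed simp
    also have "\<dots> < \<infinity>"
      by (subst nn_integral_cmult_indicator) (auto simp: m ennreal_mult_less_top of_nat_less_top)
    finally show "(\<integral>\<^sup>+x\<in>annulus w r1 r2 \<inter> D. Q x * \<eta> (dist x w) ^ ?n \<partial>lebesgue) < \<infinity>" .
  qed
qed

section \<open>Ring families\<close>

lemma homeomorphic_map_continuous_ext:
  assumes "ext_homeomorphism D f"
  shows "continuous_map (top_of_set D) ext_top f" "inj_on f D"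
  using homeomorphic_imp_continuous_map[OF assms] homeomorphic_imp_injective_map[OF assms]
  by (auto simp: continuous_map_in_subtopology)

text \<open>The preimage \<open>P\<close> of the closed cap is compact, being the image of a compact
  set under the inverse of \<open>f\<close>; hence the ray leaves it even if \<open>D\<close> is
  unbounded. The frontier point reached still belongs to \<open>P\<close>, but not to the open
  preimage \<open>U\<close> of the open cap.\<close>

lemma exit_point:
  fixes f :: "'a::euclidean_space \<Rightarrow> 'a option"
  assumes f: "ext_homeomorphism D f" and D: "open D"
    and N: "{y. chordal z y \<le> s} \<subseteq> f ` D" and q: "q \<in> D" "chordal z (f q) < s" and v: "v \<noteq> 0"
  shows "\<exists>d>0. (\<forall>t\<in>{0..d}. q + t *\<^sub>R v \<in> D) \<and> s \<le> chordal z (f (q + d *\<^sub>R v))"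
proof -
  let ?N = "{y. chordal z y \<le> s}"
  define P where "P = {x \<in> D. f x \<in> ?N}"
  define U where "U = {x \<in> D. chordal z (f x) < s}"
  obtain g where g: "homeomorphic_maps (top_of_set D) (subtopology ext_top (f ` D)) f g"
    using f homeomorphic_map_maps by blast
  then have gc: "continuous_map (subtopology ext_top (f ` D)) (top_of_set D) g"
    and gf: "\<And>x. x \<in> D \<Longrightarrow> g (f x) = x" by (auto simp: homeomorphic_maps_def)
  have "compactin (subtopology ext_top (f ` D)) ?N"
    using compactin_chordal_cball N by (simp add: compactin_subtopology)
  then have "compactin (top_of_set D) (g ` ?N)" using gc by (rule image_compactin)
  moreover have "g ` ?N = P"
  proof (intro equalityI subsetI)
    fix u assume "u \<in> g ` ?N"
    then obtain y where y: "y \<in> ?N" "u = g y" by blast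
    then obtain x where "x \<in> D" "y = f x" using N by blast
    then show "u \<in> P" using y gf by (auto simp: P_def)
  next
    fix u assume "u \<in> P"
    then show "u \<in> g ` ?N" using gf[of u] by (intro image_eqI[of _ _ "f u"]) (auto simp: P_def)
  qed
  ultimately have P: "compact P" by (simp add: compactin_subtopology)
  have "openin ext_top {y. chordal z y < s}"
    using Chordal.openin_mball[of z s] by (simp add: ext_top_eq Chordal.mball_def)
  then have "openin (top_of_set D) {x \<in> topspace (top_of_set D). f x \<in> {y. chordal z y < s}}"
    by (rule openin_continuous_map_preimage[OF homeomorphic_map_continuous_ext(1)[OF f]])
  then have U: "open U" using D by (simp add: U_def openin_open_eq)
  have UP: "U \<subseteq> interior P" using U by (intro interior_maximal) (auto simp: U_def P_def)
  have "q \<in> interior P" using q UP by (auto simp: U_def)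
  then obtain d where d: "d > 0" "q + d *\<^sub>R v \<in> frontier P" "\<And>e. \<lbrakk>0 \<le> e; e < d\<rbrakk> \<Longrightarrow> q + e *\<^sub>R v \<in> interior P"
    using ray_to_frontier[OF compact_imp_bounded[OF P] _ v] by blast
  have "q + d *\<^sub>R v \<in> P" using d(2) P by (simp add: frontier_def compact_imp_closed)
  then have "q + t *\<^sub>R v \<in> D" if "t \<in> {0..d}" for t
    using that d(3)[of t] interior_subset by (cases "t = d") (auto simp: P_def)
  moreover have "q + d *\<^sub>R v \<notin> U" using d(2) UP by (auto simp: frontier_def)
  then have "s \<le> chordal z (f (q + d *\<^sub>R v))" using \<open>q + d *\<^sub>R v \<in> P\<close> by (auto simp: U_def P_def)
  ultimately show ?thesis using d(1) by blast
qed

lemma connected_ray_segment: "connected ((\<lambda>t. q + t *\<^sub>R v) ` {0..d::real})"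
  for q v :: "'a::euclidean_space"
  by (intro connected_continuous_image continuous_intros connected_Icc)

abbreviation image_crosses :: "('a::euclidean_space \<Rightarrow> 'a option) \<Rightarrow> 'a set \<Rightarrow> 'a \<Rightarrow> real \<Rightarrow> bool" where
  "image_crosses f A c R \<equiv> (\<exists>p\<in>A. f p \<in> Some ` ball c R) \<and> (\<exists>p\<in>A. f p \<notin> Some ` cball c R)"

abbreviation crossing_configuration ::
    "'a::euclidean_space set \<Rightarrow> ('a \<Rightarrow> 'a option) \<Rightarrow> 'a \<Rightarrow> real \<Rightarrow> real \<Rightarrow> 'a \<Rightarrow> real \<Rightarrow> real \<Rightarrow> 'a set \<Rightarrow> 'a set \<Rightarrow> bool" where
  "crossing_configuration D f w r1 r2 c R0 R1 E F \<equiv>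
     ext_homeomorphism D f \<and> r1 < r2 \<and> 0 < R0 \<and> R0 < R1 \<and>
     E \<subseteq> D \<inter> cball w r1 \<and> connected E \<and> F \<subseteq> D - ball w r2 \<and> connected F \<and>
     (\<forall>R. R0 < R \<longrightarrow> R < R1 \<longrightarrow> Some ` sphere c R \<subseteq> f ` D \<and> image_crosses f E c R \<and> image_crosses f F c R)"

text \<open>Connectedness turns a point inside and a point outside each sphere into a point on it,
  as \<open>modulus_image_ring_ge\<close> requires; only the images of single points remain to be
  controlled.\<close>

lemma modulus_crossing:
  assumes dim: "DIM('a::euclidean_space) \<ge> 2"
  shows "\<exists>c0>0. \<forall>D (f :: 'a \<Rightarrow> 'a option) w r1 r2 c R0 R1 E F.
      crossing_configuration D f w r1 r2 c R0 R1 E F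
      \<longrightarrow> ennreal (c0 * ln (R1 / R0)) \<le> ring_image_modulus f D w r1 r2"
proof -
  obtain c0 where c0: "c0 > 0" and mod: "\<forall>D (f :: 'a \<Rightarrow> 'a option) w r1 r2 c R0 R1.
      ext_homeomorphism D f \<and> r1 < r2 \<and> 0 < R0 \<and> R0 < R1 \<and>
      (\<forall>R. R0 < R \<longrightarrow> R < R1 \<longrightarrow> Some ` sphere c R \<subseteq> f ` D
          \<and> (\<exists>u\<in>D. dist u w \<le> r1 \<and> f u \<in> Some ` sphere c R) \<and> (\<exists>u\<in>D. r2 \<le> dist u w \<and> f u \<in> Some ` sphere c R))
      \<longrightarrow> ennreal (c0 * ln (R1 / R0)) \<le> ring_image_modulus f D w r1 r2"
    using modulus_image_ring_ge[OF dim] by blast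
  show ?thesis
  proof (intro exI[of _ c0] conjI allI impI, rule c0)
    fix D E F :: "'a set" and f :: "'a \<Rightarrow> 'a option" and w c :: 'a and r1 r2 R0 R1 :: real
    assume asm: "crossing_configuration D f w r1 r2 c R0 R1 E F"
    then have f: "ext_homeomorphism D f" by blast
    have meets: "\<exists>u\<in>E'. f u \<in> Some ` sphere c R"
      if E': "E' \<subseteq> D" "connected E'" "p \<in> E'" "p' \<in> E'" "f p \<in> Some ` ball c R" "f p' \<notin> Some ` cball c R" for E' p p' R
    proof -
      have "connectedin (top_of_set D) E'" using E' by (simp add: connectedin_subtopology)
      then have "connectedin ext_top (f ` E')"
        by (rule connectedin_continuous_map_image[OF homeomorphic_map_continuous_ext(1)[OF f]])
      then have "\<exists>y\<in>sphere c R. Some y \<in> f ` E'"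
        by (rule connectedin_meets_sphere[where p = "f p" and q = "f p'"]) (use E' in auto)
      then obtain y u where "y \<in> sphere c R" "u \<in> E'" "Some y = f u" by (auto simp del: mem_sphere)
      then show ?thesis by (intro bexI[of _ u]) (auto simp del: mem_sphere intro!: image_eqI[of _ _ y])
    qed
    have "Some ` sphere c R \<subseteq> f ` D \<and> (\<exists>u\<in>D. dist u w \<le> r1 \<and> f u \<in> Some ` sphere c R)
      \<and> (\<exists>u\<in>D. r2 \<le> dist u w \<and> f u \<in> Some ` sphere c R)" if R: "R0 < R" "R < R1" for R
    proof (intro conjI)
      from asm R have S: "Some ` sphere c R \<subseteq> f ` D" and e: "\<exists>p\<in>E. f p \<in> Some ` ball c R" "\<exists>p\<in>E. f p \<notin> Some ` cball c R"
        "\<exists>p\<in>F. f p \<in> Some ` ball c R" "\<exists>p\<in>F. f p \<notin> Some ` cball c R" by blast+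
      show "Some ` sphere c R \<subseteq> f ` D" by (rule S)
      have ED: "E \<subseteq> D" "connected E" "E \<subseteq> cball w r1" and FD: "F \<subseteq> D" "connected F" "F \<inter> ball w r2 = {}" using asm by auto
      obtain u where "u \<in> E" "f u \<in> Some ` sphere c R" using meets[OF ED(1,2)] e(1,2) by meson
      then show "\<exists>u\<in>D. dist u w \<le> r1 \<and> f u \<in> Some ` sphere c R" using ED by (intro bexI[of _ u]) (auto simp: dist_commute simp del: mem_sphere)
      obtain u where "u \<in> F" "f u \<in> Some ` sphere c R" using meets[OF FD(1,2)] e(3,4) by meson
      then show "\<exists>u\<in>D. r2 \<le> dist u w \<and> f u \<in> Some ` sphere c R"
        using FD by (intro bexI[of _ u] conjI) (fastforce simp: dist_commute disjoint_iff not_less simp del: mem_sphere)+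
    qed
    then have hyp: "\<forall>R. R0 < R \<longrightarrow> R < R1 \<longrightarrow> Some ` sphere c R \<subseteq> f ` D \<and> (\<exists>u\<in>D. dist u w \<le> r1 \<and> f u \<in> Some ` sphere c R)
      \<and> (\<exists>u\<in>D. r2 \<le> dist u w \<and> f u \<in> Some ` sphere c R)" by blast
    have r: "r1 < r2" "0 < R0" "R0 < R1" using asm by auto
    show "ennreal (c0 * ln (R1 / R0)) \<le> ring_image_modulus f D w r1 r2"
      by (rule mod[THEN spec, THEN spec, THEN spec, THEN spec, THEN spec, THEN spec, THEN spec, THEN spec, THEN mp,
          OF conjI[OF f conjI[OF r(1) conjI[OF r(2) conjI[OF r(3) hyp]]]]])
  qed
qed

lemma ring_familyD:
  assumes "f \<in> ring_family \<delta> K Q D"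
  shows "ext_homeomorphism D f"
    and "\<And>w. w \<in> D \<Longrightarrow> ring_Q_ineq f D Q w"
  using assms by (auto simp: ring_family_def)

lemma ring_family_cap:
  assumes "f \<in> ring_family \<delta> K Q D" "x \<in> K" "K \<subseteq> D" "0 \<le> s" "s < \<delta>" "s < 1/2"
  shows "{y. chordal (f x) y \<le> s} \<subseteq> f ` D"
  by (rule chordal_cball_subset[of _ _ \<delta>]) (use assms in \<open>auto simp: ring_family_def\<close>)

lemma ring_Q_ineqD:
  fixes \<eta> :: "real \<Rightarrow> ennreal" and f :: "'a::euclidean_space \<Rightarrow> 'a option"
  assumes "ring_Q_ineq f D Q w" "0 < r1" "r1 < r2" "\<exists>x\<in>D. r2 < dist x w"
    and "\<eta> \<in> borel_measurable borel" "1 \<le> (\<integral>\<^sup>+r\<in>{r1<..<r2}. \<eta> r \<partial>lborel)"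
  shows "ring_image_modulus f D w r1 r2
      \<le> (\<integral>\<^sup>+x\<in>annulus w r1 r2 \<inter> D. Q x * \<eta> (dist x w) ^ DIM('a) \<partial>lebesgue)"
proof -
  have "\<eta> \<in> borel_measurable (restrict_space lebesgue {r1<..<r2})"
    using assms(5) by (intro measurable_restrict_space1 measurable_completion) simp
  then show ?thesis using assms unfolding ring_Q_ineq_def by blast
qed

text \<open>\<open>t\<close> depends on the ring and on \<open>s\<close>, but on neither
  \<open>f\<close> nor \<open>x\<close>. If \<open>f e\<close> stayed away from \<open>f x\<close>,
  the images of \<open>E\<close> and of a segment starting at \<open>q\<close> would both cross all
  spheres between two radii of ratio \<open>L\<close>, and the modulus would exceed the finite bound
  \<open>M\<close>. \<open>E\<close> is an arbitrary connected set, not a ball, so that the step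
  also works next to the boundary of \<open>D\<close>.\<close>

lemma collapse_step:
  fixes D K :: "'a::euclidean_space set" and Q :: "'a \<Rightarrow> ennreal"
  assumes dim: "DIM('a) \<ge> 2" and D: "open D" and Q: "Q \<in> borel_measurable (restrict_space lebesgue D)"
    and KD: "K \<subseteq> D" and \<delta>: "\<delta> > 0" and cond: "sphere_integrable_cond D Q"
    and w: "w \<in> D" and r12: "0 < r1" "r1 < r2" and far: "\<exists>x\<in>D. r2 < dist x w" and s: "s > 0"
  shows "\<exists>t>0. \<forall>f\<in>ring_family \<delta> K Q D. \<forall>x\<in>K. \<forall>E p e q. connected E \<and> E \<subseteq> D \<inter> cball w r1 \<and> p \<in> E \<and> e \<in> E
     \<and> q \<in> D \<and> r2 \<le> dist q w \<and> chordal (f x) (f p) < t \<and> chordal (f x) (f q) < t \<longrightarrow> chordal (f x) (f e) < s"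
proof -
  obtain \<eta> where \<eta>: "\<eta> \<in> borel_measurable borel" "1 \<le> (\<integral>\<^sup>+r\<in>{r1<..<r2}. \<eta> r \<partial>lborel)"
    and fin: "(\<integral>\<^sup>+x\<in>annulus w r1 r2 \<inter> D. Q x * \<eta> (dist x w) ^ DIM('a) \<partial>lebesgue) < \<infinity>"
    using ring_density_exists[OF dim D Q cond w r12 far] by blast
  then obtain M where M: "(\<integral>\<^sup>+x\<in>annulus w r1 r2 \<inter> D. Q x * \<eta> (dist x w) ^ DIM('a) \<partial>lebesgue) = ennreal M" "M \<ge> 0"
    by (cases "\<integral>\<^sup>+x\<in>annulus w r1 r2 \<inter> D. Q x * \<eta> (dist x w) ^ DIM('a) \<partial>lebesgue") auto
  obtain c0 where c0: "c0 > 0" and mod: "\<forall>D (f :: 'a \<Rightarrow> 'a option) w r1 r2 c R0 R1 E F.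
      crossing_configuration D f w r1 r2 c R0 R1 E F
      \<longrightarrow> ennreal (c0 * ln (R1 / R0)) \<le> ring_image_modulus f D w r1 r2"
    using modulus_crossing[OF dim] by (elim exE conjE)
  define s1 where "s1 = min s (min (\<delta> / 2) (1 / 4))"
  have s1: "s1 > 0" "s1 \<le> s" "s1 < \<delta>" "s1 < 1/2" using s \<delta> by (auto simp: s1_def)
  \<comment> \<open>A ratio of radii for which \<open>c0 * ln L\<close> exceeds
    \<open>M\<close>.\<close>
  define L where "L = exp (M / c0) + 1"
  have L: "L > 1" by (simp add: L_def)
  have "M / c0 = ln (exp (M / c0))" by simp
  also have "\<dots> < ln L" by (subst ln_less_cancel_iff) (auto simp: L_def add_pos_pos)
  finally have ltM: "M < c0 * ln L" using c0 by (simp add: field_simps)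
  \<comment> \<open>The threshold for \<open>f x\<close> being close to infinity: with
    \<open>R0 = 2 / s1\<close>, a finite point at chordal distance at most \<open>2 * \<tau>\<close>
    from \<open>None\<close> has norm at least \<open>L * R0\<close>.\<close>
  define \<tau> where "\<tau> = 1 / (2 * (L * (2 / s1) + 1))"
  have \<tau>pos: "\<tau> > 0" using L s1 by (simp add: \<tau>_def add_pos_pos)
  have \<tau>s: "\<tau> \<le> s1 / 2"
  proof -
    have "2 / s1 \<le> L * (2 / s1)" using mult_right_mono[of 1 L "2 / s1"] L s1 by (simp only: mult_1) simp
    moreover have "z \<le> 2 * (y + 1)" if "0 < z" "z \<le> y" for z y :: real using that by simp
    moreover have "0 < 2 / s1" using s1 by simp
    ultimately have "2 / s1 \<le> 2 * (L * (2 / s1) + 1)" by blast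
    then have "1 / (2 * (L * (2 / s1) + 1)) \<le> 1 / (2 / s1)" using s1 by (intro frac_le) auto
    then show ?thesis by (simp add: \<tau>_def)
  qed
  \<comment> \<open>The first bound keeps \<open>t + \<tau>\<close> below \<open>2 * \<tau>\<close>
    near infinity and makes \<open>chordal_small\<close> applicable otherwise. The second then gives
    a Euclidean displacement of at most \<open>s1 / (2 * L)\<close>, because
    \<open>sqrt (1 + (norm c)^2) \<le> 1 / \<tau>\<close>.\<close>
  define t where "t = min (\<tau> / 2) (s1 * \<tau>\<^sup>2 / (4 * L))"
  have t: "t > 0" using \<tau>pos s1 L by (simp add: t_def)
  have t2: "t \<le> \<tau> / 2" "t \<le> s1 * \<tau>\<^sup>2 / (4 * L)" by (auto simp: t_def)
  show ?thesis
  proof (intro exI[of _ t] conjI ballI allI impI, rule t)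
    fix f x E p e q
    assume f: "f \<in> ring_family \<delta> K Q D" and x: "x \<in> K"
      and asm: "connected E \<and> E \<subseteq> D \<inter> cball w r1 \<and> p \<in> E \<and> e \<in> E
       \<and> q \<in> D \<and> r2 \<le> dist q w \<and> chordal (f x) (f p) < t \<and> chordal (f x) (f q) < t"
    then have E: "connected E" "E \<subseteq> D \<inter> cball w r1" "p \<in> E" "e \<in> E" and q: "q \<in> D" "r2 \<le> dist q w"
      and tp: "chordal (f x) (f p) < t" and tq: "chordal (f x) (f q) < t" by auto
    note hom = ring_familyD(1)[OF f]
    show "chordal (f x) (f e) < s"
    proof (rule ccontr)
      assume "\<not> chordal (f x) (f e) < s"
      then have e: "chordal (f x) (f e) \<ge> s1" using s1 by linarith
      have cap: "{y. chordal (f x) y \<le> s1} \<subseteq> f ` D" using s1 by (intro ring_family_cap[OF f x KD]) auto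
      have qs: "chordal (f x) (f q) < s1" using tq t2 \<tau>s s1 \<tau>pos by linarith
      \<comment> \<open>The ray from \<open>q\<close> points away from \<open>w\<close>, so it never
        enters the ball of radius \<open>r2\<close>.\<close>
      have "q - w \<noteq> 0" using q r12 by auto
      then obtain d where d: "d > 0" "\<forall>t\<in>{0..d}. q + t *\<^sub>R (q - w) \<in> D" "s1 \<le> chordal (f x) (f (q + d *\<^sub>R (q - w)))"
        using exit_point[OF hom D cap q(1) qs] by blast
      define b F where "b = q + d *\<^sub>R (q - w)" and "F = (\<lambda>t. q + t *\<^sub>R (q - w)) ` {0..d}"
      have "q \<in> F" unfolding F_def using d by (intro image_eqI[of _ _ 0]) auto
      moreover have "b \<in> F" unfolding F_def b_def using d by (intro image_eqI[of _ _ d]) auto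
      ultimately have F: "connected F" "q \<in> F" "b \<in> F" unfolding F_def by (auto intro: connected_ray_segment)
      have "q + t *\<^sub>R (q - w) \<notin> ball w r2" if "t \<ge> 0" for t
      proof -
        have "w - (q + t *\<^sub>R (q - w)) = (- (1 + t)) *\<^sub>R (q - w)" by (simp add: algebra_simps)
        then have "dist w (q + t *\<^sub>R (q - w)) = (1 + t) * dist q w" using that by (simp add: dist_norm)
        moreover have "1 * dist q w \<le> (1 + t) * dist q w" using that by (intro mult_right_mono) auto
        ultimately show ?thesis using q by simp
      qed
      then have FD: "F \<subseteq> D - ball w r2" using d by (auto simp: F_def simp del: mem_ball)
      have bF: "s1 \<le> chordal (f x) (f b)" using d(3) by (simp add: b_def)
      have contra: False if R: "0 < R0" "R0 < R1" "R1 / R0 = L" and hyp: "\<forall>R. R0 < R \<longrightarrow> R < R1 \<longrightarrow> Some ` sphere c R \<subseteq> f ` D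
          \<and> image_crosses f E c R \<and> image_crosses f F c R" for c R0 R1
      proof -
        have "ennreal (c0 * ln (R1 / R0)) \<le> ring_image_modulus f D w r1 r2"
          by (rule mod[THEN spec[of _ D], THEN spec[of _ f], THEN spec[of _ w], THEN spec[of _ r1], THEN spec[of _ r2], THEN spec[of _ c],
                THEN spec[of _ R0], THEN spec[of _ R1], THEN spec[of _ E], THEN spec[of _ F], THEN mp], intro conjI)
             (rule hom r12 R E FD F hyp)+
        also have "\<dots> \<le> ennreal M"
          using ring_Q_ineqD[OF ring_familyD(2)[OF f w] r12 far \<eta>] M by simp
        finally have "c0 * ln L \<le> M" using M R by (simp add: ennreal_le_iff)
        then show False using ltM by simp
      qed
      \<comment> \<open>Spheres centred at \<open>f x\<close> serve unless \<open>f x\<close> is close to \<open>\<infinity>\<close>, when spheres centred at \<open>0\<close> do.\<close>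
      show False
      proof (cases "chordal (f x) None \<ge> \<tau>")
        case True
        then obtain c where c: "f x = Some c" using \<tau>pos by (cases "f x") (auto simp: chordal_def)
        define A where "A = sqrt (1 + (norm c)\<^sup>2)"
        have A: "A \<ge> 1" "A\<^sup>2 = 1 + (norm c)\<^sup>2" by (auto simp: A_def add_nonneg_nonneg)
        have "\<tau> \<le> 1 / A" using True c by (simp add: chordal_def A_def)
        then have \<tau>A: "\<tau> * A \<le> 1" using A by (simp add: field_simps)
        have tA: "2 * t * sqrt (1 + (norm c)\<^sup>2) \<le> 1"
        proof -
          have "2 * t * A \<le> \<tau> * A" using t2 A by (intro mult_right_mono) auto
          then show ?thesis using \<tau>A by (simp add: A_def)
        qed
        have tA2: "2 * t * (1 + (norm c)\<^sup>2) \<le> s1 / (2 * L)"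
        proof -
          have "2 * t * A\<^sup>2 \<le> 2 * (s1 * \<tau>\<^sup>2 / (4 * L)) * A\<^sup>2" using t2 by (intro mult_right_mono mult_left_mono) auto
          also have "\<dots> = (\<tau> * A)\<^sup>2 * (s1 / (2 * L))" by (simp add: power_mult_distrib)
          also have "\<dots> \<le> 1 * (s1 / (2 * L))" using \<tau>A \<tau>pos A s1 L by (intro mult_right_mono) (auto simp: power_le_one)
          finally show ?thesis using A by simp
        qed
        have near: "f u \<in> Some ` ball c R" if "chordal (f x) (f u) < t" "s1 / L < R" for u R
        proof -
          have "chordal (Some c) (f u) \<le> t" using that c by simp
          then obtain y where y: "f u = Some y" "norm (y - c) \<le> 2 * t * (1 + (norm c)\<^sup>2)" using chordal_small tA by metis
          have "s1 / (2 * L) \<le> s1 / L" using s1 L by (intro divide_left_mono) auto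
          then show ?thesis using y tA2 that(2) by (auto simp: dist_norm norm_minus_commute)
        qed
        have away: "f u \<notin> Some ` cball c R" if "s1 \<le> chordal (f x) (f u)" "R < s1" for u R
        proof
          assume "f u \<in> Some ` cball c R"
          then obtain y where "f u = Some y" "dist c y \<le> R" by auto
          then show False using chordal_le_dist[of c y] that c by (simp add: dist_norm)
        qed
        have sph: "Some ` sphere c R \<subseteq> f ` D" if "R < s1" for R
        proof -
          have "chordal (f x) (Some y) \<le> s1" if "dist c y = R" for y
            using chordal_le_dist[of c y] that \<open>R < s1\<close> c by (simp add: dist_norm)
          then show ?thesis using cap by auto
        qed
        show False
        proof (rule contra[of "s1 / L" s1 c])
          show "0 < s1 / L" "s1 / L < s1" "s1 / (s1 / L) = L" using s1 L by (auto simp: field_simps)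
        next
          show "\<forall>R. s1 / L < R \<longrightarrow> R < s1 \<longrightarrow> Some ` sphere c R \<subseteq> f ` D
          \<and> image_crosses f E c R \<and> image_crosses f F c R"
            using near away sph tp tq e bF E F by (intro allI impI conjI) blast+
        qed
      next
        case False
        then have fx: "chordal (f x) None < \<tau>" by simp
        \<comment> \<open>Finite values at least \<open>s1\<close> away from \<open>f x\<close> have
          norm at most \<open>R0\<close>, and points of norm above \<open>R0\<close> lie in the cap;
          both follow from \<open>\<tau> \<le> s1 / 2\<close>. Here the points close to
          \<open>f x\<close> are the ones outside the spheres.\<close>
        define R0 where "R0 = 2 / s1"
        have R0: "R0 > 0" using s1 by (simp add: R0_def)
        have LR: "L * R0 > 0" using L R0 by simp
        have half: "2 * (1 / (2 * z)) = 1 / z" for z :: real by simp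
        have \<tau>R: "2 * \<tau> = 1 / (L * R0 + 1)" unfolding \<tau>_def R0_def[symmetric] by (rule half)
        have tri: "chordal (f u) None \<le> chordal (f x) (f u) + \<tau>" for u
          using Chordal.triangle[of "f u" "f x" None] fx by (simp add: Chordal.commute)
        have tri': "chordal (f x) (f u) \<le> chordal (f u) None + \<tau>" for u
          using Chordal.triangle[of "f x" None "f u"] fx by (simp add: Chordal.commute)
        have sq: "sqrt (1 + r\<^sup>2) \<le> 1 + r" if "r \<ge> 0" for r :: real
          using that by (intro real_le_lsqrt) (auto simp: power2_eq_square algebra_simps)
        have away: "f u \<notin> Some ` cball 0 R" if "chordal (f x) (f u) < t" "R < L * R0" for u R
        proof
          assume "f u \<in> Some ` cball 0 R"
          then obtain y where y: "f u = Some y" "norm y \<le> R" by auto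
          have "sqrt (1 + (norm y)\<^sup>2) < L * R0 + 1" using sq[of "norm y"] y that by simp
          then have "1 / (L * R0 + 1) < 1 / sqrt (1 + (norm y)\<^sup>2)"
            using LR by (intro divide_strict_left_mono) (auto intro!: mult_pos_pos add_pos_nonneg)
          then have "2 * \<tau> < chordal (f u) None" using y \<tau>R by (simp add: chordal_def)
          then show False using tri[of u] that t2 \<tau>pos by linarith
        qed
        have near: "f u \<in> Some ` ball 0 R" if "s1 \<le> chordal (f x) (f u)" "R0 < R" for u R
        proof -
          have *: "s1 / 2 \<le> chordal (f u) None" using tri'[of u] that \<tau>s by linarith
          then obtain y where y: "f u = Some y" using s1 by (cases "f u") (auto simp: chordal_def)
          have "s1 / 2 \<le> 1 / sqrt (1 + (norm y)\<^sup>2)" using * y by (simp add: chordal_def)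
          then have "sqrt (1 + (norm y)\<^sup>2) \<le> R0" using s1 by (simp add: R0_def field_simps add_pos_nonneg)
          moreover have "norm y \<le> sqrt (1 + (norm y)\<^sup>2)" by (rule real_le_rsqrt) simp
          ultimately show ?thesis using y that by auto
        qed
        have sph: "Some ` sphere 0 R \<subseteq> f ` D" if "R0 < R" for R
        proof -
          have "chordal (f x) (Some y) \<le> s1" if y: "norm y = R" for y
          proof -
            have "R0 < sqrt (1 + (norm y)\<^sup>2)" using \<open>R0 < R\<close> y R0 by (intro real_less_rsqrt) (smt (verit) power_strict_mono zero_less_numeral)
            then have "1 / sqrt (1 + (norm y)\<^sup>2) \<le> 1 / R0" using R0 by (intro frac_le) auto
            then have "chordal (Some y) None \<le> s1 / 2" by (simp add: chordal_def R0_def)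
            then show ?thesis using Chordal.triangle[of "f x" None "Some y"] fx \<tau>s by (simp add: Chordal.commute)
          qed
          then show ?thesis using cap by auto
        qed
        show False
        proof (rule contra[of R0 "L * R0" 0])
          show "0 < R0" "R0 < L * R0" "L * R0 / R0 = L" using R0 L by auto
        next
          show "\<forall>R. R0 < R \<longrightarrow> R < L * R0 \<longrightarrow> Some ` sphere 0 R \<subseteq> f ` D
          \<and> image_crosses f E 0 R \<and> image_crosses f F 0 R"
            using near away sph tp tq e bF E F by (intro allI impI conjI) blast+
        qed
      qed
    qed
  qed
qed

text \<open>Compactness of \<open>K\<close> makes both sequences converge, so
  \<open>collapse_step\<close> can be used with fixed centres although its constant depends on them;
  the moving points enter only as \<open>p\<close> and \<open>q\<close>.\<close>

lemma ring_family_equi_uniform: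
  fixes D K :: "'a::euclidean_space set" and Q :: "'a \<Rightarrow> ennreal"
  assumes dim: "DIM('a) \<ge> 2" and D: "open D" "connected D" "bounded D" and Q: "Q \<in> borel_measurable (restrict_space lebesgue D)"
    and K: "compact K" and KD: "K \<subseteq> D" and \<delta>: "\<delta> > 0" and cond: "sphere_integrable_cond D Q"
  shows "equi_uniform (ring_family \<delta> K Q D) K"
proof (rule ccontr)
  let ?\<F> = "ring_family \<delta> K Q D"
  assume "\<not> ?thesis"
  then obtain \<epsilon> where \<epsilon>: "\<epsilon> > 0" and bad: "\<And>\<delta>1. \<delta>1 > 0 \<Longrightarrow> \<exists>f\<in>?\<F>. \<exists>x\<in>K. \<exists>y\<in>K. \<epsilon> \<le> chordal (Some x) (Some y) \<and> chordal (f x) (f y) < \<delta>1"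
    unfolding equi_uniform_def not_le[symmetric] by blast
  have "\<exists>f x y. f \<in> ?\<F> \<and> x \<in> K \<and> y \<in> K \<and> \<epsilon> \<le> chordal (Some x) (Some y) \<and> chordal (f x) (f y) < inverse (real (Suc n))" for n
    using bad[of "inverse (real (Suc n))"] by auto
  then obtain F X Y where F: "\<And>n. F n \<in> ?\<F>" and X: "\<And>n. X n \<in> K" and Y: "\<And>n. Y n \<in> K"
    and far: "\<And>n. \<epsilon> \<le> chordal (Some (X n)) (Some (Y n))" and close: "\<And>n. chordal (F n (X n)) (F n (Y n)) < inverse (real (Suc n))"
    by metis
  have "compact (K \<times> K)" using K by (intro compact_Times)
  then have "seq_compact (K \<times> K)" by (rule compact_imp_seq_compact)
  then obtain l r where l: "l \<in> K \<times> K" and r: "strict_mono r" and lim: "((\<lambda>n. (X n, Y n)) \<circ> r) \<longlonglongrightarrow> l"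
    using X Y by (elim seq_compactE[of "K \<times> K" "\<lambda>n. (X n, Y n)"]) auto
  obtain x0 y0 where xy0: "l = (x0, y0)" by (cases l)
  define f x y where "f = (\<lambda>n. F (r n))" and "x = (\<lambda>n. X (r n))" and "y = (\<lambda>n. Y (r n))"
  have f: "f n \<in> ?\<F>" and x: "x n \<in> K" and y: "y n \<in> K" for n using F X Y by (auto simp: f_def x_def y_def)
  have x0: "x0 \<in> D" and y0: "y0 \<in> D" using l KD by (auto simp: xy0)
  have limx: "x \<longlonglongrightarrow> x0" and limy: "y \<longlonglongrightarrow> y0"
    using tendsto_fst[OF lim] tendsto_snd[OF lim] by (auto simp: xy0 x_def y_def o_def)
  have "\<epsilon> \<le> dist (x n) (y n)" for n
    using far[of "r n"] chordal_le_dist[of "x n" "y n"] by (simp add: x_def y_def dist_norm)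
  then have "\<epsilon> \<le> dist x0 y0" by (intro LIMSEQ_le_const[OF tendsto_dist[OF limx limy]]) auto
  then have ne: "x0 \<noteq> y0" using \<epsilon> by auto
  define h where "h = (\<lambda>u n. chordal (f n (x n)) (f n (u n)))"
  have hy: "h y \<longlonglongrightarrow> 0"
  proof (rule tendsto_sandwich[of "\<lambda>_. 0" _ _ "\<lambda>n. inverse (real (Suc (r n)))"])
    show "(\<lambda>n. inverse (real (Suc (r n)))) \<longlonglongrightarrow> 0"
      using LIMSEQ_subseq_LIMSEQ[OF LIMSEQ_inverse_real_of_nat r] by (simp add: o_def)
    show "\<forall>\<^sub>F n in sequentially. h y n \<le> inverse (real (Suc (r n)))"
      using close by (auto simp: h_def f_def x_def y_def intro!: always_eventually less_imp_le)
  qed (auto simp: h_def)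
  have hx: "h x \<longlonglongrightarrow> 0" by (simp add: h_def)
  \<comment> \<open>Collapse is demanded uniformly on a whole closed ball, which makes
    \<open>V\<close> open by construction; in \<open>step\<close> such a ball serves as the
    connected set \<open>E\<close>.\<close>
  define V where "V = {w \<in> D. \<exists>r>0. cball w r \<subseteq> D \<and> (\<forall>s>0. \<forall>\<^sub>F n in sequentially. \<forall>u\<in>cball w r. h (\<lambda>_. u) n < s)}"
  have hV: "h (\<lambda>_. w) \<longlonglongrightarrow> 0" if wV: "w \<in> V" for w
  proof (rule order_tendstoI)
    fix a :: real assume "a > 0"
    obtain r where "r > 0" "\<forall>s>0. \<forall>\<^sub>F n in sequentially. \<forall>u\<in>cball w r. h (\<lambda>_. u) n < s" using wV by (auto simp: V_def)
    then have "\<forall>\<^sub>F n in sequentially. \<forall>u\<in>cball w r. h (\<lambda>_. u) n < a" using \<open>a > 0\<close> by blast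
    then show "\<forall>\<^sub>F n in sequentially. h (\<lambda>_. w) n < a"
      by eventually_elim (use \<open>r > 0\<close> in auto)
  next
    fix a :: real assume "a < 0"
    then show "\<forall>\<^sub>F n in sequentially. a < h (\<lambda>_. w) n"
      by (intro always_eventually allI) (simp add: h_def order_less_le_trans)
  qed
  have step: "w \<in> V" if w: "cball w r1 \<subseteq> D" and r12: "0 < r1" "r1 < r2" and p: "\<forall>\<^sub>F n in sequentially. p n \<in> cball w r1"
    and q: "\<forall>\<^sub>F n in sequentially. q n \<in> D \<and> r2 < dist (q n) w" and hp: "h p \<longlonglongrightarrow> 0" and hq: "h q \<longlonglongrightarrow> 0" for w r1 r2 p q
  proof -
    have wD: "w \<in> D" using w r12 by auto
    obtain n0 where "q n0 \<in> D \<and> r2 < dist (q n0) w" using eventually_happens[OF q] by auto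
    then have farD: "\<exists>z\<in>D. r2 < dist z w" by blast
    have "\<forall>\<^sub>F n in sequentially. \<forall>u\<in>cball w r1. h (\<lambda>_. u) n < s" if s: "s > 0" for s
    proof -
      obtain t where t: "t > 0" and imp: "\<forall>f\<in>?\<F>. \<forall>x\<in>K. \<forall>E p e q. connected E \<and> E \<subseteq> D \<inter> cball w r1 \<and> p \<in> E \<and> e \<in> E
         \<and> q \<in> D \<and> r2 \<le> dist q w \<and> chordal (f x) (f p) < t \<and> chordal (f x) (f q) < t \<longrightarrow> chordal (f x) (f e) < s"
        using collapse_step[OF dim D(1) Q KD \<delta> cond wD r12 farD s] by blast
      show ?thesis
        using p q order_tendstoD(2)[OF hp t] order_tendstoD(2)[OF hq t]
      proof eventually_elim
        case (elim n)
        show ?case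
        proof
          fix u assume u: "u \<in> cball w r1"
          have "connected (cball w r1)" "cball w r1 \<subseteq> D \<inter> cball w r1" "r2 \<le> dist (q n) w" "chordal (f n (x n)) (f n (p n)) < t" "chordal (f n (x n)) (f n (q n)) < t"
            using w elim by (auto simp: h_def)
          then have "chordal (f n (x n)) (f n u) < s" using imp f x u elim by blast
          then show "h (\<lambda>_. u) n < s" by (simp add: h_def)
        qed
      qed
    qed
    then show ?thesis using wD w r12 unfolding V_def by blast
  qed
  have evdist: "\<forall>\<^sub>F n in sequentially. u n \<in> D \<and> b < dist (u n) w" if "u \<longlonglongrightarrow> l" "\<And>n. u n \<in> K" "b < dist l w" for u l b w
    using order_tendstoD(1)[OF tendsto_dist[OF that(1) tendsto_const[of w]] that(3)]
    by eventually_elim (use that(2) KD in auto)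
  \<comment> \<open>The propagation starts here: \<open>x n\<close> is the near point and
    \<open>y n\<close> the far one.\<close>
  have x0V: "x0 \<in> V"
  proof -
    obtain e where e: "e > 0" "cball x0 e \<subseteq> D" using D(1) x0 open_contains_cball by blast
    define r1 where "r1 = min e (dist x0 y0 / 4)"
    have r1: "r1 > 0" "r1 < dist x0 y0 / 2" "cball x0 r1 \<subseteq> D"
    proof -
      have "0 < dist x0 y0" "r1 \<le> dist x0 y0 / 4" "r1 \<le> e" using ne by (auto simp: r1_def)
      moreover have "r1 > 0" using e ne by (simp add: r1_def)
      ultimately show "r1 > 0" "r1 < dist x0 y0 / 2" "cball x0 r1 \<subseteq> D"
        using e(2) subset_cball[of r1 e x0] by (simp, linarith, blast)
    qed
    show ?thesis
    proof (rule step[OF r1(3) r1(1) r1(2) _ _ hx hy])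
      show "\<forall>\<^sub>F n in sequentially. x n \<in> cball x0 r1"
        using tendstoD[OF limx r1(1)] by eventually_elim (simp add: dist_commute)
      show "\<forall>\<^sub>F n in sequentially. y n \<in> D \<and> dist x0 y0 / 2 < dist (y n) x0"
        using ne by (intro evdist[OF limy y]) (simp add: dist_commute)
    qed
  qed
  have openV: "open V"
    unfolding open_contains_ball
  proof
    fix w assume "w \<in> V"
    then obtain r where r: "r > 0" "cball w r \<subseteq> D" "\<forall>s>0. \<forall>\<^sub>F n in sequentially. \<forall>u\<in>cball w r. h (\<lambda>_. u) n < s" by (auto simp: V_def)
    have "w' \<in> V" if w': "w' \<in> ball w r" for w'
    proof -
      define r' where "r' = r - dist w w'"
      have r': "r' > 0" using w' by (simp add: r'_def)
      have sub: "cball w' r' \<subseteq> cball w r"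
      proof
        fix z assume "z \<in> cball w' r'"
        then show "z \<in> cball w r" using dist_triangle[of w z w'] by (simp add: r'_def)
      qed
      have "\<forall>\<^sub>F n in sequentially. \<forall>u\<in>cball w' r'. h (\<lambda>_. u) n < s" if "s > 0" for s
      proof -
        have "\<forall>\<^sub>F n in sequentially. \<forall>u\<in>cball w r. h (\<lambda>_. u) n < s" using r(3) that by blast
        then show ?thesis by eventually_elim (use sub in blast)
      qed
      moreover have "w' \<in> D" using r(2) w' by auto
      ultimately show ?thesis unfolding V_def using r' sub r(2) by blast
    qed
    then show "\<exists>e>0. ball w e \<subseteq> V" using r(1) by blast
  qed
  \<comment> \<open>Around \<open>w\<close> outside \<open>V\<close> the radius \<open>r1\<close> is
    fixed before \<open>p\<close>; a point \<open>p\<close> of \<open>V\<close> in that ball, with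
    \<open>x n\<close> as the far point, would force \<open>w\<close> into \<open>V\<close>.\<close>
  have openDV: "open (D - V)"
    unfolding open_contains_ball
  proof
    fix w assume w: "w \<in> D - V"
    then have wx: "w \<noteq> x0" using x0V by auto
    obtain e where e: "e > 0" "cball w e \<subseteq> D" using D(1) w open_contains_cball by blast
    define r1 where "r1 = min e (dist x0 w / 4)"
    have r1: "r1 > 0" "r1 < dist x0 w / 2" "cball w r1 \<subseteq> D"
    proof -
      have "0 < dist x0 w" "r1 \<le> dist x0 w / 4" "r1 \<le> e" using wx by (auto simp: r1_def)
      moreover have "r1 > 0" using e wx by (simp add: r1_def)
      ultimately show "r1 > 0" "r1 < dist x0 w / 2" "cball w r1 \<subseteq> D"
        using e(2) subset_cball[of r1 e w] by (simp, linarith, blast)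
    qed
    have "p \<notin> V" if p: "p \<in> ball w r1" for p
    proof
      assume "p \<in> V"
      have "w \<in> V"
      proof (rule step[OF r1(3) r1(1) r1(2) _ _ hV[OF \<open>p \<in> V\<close>] hx])
        show "\<forall>\<^sub>F n in sequentially. p \<in> cball w r1" using p by (auto intro: always_eventually)
        show "\<forall>\<^sub>F n in sequentially. x n \<in> D \<and> dist x0 w / 2 < dist (x n) w"
          using wx by (intro evdist[OF limx x]) simp
      qed
      then show False using w by blast
    qed
    then have "ball w r1 \<subseteq> D - V" using r1(3) by auto
    then show "\<exists>e>0. ball w e \<subseteq> D - V" using r1(1) by blast
  qed
  have VD: "V = D"
  proof -
    have "V \<subseteq> D" by (auto simp: V_def)
    moreover have "D - V = {}"
      using connectedD[OF D(2) openV openDV] x0V x0 by blast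
    ultimately show ?thesis by blast
  qed
  txt \<open>The segment of a ray from \<open>x0\<close> next to its exit point from \<open>D\<close> cannot collapse.\<close>
  obtain v :: 'a where v: "v \<in> Basis" using nonempty_Basis by blast
  then have nv: "norm v = 1" "v \<noteq> 0" by auto
  have "x0 \<in> interior D" using x0 D(1) by (simp add: interior_open)
  then obtain d where d: "d > 0" "x0 + d *\<^sub>R v \<in> frontier D" "\<And>e. \<lbrakk>0 \<le> e; e < d\<rbrakk> \<Longrightarrow> x0 + e *\<^sub>R v \<in> interior D"
    using ray_to_frontier[OF D(3) _ nv(2)] by blast
  have dD: "x0 + d *\<^sub>R v \<notin> D" using d(2) D(1) by (simp add: frontier_def interior_open)
  \<comment> \<open>At this position the boundary point is at distance \<open>d / 4\<close>, while
    \<open>x0\<close>, at distance \<open>3 * d / 4\<close>, serves as the far point. The closed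
    ball of radius \<open>d / 4\<close> contains the boundary point and is not inside
    \<open>D\<close>, so a segment takes its place.\<close>
  define w where "w = x0 + (3 * d / 4) *\<^sub>R v"
  have w: "w \<in> D" using d(3)[of "3 * d / 4"] d(1) interior_subset by (auto simp: w_def)
  have dw: "dist x0 w = 3 * d / 4" using d(1) nv by (simp add: w_def dist_norm)
  define s1 where "s1 = min (\<delta> / 2) (1 / 4)"
  have s1: "s1 > 0" "s1 < \<delta>" "s1 < 1/2" using \<delta> by (auto simp: s1_def)
  have "\<exists>z\<in>D. d / 2 < dist z w" using x0 dw d(1) by (intro bexI[of _ x0]) auto
  then obtain t where t: "t > 0" and imp: "\<forall>f\<in>?\<F>. \<forall>x\<in>K. \<forall>E p e q. connected E \<and> E \<subseteq> D \<inter> cball w (d / 4) \<and> p \<in> E \<and> e \<in> E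
         \<and> q \<in> D \<and> d / 2 \<le> dist q w \<and> chordal (f x) (f p) < t \<and> chordal (f x) (f q) < t \<longrightarrow> chordal (f x) (f e) < s1"
    using collapse_step[OF dim D(1) Q KD \<delta> cond w, of "d / 4" "d / 2" s1] d(1) s1(1) by auto
  have hw: "h (\<lambda>_. w) \<longlonglongrightarrow> 0" and hx0: "h (\<lambda>_. x0) \<longlonglongrightarrow> 0" using hV VD w x0 by auto
  have "\<forall>\<^sub>F n in sequentially. h (\<lambda>_. w) n < t \<and> h (\<lambda>_. w) n < s1 \<and> h (\<lambda>_. x0) n < t"
    by (intro eventually_conj order_tendstoD(2)[OF hw] order_tendstoD(2)[OF hx0] t s1)
  then obtain n where n: "h (\<lambda>_. w) n < t" "h (\<lambda>_. w) n < s1" "h (\<lambda>_. x0) n < t"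
    using eventually_happens by (metis (no_types, lifting) sequentially_bot)
  have cap: "{y. chordal (f n (x n)) y \<le> s1} \<subseteq> f n ` D" using s1 by (intro ring_family_cap[OF f x KD]) auto
  have "chordal (f n (x n)) (f n w) < s1" using n by (simp add: h_def)
  then obtain \<tau> where \<tau>: "\<tau> > 0" "\<forall>t\<in>{0..\<tau>}. w + t *\<^sub>R v \<in> D" "s1 \<le> chordal (f n (x n)) (f n (w + \<tau> *\<^sub>R v))"
    using exit_point[OF ring_familyD(1)[OF f] D(1) cap w _ nv(2)] by blast
  \<comment> \<open>The cap is left while still in \<open>D\<close>, hence before the ray reaches
    the boundary point.\<close>
  have "w + (d / 4) *\<^sub>R v = x0 + d *\<^sub>R v" by (simp add: w_def algebra_simps flip: scaleR_left_distrib)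
  then have "\<tau> < d / 4" using \<tau>(2) dD d(1) by (metis atLeastAtMost_iff divide_nonneg_nonneg less_eq_real_def linorder_not_le zero_le_numeral)
  define E where "E = (\<lambda>t. w + t *\<^sub>R v) ` {0..\<tau>}"
  have "connected E" unfolding E_def by (rule connected_ray_segment)
  moreover have "E \<subseteq> D \<inter> cball w (d / 4)"
    using \<tau>(2) \<open>\<tau> < d / 4\<close> nv by (auto simp: E_def dist_norm)
  moreover have "w \<in> E" "w + \<tau> *\<^sub>R v \<in> E" using \<tau>(1) by (auto simp: E_def intro!: image_eqI[of w _ 0])
  moreover have "d / 2 \<le> dist x0 w" using dw d(1) by simp
  ultimately have "chordal (f n (x n)) (f n (w + \<tau> *\<^sub>R v)) < s1"
    using imp f[of n] x[of n] x0 n unfolding h_def by blast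
  then show False using \<tau>(3) by simp
qed

text \<open>The diameter is a supremum; passing to \<open>\<epsilon> / 2\<close> provides an actual
  pair of points to which equi-uniformity applies.\<close>

lemma equi_uniform_imp_uniformly_light:
  assumes "equi_uniform \<F> K"
  shows "uniformly_light \<F> K"
  unfolding uniformly_light_def
proof (intro allI impI)
  fix \<epsilon> :: real assume "\<epsilon> > 0"
  then obtain \<delta>1 where \<delta>1: "\<delta>1 > 0" and le: "\<And>f x y. f \<in> \<F> \<Longrightarrow> x \<in> K \<Longrightarrow> y \<in> K \<Longrightarrow> \<epsilon> / 2 \<le> chordal (Some x) (Some y) \<Longrightarrow> \<delta>1 \<le> chordal (f x) (f y)"
    using assms unfolding equi_uniform_def by (meson half_gt_zero)
  show "\<exists>\<delta>1>0. \<forall>f\<in>\<F>. \<forall>C. C \<subseteq> K \<and> C \<noteq> {} \<and> compact C \<and> connected C \<and> \<epsilon> \<le> chordal_diam (Some ` C) \<longrightarrow> \<delta>1 \<le> chordal_diam (f ` C)"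
  proof (intro exI[of _ \<delta>1] conjI ballI allI impI, rule \<delta>1)
    fix f C assume f: "f \<in> \<F>" and C: "C \<subseteq> K \<and> C \<noteq> {} \<and> compact C \<and> connected C \<and> \<epsilon> \<le> chordal_diam (Some ` C)"
    have "\<exists>x\<in>C. \<exists>y\<in>C. \<epsilon> / 2 < chordal (Some x) (Some y)"
    proof (rule ccontr)
      assume *: "\<not> ?thesis"
      have "chordal_diam (Some ` C) \<le> \<epsilon> / 2"
        unfolding chordal_diam_def
      proof (rule cSup_least)
        obtain c where "c \<in> C" using C by blast
        then show "{chordal x y |x y. x \<in> Some ` C \<and> y \<in> Some ` C} \<noteq> {}" by blast
      qed (use * in \<open>auto simp: not_less\<close>)
      then show False using C \<open>\<epsilon> > 0\<close> by simp
    qed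
    then obtain x y where xy: "x \<in> C" "y \<in> C" "\<epsilon> / 2 < chordal (Some x) (Some y)" by blast
    have "\<delta>1 \<le> chordal (f x) (f y)" using xy C f by (intro le) auto
    also have "\<dots> \<le> chordal_diam (f ` C)"
      unfolding chordal_diam_def using xy by (intro cSup_upper bdd_aboveI[of _ 1]) (auto intro: chordal_le_1)
    finally show "\<delta>1 \<le> chordal_diam (f ` C)" .
  qed
qed


text \<open>With \<open>R0\<close> the distance of the two images and
  \<open>l = norm (x - y)\<close>, the modulus lies between \<open>c0 * ln (s / R0)\<close> and
  \<open>I / l ^ n\<close>; the claim is this solved for \<open>R0\<close>. The constants are
  \<open>C1 = s\<close> and \<open>C = 2 * c0\<close>, which cancels the 2 in the exponent.
  Finiteness of \<open>f x\<close> allows Euclidean spheres to be centred there.\<close>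

lemma ring_family_lower_bound:
  fixes D K :: "'a::euclidean_space set" and Q :: "'a \<Rightarrow> ennreal"
  assumes dim: "DIM('a) \<ge> 2" and D: "open D" and KD: "K \<subseteq> D" and \<delta>: "\<delta> > 0"
    and Qint: "(\<integral>\<^sup>+x\<in>D. Q x \<partial>lebesgue) < \<infinity>" and Qm: "Q \<in> borel_measurable (restrict_space lebesgue D)"
    and finite_values: "\<And>f x. f \<in> ring_family \<delta> K Q D \<Longrightarrow> x \<in> D \<Longrightarrow> f x \<noteq> None"
  shows "\<exists>C>0. \<exists>C1>0. \<forall>f\<in>ring_family \<delta> K Q D. \<forall>x\<in>K. \<forall>y\<in>K. x \<noteq> y \<longrightarrow>
     C1 * exp (- (2 * enn2real (\<integral>\<^sup>+x\<in>D. Q x \<partial>lebesgue)) / (C * norm (x - y) ^ DIM('a))) \<le> norm (the (f x) - the (f y))"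
proof -
  let ?\<F> = "ring_family \<delta> K Q D" and ?n = "DIM('a)"
  define I where "I = enn2real (\<integral>\<^sup>+x\<in>D. Q x \<partial>lebesgue)"
  have I: "(\<integral>\<^sup>+x\<in>D. Q x \<partial>lebesgue) = ennreal I" "I \<ge> 0" using Qint by (auto simp: I_def less_top)
  obtain c0 where c0: "c0 > 0" and mod: "\<forall>D (f :: 'a \<Rightarrow> 'a option) w r1 r2 c R0 R1 E F.
      crossing_configuration D f w r1 r2 c R0 R1 E F
      \<longrightarrow> ennreal (c0 * ln (R1 / R0)) \<le> ring_image_modulus f D w r1 r2"
    using modulus_crossing[OF dim] by (elim exE conjE)
  define s where "s = min (\<delta> / 2) (1 / 4)"
  have s: "s > 0" "s < \<delta>" "s < 1/2" using \<delta> by (auto simp: s_def)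
  have main: "s * exp (- (2 * I) / ((2 * c0) * norm (x - y) ^ ?n)) \<le> norm (the (f x) - the (f y))"
    if f: "f \<in> ?\<F>" and x: "x \<in> K" and y: "y \<in> K" and xy: "x \<noteq> y" for f x y
  proof (cases "s \<le> norm (the (f x) - the (f y))")
    case True
    have "s * exp (- (2 * I) / ((2 * c0) * norm (x - y) ^ ?n)) \<le> s * 1"
      using s c0 I by (intro mult_left_mono) auto
    then show ?thesis using True by simp
  next
    case False
    note hom = ring_familyD(1)[OF f]
    have xD: "x \<in> D" and yD: "y \<in> D" using x y KD by auto
    obtain c c' where c: "f x = Some c" "f y = Some c'" using finite_values[OF f] xD yD by fastforce
    define R0 where "R0 = norm (c - c')"
    have "f x \<noteq> f y" using homeomorphic_map_continuous_ext(2)[OF hom] xD yD xy by (auto simp: inj_on_def)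
    then have R0: "0 < R0" "R0 < s" using False c by (auto simp: R0_def)
    have cap: "{z. chordal (f x) z \<le> s} \<subseteq> f ` D" using s by (intro ring_family_cap[OF f x KD]) auto
    have xx: "chordal (f x) (f x) < s" using s by simp
    have xy': "chordal (f x) (f y) < s" using R0 chordal_le_dist[of c c'] c by (simp add: R0_def)
    define l where "l = norm (x - y)"
    have l: "l > 0" using xy by (simp add: l_def)
    obtain d where d: "d > 0" "\<forall>t\<in>{0..d}. x + t *\<^sub>R (x - y) \<in> D" "s \<le> chordal (f x) (f (x + d *\<^sub>R (x - y)))"
      using exit_point[OF hom D cap xD xx, of "x - y"] xy by auto
    obtain d' where d': "d' > 0" "\<forall>t\<in>{0..d'}. y + t *\<^sub>R (y - x) \<in> D" "s \<le> chordal (f x) (f (y + d' *\<^sub>R (y - x)))"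
      using exit_point[OF hom D cap yD xy', of "y - x"] xy by auto
    \<comment> \<open>The segment \<open>E\<close> is a diameter of \<open>cball w r1\<close>, and
      \<open>y\<close>, the first point of \<open>F\<close>, is at distance exactly
      \<open>r2\<close>: the ring has width \<open>l\<close>.\<close>
    define w r1 r2 where "w = x + (d / 2) *\<^sub>R (x - y)" and "r1 = d / 2 * l" and "r2 = d / 2 * l + l"
    have w: "w \<in> D" using d by (simp add: w_def)
    have r12: "0 < r1" "r1 < r2" using d l by (auto simp: r1_def r2_def)
    define E F where "E = (\<lambda>t. x + t *\<^sub>R (x - y)) ` {0..d}" and "F = (\<lambda>t. y + t *\<^sub>R (y - x)) ` {0..d'}"
    have E: "connected E" "x \<in> E" "x + d *\<^sub>R (x - y) \<in> E"
    proof -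
      show "connected E" unfolding E_def by (rule connected_ray_segment)
      show "x \<in> E" unfolding E_def using d by (intro image_eqI[of _ _ 0]) auto
      show "x + d *\<^sub>R (x - y) \<in> E" unfolding E_def using d by (intro image_eqI[of _ _ d]) auto
    qed
    have F: "connected F" "y \<in> F" "y + d' *\<^sub>R (y - x) \<in> F"
    proof -
      show "connected F" unfolding F_def by (rule connected_ray_segment)
      show "y \<in> F" unfolding F_def using d' by (intro image_eqI[of _ _ 0]) auto
      show "y + d' *\<^sub>R (y - x) \<in> F" unfolding F_def using d' by (intro image_eqI[of _ _ d']) auto
    qed
    have ED: "E \<subseteq> D \<inter> cball w r1"
    proof -
      have "dist w (x + t *\<^sub>R (x - y)) \<le> r1" if "t \<in> {0..d}" for t
      proof -
        have "w - (x + t *\<^sub>R (x - y)) = (d / 2 - t) *\<^sub>R (x - y)" by (simp add: w_def algebra_simps)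
        then have "dist w (x + t *\<^sub>R (x - y)) = \<bar>d / 2 - t\<bar> * l" by (simp add: dist_norm l_def)
        moreover have "\<bar>d / 2 - t\<bar> \<le> d / 2" using that unfolding abs_le_iff by auto
        then have "\<bar>d / 2 - t\<bar> * l \<le> r1" unfolding r1_def using l by (intro mult_right_mono) auto
        ultimately show ?thesis by simp
      qed
      then show ?thesis using d by (auto simp: E_def)
    qed
    have distF: "dist (y + t *\<^sub>R (y - x)) w = r2 + t * l" if "t \<ge> 0" for t
    proof -
      have "(y + t *\<^sub>R (y - x)) - w = (1 + t + d / 2) *\<^sub>R (y - x)" by (simp add: w_def algebra_simps)
      then have "dist (y + t *\<^sub>R (y - x)) w = \<bar>1 + t + d / 2\<bar> * norm (y - x)" by (simp only: dist_norm norm_scaleR)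
      also have "\<bar>1 + t + d / 2\<bar> = 1 + t + d / 2" using that d by simp
      finally show ?thesis by (simp add: r2_def l_def norm_minus_commute algebra_simps)
    qed
    have FD: "F \<subseteq> D - ball w r2"
    proof -
      have "y + t *\<^sub>R (y - x) \<notin> ball w r2" if "t \<in> {0..d'}" for t
      proof -
        have "0 \<le> t * l" using that l by simp
        then show ?thesis using distF[of t] that by (simp add: dist_commute)
      qed
      then show ?thesis using d' by (auto simp: F_def simp del: mem_ball)
    qed
    \<comment> \<open>The ring inequality admits only radii below some distance from
      \<open>w\<close> attained in \<open>D\<close>; the segment beyond \<open>y\<close> provides
      such a point.\<close>
    have far: "\<exists>z\<in>D. r2 < dist z w"
      using d' distF[of d'] l by (intro bexI[of _ "y + d' *\<^sub>R (y - x)"]) auto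
    have away: "f u \<notin> Some ` cball c R" if "s \<le> chordal (f x) (f u)" "R < s" for u R
    proof
      assume "f u \<in> Some ` cball c R"
      then obtain z where "f u = Some z" "dist c z \<le> R" by auto
      then show False using chordal_le_dist[of c z] that c by (simp add: dist_norm)
    qed
    have sph: "Some ` sphere c R \<subseteq> f ` D" if R: "R < s" for R
    proof -
      have "chordal (f x) (Some z) \<le> s" if "dist c z = R" for z
        using chordal_le_dist[of c z] that R c by (simp add: dist_norm)
      then show ?thesis using cap by auto
    qed
    have near: "f x \<in> Some ` ball c R" "f y \<in> Some ` ball c R" if "R0 < R" for R
    proof -
      have "0 < R" using that R0 by linarith
      then have "c \<in> ball c R" "c' \<in> ball c R" using that by (auto simp: R0_def dist_norm)
      then show "f x \<in> Some ` ball c R" "f y \<in> Some ` ball c R" unfolding c by blast+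
    qed
    have hyp: "\<forall>R. R0 < R \<longrightarrow> R < s \<longrightarrow> Some ` sphere c R \<subseteq> f ` D
          \<and> image_crosses f E c R \<and> image_crosses f F c R"
      using near away sph d(3) d'(3) E F by (intro allI impI conjI) blast+
    define \<eta> where "\<eta> = (\<lambda>r::real. ennreal (1 / l))"
    have \<eta>: "\<eta> \<in> borel_measurable borel" "1 \<le> (\<integral>\<^sup>+r\<in>{r1<..<r2}. \<eta> r \<partial>lborel)"
    proof -
      have "(\<integral>\<^sup>+r\<in>{r1<..<r2}. \<eta> r \<partial>lborel) = ennreal (1 / l) * ennreal l"
        unfolding \<eta>_def using r12 by (subst nn_integral_cmult_indicator) (auto simp: r1_def r2_def)
      also have "\<dots> = 1" using l by (simp add: ennreal_mult'[symmetric])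
      finally show "1 \<le> (\<integral>\<^sup>+r\<in>{r1<..<r2}. \<eta> r \<partial>lborel)" by simp
    qed (simp add: \<eta>_def)
    have "ennreal (c0 * ln (s / R0)) \<le> ring_image_modulus f D w r1 r2"
      by (rule mod[THEN spec[of _ D], THEN spec[of _ f], THEN spec[of _ w], THEN spec[of _ r1], THEN spec[of _ r2], THEN spec[of _ c],
            THEN spec[of _ R0], THEN spec[of _ s], THEN spec[of _ E], THEN spec[of _ F], THEN mp], intro conjI)
         (rule hom r12 R0 E FD ED F hyp)+
    also have "\<dots> \<le> (\<integral>\<^sup>+z\<in>annulus w r1 r2 \<inter> D. Q z * \<eta> (dist z w) ^ ?n \<partial>lebesgue)"
      by (rule ring_Q_ineqD[OF ring_familyD(2)[OF f w] r12 far \<eta>])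
    also have "\<dots> \<le> (\<integral>\<^sup>+z. ennreal (1 / l ^ ?n) * (Q z * indicator D z) \<partial>lebesgue)"
      using l by (intro nn_integral_mono) (auto simp: \<eta>_def indicator_def ennreal_power power_one_over mult.commute)
    also have "\<dots> = ennreal (1 / l ^ ?n) * (\<integral>\<^sup>+z\<in>D. Q z \<partial>lebesgue)"
      using Qm D by (intro nn_integral_cmult) (subst (asm) borel_measurable_restrict_space_iff_ennreal, auto)
    also have "\<dots> = ennreal (1 / l ^ ?n * I)" unfolding I(1) using I(2) l by (subst ennreal_mult) auto
    finally have "c0 * ln (s / R0) \<le> 1 / l ^ ?n * I" using I l by (subst (asm) ennreal_le_iff) auto
    then have "ln (s / R0) \<le> I / (c0 * l ^ ?n)" using c0 l by (simp add: field_simps)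
    then have "exp (ln (s / R0)) \<le> exp (I / (c0 * l ^ ?n))" by simp
    then have "s / R0 \<le> exp (I / (c0 * l ^ ?n))" using s R0 by simp
    then have "s \<le> exp (I / (c0 * l ^ ?n)) * R0" using R0 by (simp add: field_simps)
    then have "s * exp (- (I / (c0 * l ^ ?n))) \<le> exp (I / (c0 * l ^ ?n)) * R0 * exp (- (I / (c0 * l ^ ?n)))"
      by (rule mult_right_mono) simp
    also have "\<dots> = R0" by (simp add: exp_minus)
    finally have "s * exp (- (I / (c0 * l ^ ?n))) \<le> R0" .
    moreover have "- (2 * I) / ((2 * c0) * l ^ ?n) = - (I / (c0 * l ^ ?n))" using c0 l by (simp add: field_simps)
    ultimately show ?thesis using c by (simp only: l_def R0_def option.sel)
  qed
  show ?thesis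
    unfolding I_def[symmetric]
    using c0 s(1) main by (intro exI[of _ "2 * c0"] conjI exI[of _ s]) auto
qed

text \<open>The restriction to \<open>x \<noteq> y\<close> reflects that division by zero would make
  the exponential equal to 1 on the diagonal. Using \<open>the\<close> loses nothing there, as all
  values are finite.\<close>

theorem theorem2:
  fixes D K :: "'a::euclidean_space set" and Q :: "'a \<Rightarrow> ennreal" and \<delta> :: real
  assumes "DIM('a) \<ge> 2"
    and "open D" and "connected D" and "D \<noteq> {}"
    and "Q \<in> borel_measurable (restrict_space lebesgue D)"
    and "compact K" and "K \<subseteq> D" and "\<delta> > 0"
    and "sphere_integrable_cond D Q"
  shows "(bounded D \<longrightarrow> equi_uniform (ring_family \<delta> K Q D) K
                          \<and> uniformly_light (ring_family \<delta> K Q D) K)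
       \<and> ((\<integral>\<^sup>+ x \<in> D. Q x \<partial>lebesgue) < \<infinity> \<and> (\<forall>f\<in>ring_family \<delta> K Q D. \<forall>x\<in>D. f x \<noteq> None)
          \<longrightarrow> (\<exists>C>0. \<exists>C1>0. \<forall>f\<in>ring_family \<delta> K Q D. \<forall>x\<in>K. \<forall>y\<in>K. x \<noteq> y \<longrightarrow>
                 norm (the (f x) - the (f y))
                   \<ge> C1 * exp (- (2 * enn2real (\<integral>\<^sup>+ x \<in> D. Q x \<partial>lebesgue)) / (C * norm (x - y) ^ DIM('a)))))"
proof (intro conjI impI)
  assume "bounded D"
  then show "equi_uniform (ring_family \<delta> K Q D) K"
    using assms by (intro ring_family_equi_uniform) auto
  then show "uniformly_light (ring_family \<delta> K Q D) K" by (rule equi_uniform_imp_uniformly_light)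
next
  assume "(\<integral>\<^sup>+ x \<in> D. Q x \<partial>lebesgue) < \<infinity> \<and> (\<forall>f\<in>ring_family \<delta> K Q D. \<forall>x\<in>D. f x \<noteq> None)"
  then show "\<exists>C>0. \<exists>C1>0. \<forall>f\<in>ring_family \<delta> K Q D. \<forall>x\<in>K. \<forall>y\<in>K. x \<noteq> y \<longrightarrow>
                 norm (the (f x) - the (f y))
                   \<ge> C1 * exp (- (2 * enn2real (\<integral>\<^sup>+ x \<in> D. Q x \<partial>lebesgue)) / (C * norm (x - y) ^ DIM('a)))"
    using assms by (intro ring_family_lower_bound) auto
qed

end
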